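(* Let $\Bbbk$ be a field and $I$ a monomial ideal in $R=\Bbbk[x_1,\dots,x_m]$. There exist an hcw-poset $Q$ over $\Bbbk$ and a morphism of posets $\deg\colon Q\to\mathbb Z^m$ such that the minimal free $\mathbb Z^m$-graded resolution of $I$ over $R$ is supported on $Q$, i.e. it is isomorphic to the homogenization of the conic chain complex $\mathcal C_\bullet(Q,\Bbbk)$ with respect to $\deg$.
   Context: For a finite poset $Q$ and $a\in Q$: $Q_{\le a},Q_{<a}$ the sets of elements $\le a$, $<a$; $\Delta(S)$ the order complex; $d(a)=\dim\Delta(Q_{\le a})$; $Q^n=\{a:d(a)\le n\}$, $\Delta^n=\Delta(Q^n)$, $\Delta^{-1}=\emptyset$; faces oriented by decreasing order. $Q$ is an hcw-poset over $\Bbbk$ if for each $a$, $\widetilde H_i(\Delta(Q_{<a});\Bbbk)\cong\Bbbk$ for $i=\dim\Delta(Q_{<a})$ and $0$ otherwise (empty complex: dimension $-1$, $\widetilde H_{-1}=\Bbbk$). Conic chain complex: $\mathcal C_n(Q,\Bbbk)=H_n(\Delta^n,\Delta^{n-1};\Bbbk)=\bigoplus_{d(a)=n}H_n(\Delta(Q_{\le a}),\Delta(Q_{<a});\Bbbk)$ with differential $\partial_n=\iota_{n-1}\circ\delta_n$ ($\delta_n$ the connecting map of $(\Delta^n,\Delta^{n-1})$, $\iota_{n-1}\colon\widetilde H_{n-1}(\Delta^{n-1})\to H_{n-1}(\Delta^{n-1},\Delta^{n-2})$ the natural map). It is $Q$-graded with $F_{n,a}=H_n(\Delta(Q_{\le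 a}),\Delta(Q_{<a});\Bbbk)$ if $n=d(a)$ and $0$ otherwise; $f_n^b(x)$ is the component of $\partial_n(x)$ in $F_{n-1,b}$. Homogenization with respect to $\deg$: the complex of $\mathbb Z^m$-graded $R$-modules $\widehat F_n=\bigoplus_aF_{n,a}\otimes_\Bbbk R(-\deg a)$ with $\hat f_n(x\otimes1)=\sum_{b\le a}f_n^b(x)\otimes x^{\deg a-\deg b}$ for $x\in F_{n,a}$. *)

theory Defs
  imports Main "HOL-Library.Poly_Mapping"
begin

definition Rpoly :: "nat \<Rightarrow> ((nat \<Rightarrow>\<^sub>0 nat) \<Rightarrow>\<^sub>0 'k::comm_ring_1) set" where
  "Rpoly m = {p. \<forall>u\<in>Poly_Mapping.keys p. Poly_Mapping.keys u \<subseteq> {..<m}}"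

definition monom :: "(nat \<Rightarrow>\<^sub>0 nat) \<Rightarrow> ((nat \<Rightarrow>\<^sub>0 nat) \<Rightarrow>\<^sub>0 'k::comm_ring_1)" where
  "monom u = Poly_Mapping.single u 1"

definition monomial_ideal :: "nat \<Rightarrow> ((nat \<Rightarrow>\<^sub>0 nat) \<Rightarrow>\<^sub>0 'k::comm_ring_1) set \<Rightarrow> bool" where
  "monomial_ideal m I \<longleftrightarrow> (\<exists>G. (\<forall>u\<in>G. Poly_Mapping.keys u \<subseteq> {..<m}) \<and>
     I = {p. \<exists>F r. finite F \<and> F \<subseteq> G \<and> (\<forall>g\<in>F. r g \<in> Rpoly m) \<and>
                    p = (\<Sum>g\<in>F. r g * monom g)})"

definition Rdeg :: "nat \<Rightarrow> (nat \<Rightarrow> int) \<Rightarrow> ((nat \<Rightarrow>\<^sub>0 nat) \<Rightarrow>\<^sub>0 'k::comm_ring_1) set" where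
  "Rdeg m c = {p. \<forall>u\<in>Poly_Mapping.keys p. Poly_Mapping.keys u \<subseteq> {..<m} \<and> (\<forall>i<m. int (Poly_Mapping.lookup u i) = c i)}"

definition vle :: "nat \<Rightarrow> (nat \<Rightarrow> int) \<Rightarrow> (nat \<Rightarrow> int) \<Rightarrow> bool" where
  "vle m u v \<longleftrightarrow> (\<forall>i<m. u i \<le> v i)"

definition nonneg :: "nat \<Rightarrow> (nat \<Rightarrow> int) \<Rightarrow> bool" where
  "nonneg m c \<longleftrightarrow> (\<forall>i<m. 0 \<le> c i)"

definition is_poset :: "nat set \<Rightarrow> (nat \<Rightarrow> nat \<Rightarrow> bool) \<Rightarrow> bool" where
  "is_poset Q le \<longleftrightarrow> finite Q \<and> (\<forall>a\<in>Q. le a a) \<and>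
     (\<forall>a\<in>Q. \<forall>b\<in>Q. le a b \<and> le b a \<longrightarrow> a = b) \<and>
     (\<forall>a\<in>Q. \<forall>b\<in>Q. \<forall>c\<in>Q. le a b \<and> le b c \<longrightarrow> le a c)"

definition lt :: "(nat \<Rightarrow> nat \<Rightarrow> bool) \<Rightarrow> nat \<Rightarrow> nat \<Rightarrow> bool" where
  "lt le a b \<longleftrightarrow> le a b \<and> a \<noteq> b"

definition poset_morphism :: "nat \<Rightarrow> nat set \<Rightarrow> (nat \<Rightarrow> nat \<Rightarrow> bool) \<Rightarrow> (nat \<Rightarrow> nat \<Rightarrow> int) \<Rightarrow> bool" where
  "poset_morphism m Q le deg \<longleftrightarrow> (\<forall>a\<in>Q. \<forall>b\<in>Q. le a b \<longrightarrow> vle m (deg a) (deg b))"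

definition Qle :: "(nat \<Rightarrow> nat \<Rightarrow> bool) \<Rightarrow> nat set \<Rightarrow> nat \<Rightarrow> nat set" where
  "Qle le Q a = {b\<in>Q. le b a}"

definition Qlt :: "(nat \<Rightarrow> nat \<Rightarrow> bool) \<Rightarrow> nat set \<Rightarrow> nat \<Rightarrow> nat set" where
  "Qlt le Q a = {b\<in>Q. lt le b a}"

text \<open>Oriented simplices of the order complex of S: chains listed in decreasing order.
  The list of length n is a simplex of dimension n-1 (the empty list is the empty simplex).\<close>
definition chains :: "(nat \<Rightarrow> nat \<Rightarrow> bool) \<Rightarrow> nat set \<Rightarrow> nat list set" where
  "chains le S = {\<sigma>. set \<sigma> \<subseteq> S \<and> sorted_wrt (\<lambda>x y. lt le y x) \<sigma>}"

definition chains_len :: "(nat \<Rightarrow> nat \<Rightarrow> bool) \<Rightarrow> nat set \<Rightarrow> nat \<Rightarrow> nat list set" where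
  "chains_len le S n = {\<sigma>\<in>chains le S. length \<sigma> = n}"

text \<open>maxlen = dim Delta(S) + 1.\<close>
definition maxlen :: "(nat \<Rightarrow> nat \<Rightarrow> bool) \<Rightarrow> nat set \<Rightarrow> nat" where
  "maxlen le S = Max (length ` chains le S)"

definition chainsp :: "(nat \<Rightarrow> nat \<Rightarrow> bool) \<Rightarrow> nat set \<Rightarrow> nat \<Rightarrow> (nat list \<Rightarrow> 'k::zero) set" where
  "chainsp le S n = {c. \<forall>\<sigma>. \<sigma> \<notin> chains_len le S n \<longrightarrow> c \<sigma> = 0}"

definition del_nth :: "nat \<Rightarrow> 'a list \<Rightarrow> 'a list" where
  "del_nth i xs = take i xs @ drop (Suc i) xs"

definition bd :: "(nat \<Rightarrow> nat \<Rightarrow> bool) \<Rightarrow> nat set \<Rightarrow> nat \<Rightarrow> (nat list \<Rightarrow> 'k::comm_ring_1) \<Rightarrow> (nat list \<Rightarrow> 'k)" where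
  "bd le S n c = (\<lambda>\<sigma>. \<Sum>\<tau>\<in>chains_len le S (Suc n). \<Sum>i<Suc n.
      if del_nth i \<tau> = \<sigma> then (-1) ^ i * c \<tau> else 0)"

definition rcyc :: "(nat \<Rightarrow> nat \<Rightarrow> bool) \<Rightarrow> nat set \<Rightarrow> nat \<Rightarrow> (nat list \<Rightarrow> 'k::comm_ring_1) set" where
  "rcyc le S n = {c\<in>chainsp le S n. \<forall>n'. n = Suc n' \<longrightarrow> bd le S n' c = (\<lambda>_. 0)}"

definition rbnd :: "(nat \<Rightarrow> nat \<Rightarrow> bool) \<Rightarrow> nat set \<Rightarrow> nat \<Rightarrow> (nat list \<Rightarrow> 'k::comm_ring_1) set" where
  "rbnd le S n = bd le S n ` chainsp le S (Suc n)"

definition quot_iso_k :: "(nat list \<Rightarrow> 'k::field) set \<Rightarrow> (nat list \<Rightarrow> 'k) set \<Rightarrow> bool" where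
  "quot_iso_k Z B \<longleftrightarrow> (\<exists>\<phi> :: (nat list \<Rightarrow> 'k) \<Rightarrow> 'k.
      (\<forall>x\<in>Z. \<forall>y\<in>Z. \<phi> (\<lambda>\<sigma>. x \<sigma> + y \<sigma>) = \<phi> x + \<phi> y) \<and>
      (\<forall>r. \<forall>x\<in>Z. \<phi> (\<lambda>\<sigma>. r * x \<sigma>) = r * \<phi> x) \<and>
      \<phi> ` Z = UNIV \<and> {x\<in>Z. \<phi> x = 0} = B)"

definition hcw_poset :: "'k::field itself \<Rightarrow> nat set \<Rightarrow> (nat \<Rightarrow> nat \<Rightarrow> bool) \<Rightarrow> bool" where
  "hcw_poset _ Q le \<longleftrightarrow> is_poset Q le \<and>
     (\<forall>a\<in>Q. \<forall>n. let S = Qlt le Q a in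
        (n = maxlen le S \<longrightarrow> quot_iso_k (rcyc le S n :: (nat list \<Rightarrow> 'k) set) (rbnd le S n)) \<and>
        (n \<noteq> maxlen le S \<longrightarrow> (rcyc le S n :: (nat list \<Rightarrow> 'k) set) \<subseteq> rbnd le S n))"

text \<open>d(a) = dim Delta(Q_{<=a}); Qup le Q k = Q^{k-1} = {a. d(a) < k}.\<close>
definition dd :: "(nat \<Rightarrow> nat \<Rightarrow> bool) \<Rightarrow> nat set \<Rightarrow> nat \<Rightarrow> nat" where
  "dd le Q a = maxlen le (Qle le Q a) - 1"

definition Qup :: "(nat \<Rightarrow> nat \<Rightarrow> bool) \<Rightarrow> nat set \<Rightarrow> nat \<Rightarrow> nat set" where
  "Qup le Q k = {a\<in>Q. dd le Q a < k}"

definition conic :: "(nat \<Rightarrow> nat \<Rightarrow> bool) \<Rightarrow> nat set \<Rightarrow> nat \<Rightarrow> (nat list \<Rightarrow> 'k::comm_ring_1) set" where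
  "conic le Q n = {c. (\<forall>\<sigma>. c \<sigma> \<noteq> 0 \<longrightarrow> \<sigma> \<in> chains_len le (Qup le Q (Suc n)) (Suc n) \<and>
                                     \<sigma> \<notin> chains_len le (Qup le Q n) (Suc n)) \<and>
      (0 < n \<longrightarrow> (\<forall>\<sigma>. \<sigma> \<notin> chains_len le (Qup le Q n) n \<longrightarrow> bd le Q n c \<sigma> = 0))}"

definition Fna :: "(nat \<Rightarrow> nat \<Rightarrow> bool) \<Rightarrow> nat set \<Rightarrow> nat \<Rightarrow> nat \<Rightarrow> (nat list \<Rightarrow> 'k::comm_ring_1) set" where
  "Fna le Q n a = {c\<in>conic le Q n. \<forall>\<sigma>. c \<sigma> \<noteq> 0 \<longrightarrow> hd \<sigma> = a}"

definition fcomp :: "(nat \<Rightarrow> nat \<Rightarrow> bool) \<Rightarrow> nat set \<Rightarrow> nat \<Rightarrow> nat \<Rightarrow> (nat list \<Rightarrow> 'k::comm_ring_1) \<Rightarrow> (nat list \<Rightarrow> 'k)" where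
  "fcomp le Q n b x = (\<lambda>\<sigma>. if \<sigma> \<noteq> [] \<and> hd \<sigma> = b then bd le Q n x \<sigma> else 0)"

text \<open>Multidegree-c component of the homogenization: (hat F_n)_c is the direct sum of the
  F_{n,a} with deg a <= c (each x in F_{n,a} standing for x (x) x^(c - deg a)); in this
  degree the homogenized differential is the conic differential.\<close>
definition hstrand :: "(nat \<Rightarrow> nat \<Rightarrow> bool) \<Rightarrow> nat set \<Rightarrow> (nat \<Rightarrow> nat \<Rightarrow> int) \<Rightarrow> nat \<Rightarrow> nat \<Rightarrow> (nat \<Rightarrow> int)
     \<Rightarrow> (nat list \<Rightarrow> 'k::comm_ring_1) set" where
  "hstrand le Q deg m n c = {x\<in>conic le Q n. \<forall>\<sigma>. x \<sigma> \<noteq> 0 \<longrightarrow> vle m (deg (hd \<sigma>)) c}"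

text \<open>The homogenization of C(Q,k) w.r.t. deg is a minimal free Z^m-graded resolution of I:
  there is a graded R-linear augmentation hat F_0 -> I (determined by e: the generator [a] of
  F_{0,a} goes to e a * x^(deg a)) onto I, the augmented complex is exact (checked in every
  multidegree c), and the differentials have image in m * hat F (no unit entries: f_n^b = 0
  whenever deg b = deg a).\<close>
definition homog_min_free_res :: "nat \<Rightarrow> ((nat \<Rightarrow>\<^sub>0 nat) \<Rightarrow>\<^sub>0 'k::field) set \<Rightarrow> nat set \<Rightarrow>
     (nat \<Rightarrow> nat \<Rightarrow> bool) \<Rightarrow> (nat \<Rightarrow> nat \<Rightarrow> int) \<Rightarrow> bool" where
  "homog_min_free_res m I Q le deg \<longleftrightarrow>
    (\<exists>e :: nat \<Rightarrow> 'k.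
      (\<forall>a\<in>Q. e a \<noteq> 0 \<longrightarrow> nonneg m (deg a)) \<and>
      (\<forall>c. (\<forall>u. Poly_Mapping.keys u \<subseteq> {..<m} \<and> (\<forall>i<m. c i = int (Poly_Mapping.lookup u i)) \<longrightarrow>
              I \<inter> Rdeg m c =
              (\<lambda>x. Poly_Mapping.single u (\<Sum>a\<in>Q. e a * x [a])) ` hstrand le Q deg m 0 c) \<and>
           {x\<in>hstrand le Q deg m 0 c. (\<Sum>a\<in>Q. e a * x [a]) = 0} =
              bd le Q 1 ` hstrand le Q deg m 1 c \<and>
           (\<forall>n\<ge>1. {x\<in>(hstrand le Q deg m n c :: (nat list \<Rightarrow> 'k) set). bd le Q n x = (\<lambda>_. 0)} =
              bd le Q (Suc n) ` hstrand le Q deg m (Suc n) c))) \<and>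
    (\<forall>n\<ge>1. \<forall>a\<in>Q. \<forall>b\<in>Q. (\<forall>i<m. deg b i = deg a i) \<longrightarrow>
        (\<forall>x\<in>(Fna le Q n a :: (nat list \<Rightarrow> 'k) set). fcomp le Q n b x = (\<lambda>_. 0)))"

end

theory Submission
  imports Defs "HOL-Library.Countable"
begin

text \<open>The poset is built one cell at a time, over the degrees \<open>\<alpha>\<close> of a large finite box in an order
  compatible with divisibility and, for fixed \<open>\<alpha>\<close>, by increasing dimension. Suppose that the degree \<open>\<alpha>\<close>
  strand is exact below level \<open>l\<close> but has a cycle at level \<open>l\<close> that is not a boundary. Among the sets \<open>S\<close>
  of cells of dimension \<open>l - 1\<close> and degree at most \<open>\<alpha>\<close> that support such a cycle and have the same
  boundaries as all these cells, take one of least cardinality. Exchange arguments show that the cycles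
  on \<open>S\<close> form a line, so the down-set \<open>D\<close> consisting of \<open>S\<close> and \<^emph>\<open>all\<close> cells of smaller dimension and
  degree at most \<open>\<alpha>\<close> has the homology of a sphere. A new cell of degree \<open>\<alpha>\<close> is put on top of \<open>D\<close>; the
  order may have more relations than the one generated by the nonzero coefficients of the differential. Since the
  new boundary was not a boundary before, no cycle of degree \<open>\<alpha>\<close> ever involves a cell of degree \<open>\<alpha>\<close>,
  which gives minimality and also exactness in all large dimensions.\<close>

section \<open>Chains and boundaries\<close>

text \<open>What has to be forced is the hcw condition on \<open>D\<close>, and the two demands on
  \<open>S\<close> serve its two halves. Least cardinality makes the top cycles a line. Equality of
  boundaries is needed one dimension lower: a cycle there bounds in the strand by exactness, but the
  chain that it bounds may use cells outside \<open>S\<close> and has to be replaced by one on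
  \<open>S\<close>. In still lower dimensions nothing is replaced, because no cell of the strand was
  left out of \<open>D\<close>. Simplicial cycles of \<open>D\<close> and cycles of the strand are
  related through the older cells: since their links are homology spheres, a simplicial cycle can be
  deformed into a conic one, and since the top cycles of each link form a line, a cell behaves like
  one coordinate in the exchange arguments. A cell attached for level \<open>l\<close> enlarges the
  boundaries of degree \<alpha> at level \<open>l\<close>, but not the cycles there, so finitely
  many attachments settle the level; exactness below \<open>l\<close>, on which the acyclicity of
  \<open>D\<close> rests, is not disturbed. The edge of the box comes from Dickson's lemma.\<close>

lemma Nil_in_chains [simp]: "[] \<in> chains le S"
  by (simp add: chains_def)

lemma Cons_in_chains: "a # \<sigma> \<in> chains le S \<longleftrightarrow> a \<in> S \<and> \<sigma> \<in> chains le (Qlt le S a)"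
  by (auto simp: chains_def Qlt_def)

lemma chains_mono: "S \<subseteq> T \<Longrightarrow> chains le S \<subseteq> chains le T"
  by (auto simp: chains_def)

lemma chains_distinct: "\<sigma> \<in> chains le S \<Longrightarrow> distinct \<sigma>"
proof -
  have "sorted_wrt (\<lambda>x y. lt le y x) \<sigma> \<Longrightarrow> distinct \<sigma>" for \<sigma>
    by (induction \<sigma>) (auto simp: lt_def)
  then show "\<sigma> \<in> chains le S \<Longrightarrow> distinct \<sigma>" by (auto simp: chains_def)
qed

lemma finite_chains:
  assumes "finite S" shows "finite (chains le S)"
proof (rule finite_subset)
  show "chains le S \<subseteq> {xs. set xs \<subseteq> S \<and> length xs \<le> card S}"
  proof
    fix \<sigma> assume s: "\<sigma> \<in> chains le S"
    then have "card (set \<sigma>) = length \<sigma>" by (simp add: chains_distinct distinct_card)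
    with s assms show "\<sigma> \<in> {xs. set xs \<subseteq> S \<and> length xs \<le> card S}"
      by (metis (mono_tags, lifting) card_mono chains_def mem_Collect_eq)
  qed
  show "finite {xs. set xs \<subseteq> S \<and> length xs \<le> card S}"
    using assms by (rule finite_lists_length_le)
qed

lemma finite_chains_len: "finite S \<Longrightarrow> finite (chains_len le S n)"
  by (simp add: chains_len_def finite_chains)

lemma finite_Qlt: "finite S \<Longrightarrow> finite (Qlt le S a)"
  by (simp add: Qlt_def)

lemma length_le_maxlen: "finite S \<Longrightarrow> \<sigma> \<in> chains le S \<Longrightarrow> length \<sigma> \<le> maxlen le S"
  by (simp add: maxlen_def finite_chains)

lemma maxlen_attained:
  assumes "finite S" obtains \<sigma> where "\<sigma> \<in> chains le S" "length \<sigma> = maxlen le S"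
proof -
  have "maxlen le S \<in> length ` chains le S"
    unfolding maxlen_def by (rule Max_in) (use assms in \<open>auto simp: finite_chains intro: Nil_in_chains\<close>)
  then show thesis using that by auto
qed

lemma maxlen_eqI:
  assumes "finite S" "\<And>\<sigma>. \<sigma> \<in> chains le S \<Longrightarrow> length \<sigma> \<le> n" "\<tau> \<in> chains le S" "length \<tau> = n"
  shows "maxlen le S = n"
  by (metis assms length_le_maxlen maxlen_attained antisym)

lemma chainsp_Cons:
  "c \<in> chainsp le S (Suc n) \<Longrightarrow> (\<lambda>\<tau>. c (a # \<tau>)) \<in> chainsp le (Qlt le S a) n"
  by (auto simp: chainsp_def chains_len_def Cons_in_chains)

lemma chainsp_nonzeroD: "c \<in> chainsp le S n \<Longrightarrow> c \<sigma> \<noteq> 0 \<Longrightarrow> \<sigma> \<in> chains le S \<and> length \<sigma> = n"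
  by (auto simp: chainsp_def chains_len_def)

lemma chainsp_mono: "S \<subseteq> T \<Longrightarrow> chainsp le S n \<subseteq> chainsp le T n"
  using chains_mono[of S T le] by (fastforce simp: chainsp_def chains_len_def)

text \<open>The simplicial boundary, stripped of the order: every way of inserting a vertex into
  \<open>\<sigma>\<close> contributes, with the sign of the position.\<close>

primrec dl :: "nat set \<Rightarrow> nat list \<Rightarrow> (nat list \<Rightarrow> 'k::comm_ring_1) \<Rightarrow> 'k" where
  "dl A [] c = (\<Sum>a\<in>A. c [a])"
| "dl A (b # \<sigma>) c = (\<Sum>a\<in>A. c (a # b # \<sigma>)) - dl A \<sigma> (\<lambda>\<tau>. c (b # \<tau>))"

lemma dl_zero: "dl A \<sigma> (\<lambda>_. 0) = 0"
  by (induction \<sigma>) auto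

lemma dl_add_mult: "dl A \<sigma> (\<lambda>\<tau>. x \<tau> + r * y \<tau>) = dl A \<sigma> x + r * dl A \<sigma> y"
  by (induction \<sigma> arbitrary: x y) (simp_all add: sum.distrib sum_distrib_left algebra_simps)

lemma dl_sum: "finite B \<Longrightarrow> dl A \<sigma> (\<lambda>\<tau>. \<Sum>b\<in>B. f b \<tau>) = (\<Sum>b\<in>B. dl A \<sigma> (f b))"
proof (induction B rule: finite_induct)
  case (insert b B)
  then show ?case using dl_add_mult[of A \<sigma> "f b" 1 "\<lambda>\<tau>. \<Sum>b\<in>B. f b \<tau>"] by simp
qed (simp add: dl_zero)

text \<open>The usual cancellation behind d d = 0, valid for every function on lists. With
  \<open>b\<close> at the head, two insertions in front of \<open>b\<close> cancel, mixed insertions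
  occur twice with opposite signs, and two insertions behind \<open>b\<close> are the induction
  hypothesis.\<close>

lemma dl_dl:
  assumes "finite A" shows "dl A \<sigma> (\<lambda>\<tau>. dl A \<tau> c) = 0"
proof (induction \<sigma> arbitrary: c)
  case Nil
  have "(\<Sum>a\<in>A. \<Sum>x\<in>A. c [x, a]) = (\<Sum>a\<in>A. \<Sum>x\<in>A. c [a, x])" by (rule sum.swap)
  then show ?case by (simp add: sum_subtractf)
next
  case (Cons b \<sigma>)
  define e where "e = (\<lambda>\<tau>. \<Sum>a\<in>A. c (a # \<tau>))"
  have 1: "(\<Sum>a\<in>A. dl A (b # \<sigma>) (\<lambda>\<tau>. c (a # \<tau>))) = dl A (b # \<sigma>) e"
    unfolding e_def by (rule dl_sum[OF assms, symmetric])
  have 2: "(\<lambda>\<tau>. dl A (b # \<tau>) c) = (\<lambda>\<tau>. e (b # \<tau>) + (-1) * dl A \<tau> (\<lambda>\<tau>. c (b # \<tau>)))"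
    by (simp add: e_def)
  have 3: "(\<Sum>a\<in>A. dl A (a # b # \<sigma>) c)
      = (\<Sum>a\<in>A. e (a # b # \<sigma>)) - (\<Sum>a\<in>A. dl A (b # \<sigma>) (\<lambda>\<tau>. c (a # \<tau>)))"
    by (simp add: e_def sum_subtractf)
  have "dl A (b # \<sigma>) (\<lambda>\<tau>. dl A \<tau> c)
      = (\<Sum>a\<in>A. dl A (a # b # \<sigma>) c) - dl A \<sigma> (\<lambda>\<tau>. dl A (b # \<tau>) c)" by simp
  also have "\<dots> = 0"
    unfolding 3 1 2 dl_add_mult Cons.IH by simp
  finally show ?case .
qed

lemma dl_length0: "(\<And>\<tau>. \<tau> \<noteq> [] \<Longrightarrow> c \<tau> = 0) \<Longrightarrow> dl A \<sigma> c = 0"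
  by (induction \<sigma> arbitrary: c) (auto simp: dl_zero)

lemma chains_len_Suc:
  "chains_len le S (Suc n) = (\<Union>a\<in>S. (#) a ` chains_len le (Qlt le S a) n)"
proof (rule set_eqI)
  fix \<sigma> show "\<sigma> \<in> chains_len le S (Suc n) \<longleftrightarrow> \<sigma> \<in> (\<Union>a\<in>S. (#) a ` chains_len le (Qlt le S a) n)"
    by (cases \<sigma>) (auto simp: chains_len_def Cons_in_chains)
qed

lemma sum_chains_len_Suc:
  assumes "finite S"
  shows "(\<Sum>\<tau>\<in>chains_len le S (Suc n). g \<tau>)
    = (\<Sum>a\<in>S. \<Sum>\<tau>\<in>chains_len le (Qlt le S a) n. g (a # \<tau>) :: 'b::comm_monoid_add)"
proof -
  have "(\<Sum>\<tau>\<in>chains_len le S (Suc n). g \<tau>)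
      = (\<Sum>a\<in>S. \<Sum>\<tau>\<in>(#) a ` chains_len le (Qlt le S a) n. g \<tau>)"
    unfolding chains_len_Suc
    by (rule sum.UNION_disjoint) (use assms in \<open>auto simp: finite_chains_len finite_Qlt\<close>)
  also have "\<dots> = (\<Sum>a\<in>S. \<Sum>\<tau>\<in>chains_len le (Qlt le S a) n. g (a # \<tau>))"
    by (rule sum.cong[OF refl]) (subst sum.reindex, auto simp: inj_on_def)
  finally show ?thesis .
qed

lemma del_nth_0: "del_nth 0 (a # \<tau>) = \<tau>" and del_nth_Suc: "del_nth (Suc i) (a # \<tau>) = a # del_nth i \<tau>"
  by (simp_all add: del_nth_def)

text \<open>Grouping the cofaces of \<sigma> by their first vertex gives the recursion of
  \<open>dl\<close>: either the head was deleted, or it is kept and the deletion happens in its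
  link, one position later and hence with the opposite sign. The right side mentions neither
  \<open>S\<close> nor \<open>le\<close>, so boundaries in subposets and under modified orders
  become directly comparable.\<close>

lemma bd_eq_dl:
  assumes "finite A" "S \<subseteq> A" "c \<in> chainsp le S (Suc n)"
  shows "bd le S n c \<sigma> = dl A \<sigma> c"
  using assms(2,3)
proof (induction n arbitrary: S c \<sigma>)
  case (0 S c)
  have fS: "finite S" using 0 assms finite_subset by blast
  have z: "c (a # \<tau>) = 0" if "\<tau> \<noteq> [] \<or> a \<notin> S" for a \<tau>
    using that chainsp_nonzeroD[OF 0(2), of "a # \<tau>"] by (auto simp: Cons_in_chains)
  have c0: "chains_len le T 0 = {[]}" for T by (auto simp: chains_len_def)
  have "bd le S 0 c \<sigma> = (\<Sum>a\<in>S. if \<sigma> = [] then c [a] else 0)"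
    unfolding bd_def sum_chains_len_Suc[OF fS] c0 by (intro sum.cong refl) (auto simp: del_nth_0)
  also have "\<dots> = (\<Sum>a\<in>S. c (a # \<sigma>))" using z by (intro sum.cong) auto
  also have "\<dots> = (\<Sum>a\<in>A. c (a # \<sigma>))"
    by (rule sum.mono_neutral_left) (use assms 0 z in auto)
  also have "\<dots> = dl A \<sigma> c"
  proof (cases \<sigma>)
    case (Cons b \<sigma>')
    then show ?thesis using z by (simp add: dl_length0)
  qed simp
  finally show ?case .
next
  case (Suc n S c \<sigma>)
  have fS: "finite S" using Suc assms finite_subset by blast
  have z: "c (a # \<tau>) = 0" if "\<not> (a \<in> S \<and> \<tau> \<in> chains_len le (Qlt le S a) (Suc n))" for a \<tau>
    using that chainsp_nonzeroD[OF Suc(3), of "a # \<tau>"] by (auto simp: Cons_in_chains chains_len_def)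
  have split: "(\<Sum>i<Suc (Suc n). if del_nth i (a # \<tau>) = \<sigma> then (-1) ^ i * c (a # \<tau>) else 0)
      = (if \<tau> = \<sigma> then c (a # \<tau>) else 0)
        + (\<Sum>i<Suc n. if a # del_nth i \<tau> = \<sigma> then - ((-1) ^ i * c (a # \<tau>)) else 0)" for a \<tau>
    unfolding sum.lessThan_Suc_shift[of _ "Suc n"]
    by (simp add: del_nth_0 del_nth_Suc cong: if_cong)
  have one: "(\<Sum>\<tau>\<in>chains_len le (Qlt le S a) (Suc n). if \<tau> = \<sigma> then c (a # \<tau>) else 0) = c (a # \<sigma>)"
    if "a \<in> S" for a
    using z[of a \<sigma>] that by (simp add: finite_chains_len finite_Qlt fS)
  have "bd le S (Suc n) c \<sigma> = (\<Sum>a\<in>S. c (a # \<sigma>)) +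
    (\<Sum>a\<in>S. \<Sum>\<tau>\<in>chains_len le (Qlt le S a) (Suc n).
        \<Sum>i<Suc n. if a # del_nth i \<tau> = \<sigma> then - ((-1) ^ i * c (a # \<tau>)) else 0)"
    unfolding bd_def sum_chains_len_Suc[OF fS] split sum.distrib using one by simp
  also have "(\<Sum>a\<in>S. c (a # \<sigma>)) = (\<Sum>a\<in>A. c (a # \<sigma>))"
    by (rule sum.mono_neutral_left) (use assms Suc z in auto)
  also have "(\<Sum>a\<in>A. c (a # \<sigma>)) + (\<Sum>a\<in>S. \<Sum>\<tau>\<in>chains_len le (Qlt le S a) (Suc n).
        \<Sum>i<Suc n. if a # del_nth i \<tau> = \<sigma> then - ((-1) ^ i * c (a # \<tau>)) else 0) = dl A \<sigma> c"
  proof (cases \<sigma>)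
    case (Cons b \<sigma>')
    define g where "g = (\<lambda>a. \<Sum>\<tau>\<in>chains_len le (Qlt le S a) (Suc n).
        \<Sum>i<Suc n. if a # del_nth i \<tau> = b # \<sigma>' then - ((-1) ^ i * c (a # \<tau>)) else 0)"
    \<comment> \<open>Faces other than the first keep the head, so a chain with face
      \<open>b # \<sigma>'\<close> of this kind starts with \<open>b\<close>, and only the link of
      \<open>b\<close> contributes.\<close>
    have off: "g a = 0" if "a \<noteq> b" for a using that by (simp add: g_def)
    have "sum g S = - dl A \<sigma>' (\<lambda>\<tau>. c (b # \<tau>))"
    proof (cases "b \<in> S")
      case True
      have "sum g S = (\<Sum>a\<in>S. if a = b then g b else 0)" using off by (intro sum.cong) auto
      also have "\<dots> = g b" using True fS by simp
      also have "\<dots> = - bd le (Qlt le S b) n (\<lambda>\<tau>. c (b # \<tau>)) \<sigma>'"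
        unfolding bd_def sum_negf[symmetric] g_def by (intro sum.cong refl) auto
      also have "bd le (Qlt le S b) n (\<lambda>\<tau>. c (b # \<tau>)) \<sigma>' = dl A \<sigma>' (\<lambda>\<tau>. c (b # \<tau>))"
        using Suc.prems by (intro Suc.IH) (auto simp: Qlt_def dest: chainsp_Cons)
      finally show ?thesis .
    next
      case False
      then have "sum g S = 0" using off by (intro sum.neutral) metis
      then show ?thesis using False z by (simp add: dl_zero)
    qed
    then show ?thesis using Cons unfolding g_def by simp
  qed simp
  finally show ?case .
qed

section \<open>The conic complex\<close>

text \<open>Here \<open>n\<close> counts vertices, so these are cycles of dimension
  \<open>n - 1\<close> in the augmented complex; the empty simplex, \<open>n = 0\<close>, carries no
  condition.\<close>

lemma rcyc_iff:
  assumes "finite A" "S \<subseteq> A"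
  shows "c \<in> rcyc le S n \<longleftrightarrow> c \<in> chainsp le S n \<and> (n \<noteq> 0 \<longrightarrow> (\<forall>\<sigma>. dl A \<sigma> c = 0))"
proof (cases n)
  case (Suc k)
  have "bd le S k c = (\<lambda>_. 0) \<longleftrightarrow> (\<forall>\<sigma>. dl A \<sigma> c = 0)" if "c \<in> chainsp le S (Suc k)"
    using bd_eq_dl[OF assms that] by (simp add: fun_eq_iff)
  then show ?thesis unfolding rcyc_def Suc by auto
qed (auto simp: rcyc_def)

lemma rbnd_iff:
  assumes "finite A" "S \<subseteq> A"
  shows "c \<in> rbnd le S n \<longleftrightarrow> (\<exists>w\<in>chainsp le S (Suc n). c = (\<lambda>\<sigma>. dl A \<sigma> w))"
proof -
  have "bd le S n w = (\<lambda>\<sigma>. dl A \<sigma> w)" if "w \<in> chainsp le S (Suc n)" for w :: "nat list \<Rightarrow> 'a"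
    using bd_eq_dl[OF assms that] by (simp add: fun_eq_iff)
  then show ?thesis unfolding rbnd_def by auto
qed

lemma chainsp_add_mult:
  "x \<in> chainsp le S n \<Longrightarrow> y \<in> chainsp le S n \<Longrightarrow> (\<lambda>\<sigma>. x \<sigma> + r * y \<sigma>) \<in> chainsp le S n"
  for r :: "'k::comm_ring_1"
  by (simp add: chainsp_def)

lemma chainsp_zero: "(\<lambda>_. 0) \<in> chainsp le S n"
  by (simp add: chainsp_def)

lemma rcyc_add_mult:
  assumes "finite S" "x \<in> rcyc le S n" "y \<in> rcyc le S n"
  shows "(\<lambda>\<sigma>. x \<sigma> + r * y \<sigma>) \<in> rcyc le S n"
  using assms(2,3) unfolding rcyc_iff[OF assms(1) subset_refl]
  by (simp add: dl_add_mult chainsp_add_mult)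

lemma rcyc_zero: "finite S \<Longrightarrow> (\<lambda>_. 0) \<in> rcyc le S n"
  by (simp add: rcyc_iff[OF _ subset_refl] dl_zero chainsp_zero)

section \<open>Dimension of elements and the splitting of conic chains\<close>

lemma is_poset_finite: "is_poset Q le \<Longrightarrow> finite Q"
  by (simp add: is_poset_def)

lemma finite_QltI: "is_poset Q le \<Longrightarrow> finite (Qlt le Q a)"
  by (simp add: is_poset_def finite_Qlt)

lemma Qlt_Qlt:
  assumes "is_poset Q le" "a \<in> Q" "b \<in> Qlt le Q a"
  shows "Qlt le (Qlt le Q a) b = Qlt le Q b"
  using assms unfolding is_poset_def Qlt_def lt_def by blast

text \<open>A longest chain in \<open>Qle le Q a\<close> starts with \<open>a\<close>, and the
  subtraction in \<open>dd\<close> removes just this vertex. Thus \<open>dd le Q a\<close> is also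
  the vertex count of the top simplices below \<open>a\<close>, the index at which the link of
  \<open>a\<close> has its sphere class.\<close>

lemma dd_eq:
  assumes "is_poset Q le" "a \<in> Q"
  shows "dd le Q a = maxlen le (Qlt le Q a)"
proof -
  have fin: "finite (Qle le Q a)" using assms by (auto simp: is_poset_def Qle_def)
  obtain \<sigma> where s: "\<sigma> \<in> chains le (Qlt le Q a)" "length \<sigma> = maxlen le (Qlt le Q a)"
    using maxlen_attained[OF finite_QltI[OF assms(1)]] .
  have "maxlen le (Qle le Q a) = Suc (maxlen le (Qlt le Q a))"
  proof (rule maxlen_eqI[OF fin])
    have "Qlt le (Qle le Q a) a = Qlt le Q a" by (auto simp: Qlt_def Qle_def lt_def)
    then show "a # \<sigma> \<in> chains le (Qle le Q a)"
      using s assms by (simp add: Cons_in_chains) (auto simp: Qle_def is_poset_def)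
    show "length (a # \<sigma>) = Suc (maxlen le (Qlt le Q a))" using s by simp
  next
    fix \<tau> assume t: "\<tau> \<in> chains le (Qle le Q a)"
    show "length \<tau> \<le> Suc (maxlen le (Qlt le Q a))"
    proof (cases \<tau>)
      case (Cons b \<tau>')
      have b: "b \<in> Q" "le b a" "\<tau>' \<in> chains le (Qlt le (Qle le Q a) b)"
        using t by (auto simp: Cons Cons_in_chains Qle_def)
      have "Qlt le (Qle le Q a) b \<subseteq> Qlt le Q a"
        using assms b(1,2) unfolding is_poset_def Qlt_def Qle_def lt_def by blast
      then have "\<tau>' \<in> chains le (Qlt le Q a)" using b(3) chains_mono by blast
      then show ?thesis using length_le_maxlen[OF finite_QltI[OF assms(1)]] Cons by fastforce
    qed simp
  qed
  then show ?thesis by (simp add: dd_def)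
qed

lemma dd_ge_length:
  "is_poset Q le \<Longrightarrow> a # \<sigma> \<in> chains le Q \<Longrightarrow> length \<sigma> \<le> dd le Q a"
  by (simp add: Cons_in_chains dd_eq length_le_maxlen finite_QltI)

lemma dd_less:
  assumes "is_poset Q le" "a \<in> Q" "b \<in> Qlt le Q a"
  shows "dd le Q b < dd le Q a"
proof -
  have bQ: "b \<in> Q" using assms by (simp add: Qlt_def)
  obtain \<sigma> where s: "\<sigma> \<in> chains le (Qlt le Q b)" "length \<sigma> = maxlen le (Qlt le Q b)"
    using maxlen_attained[OF finite_QltI[OF assms(1)]] .
  have "b # \<sigma> \<in> chains le (Qlt le Q a)"
    using s assms by (simp add: Cons_in_chains Qlt_Qlt)
  then have "length (b # \<sigma>) \<le> maxlen le (Qlt le Q a)"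
    using length_le_maxlen[OF finite_QltI[OF assms(1)]] by blast
  then show ?thesis using s assms bQ by (simp add: dd_eq)
qed

text \<open>The \<open>n\<close> vertices below the head force its dimension to be at least
  \<open>n\<close>, and membership in the n-th skeleton bounds it by \<open>n\<close>. So the first
  vertex alone decides which summand a relative simplex belongs to.\<close>

lemma conic_support:
  assumes "is_poset Q le"
  shows "\<sigma> \<in> chains_len le (Qup le Q (Suc n)) (Suc n) \<and> \<sigma> \<notin> chains_len le (Qup le Q n) (Suc n) \<longleftrightarrow>
    (\<exists>a \<tau>. \<sigma> = a # \<tau> \<and> a \<in> Q \<and> dd le Q a = n \<and> \<tau> \<in> chains_len le (Qlt le Q a) n)" (is "?L \<longleftrightarrow> ?R")
proof
  assume L: ?L
  then obtain a \<tau> where s: "\<sigma> = a # \<tau>" by (cases \<sigma>) (auto simp: chains_len_def)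
  have up: "Qup le Q (Suc n) \<subseteq> Q" by (auto simp: Qup_def)
  then have "\<sigma> \<in> chains le Q" using L chains_mono unfolding chains_len_def by blast
  moreover from this have "n \<le> dd le Q a" using dd_ge_length[OF assms] L s by (auto simp: chains_len_def)
  moreover have "dd le Q a < Suc n" using L s by (simp add: chains_len_def Cons_in_chains Qup_def)
  ultimately show ?R using L s by (auto simp: chains_len_def Cons_in_chains)
next
  assume ?R
  then obtain a \<tau> where s: "\<sigma> = a # \<tau>" "a \<in> Q" "dd le Q a = n" "\<tau> \<in> chains_len le (Qlt le Q a) n" by blast
  have "Qlt le Q a \<subseteq> Qlt le (Qup le Q (Suc n)) a"
    using dd_less[OF assms s(2)] s(3) by (fastforce simp: Qup_def Qlt_def)
  then have "\<tau> \<in> chains le (Qlt le (Qup le Q (Suc n)) a)"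
    using s(4) chains_mono unfolding chains_len_def by blast
  then show ?L using s by (auto simp: chains_len_def Cons_in_chains Qup_def)
qed

text \<open>This is the splitting of the relative homology into the homology of the links. As
  \<open>dd\<close> drops strictly along a chain, a head of dimension \<open>n\<close> never has
  another vertex of dimension \<open>n\<close> below it; hence the relative boundary at
  \<open>a # \<sigma>\<close> is, up to sign, the boundary of the link of \<open>a\<close> at
  \<sigma>.\<close>

lemma conic_iff:
  assumes P: "is_poset Q le"
  shows "x \<in> conic le Q n \<longleftrightarrow> x [] = 0 \<and> (\<forall>a. (\<lambda>\<tau>. x (a # \<tau>)) \<in>
    (if a \<in> Q \<and> dd le Q a = n then rcyc le (Qlt le Q a) n else {\<lambda>_. 0}))"
proof -
  note fQ = is_poset_finite[OF P]
  define C where "C a = chains_len le (Qlt le Q a) n" for a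
  have sub: "Qlt le Q a \<subseteq> Q" for a by (auto simp: Qlt_def)
  have supp: "(\<forall>\<sigma>. x \<sigma> \<noteq> 0 \<longrightarrow> \<sigma> \<in> chains_len le (Qup le Q (Suc n)) (Suc n) \<and> \<sigma> \<notin> chains_len le (Qup le Q n) (Suc n))
     \<longleftrightarrow> x [] = 0 \<and> (\<forall>a \<tau>. x (a # \<tau>) \<noteq> 0 \<longrightarrow> a \<in> Q \<and> dd le Q a = n \<and> \<tau> \<in> C a)"
    unfolding conic_support[OF P] C_def[symmetric] by (metis list.exhaust list.inject list.simps(3))
  have main: "(0 < n \<longrightarrow> (\<forall>\<sigma>. \<sigma> \<notin> chains_len le (Qup le Q n) n \<longrightarrow> bd le Q n x \<sigma> = 0)) \<longleftrightarrow>
     (n \<noteq> 0 \<longrightarrow> (\<forall>a\<in>Q. dd le Q a = n \<longrightarrow> (\<forall>\<sigma>. dl Q \<sigma> (\<lambda>\<tau>. x (a # \<tau>)) = 0)))" (is "?A \<longleftrightarrow> ?B")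
    if x0: "x [] = 0" and xs: "\<And>a \<tau>. x (a # \<tau>) \<noteq> 0 \<Longrightarrow> a \<in> Q \<and> dd le Q a = n \<and> \<tau> \<in> C a"
  proof -
    have "x \<in> chainsp le Q (Suc n)"
      unfolding chainsp_def
    proof (intro CollectI allI impI)
      fix \<sigma> assume "\<sigma> \<notin> chains_len le Q (Suc n)"
      then show "x \<sigma> = 0" using x0 xs
        by (cases \<sigma>) (auto simp: chains_len_def Cons_in_chains C_def)
    qed
    note bd = bd_eq_dl[OF fQ subset_refl this]
    have hd: "dd le Q b < n" if "x (a # b # \<sigma>) \<noteq> 0" for a b \<sigma>
      using xs[OF that] dd_less[OF P, of a b] by (auto simp: C_def chains_len_def Cons_in_chains)
    show ?thesis
    proof
      assume A: ?A
      show ?B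
      proof (intro impI ballI allI)
        fix a \<sigma> assume n: "n \<noteq> 0" and a: "a \<in> Q" "dd le Q a = n"
        have "a # \<sigma> \<notin> chains_len le (Qup le Q n) n" using a by (simp add: chains_len_def Cons_in_chains Qup_def)
        then have "dl Q (a # \<sigma>) x = 0" using A n unfolding bd by blast
        moreover have "(\<Sum>b\<in>Q. x (b # a # \<sigma>)) = 0" using hd a by (intro sum.neutral) blast
        ultimately show "dl Q \<sigma> (\<lambda>\<tau>. x (a # \<tau>)) = 0" by simp
      qed
    next
      assume B: ?B
      show ?A
      proof (intro impI allI)
        fix \<sigma> assume n: "0 < n" and s: "\<sigma> \<notin> chains_len le (Qup le Q n) n"
        have "x (a # \<sigma>) = 0" for a
        proof (rule ccontr)
          assume z: "x (a # \<sigma>) \<noteq> 0"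
          from xs[OF z] have "a \<in> Q" "dd le Q a = n" "\<sigma> \<in> C a" by auto
          then have "set \<sigma> \<subseteq> Qup le Q n" using dd_less[OF P, of a]
            by (auto simp: C_def chains_len_def chains_def Qup_def Qlt_def)
          then show False using \<open>\<sigma> \<in> C a\<close> s by (auto simp: C_def chains_len_def chains_def)
        qed
        moreover have "dl Q \<tau> (\<lambda>\<tau>. x (b # \<tau>)) = 0" for b \<tau>
        proof (cases "b \<in> Q \<and> dd le Q b = n")
          case False
          then have "(\<lambda>\<tau>. x (b # \<tau>)) = (\<lambda>_. 0)" using xs by (auto simp: fun_eq_iff)
          then show ?thesis by (simp add: dl_zero)
        qed (use B n in auto)
        ultimately have "dl Q \<sigma> x = 0" by (cases \<sigma>) auto
        then show "bd le Q n x \<sigma> = 0" using bd by simp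
      qed
    qed
  qed
  have Ra: "(\<lambda>\<tau>. x (a # \<tau>)) \<in> (if a \<in> Q \<and> dd le Q a = n then rcyc le (Qlt le Q a) n else {\<lambda>_. 0})
     \<longleftrightarrow> (\<forall>\<tau>. x (a # \<tau>) \<noteq> 0 \<longrightarrow> a \<in> Q \<and> dd le Q a = n \<and> \<tau> \<in> C a) \<and>
      (n \<noteq> 0 \<longrightarrow> a\<in>Q \<longrightarrow> dd le Q a = n \<longrightarrow> (\<forall>\<sigma>. dl Q \<sigma> (\<lambda>\<tau>. x (a # \<tau>)) = 0))" for a
  proof (cases "a \<in> Q \<and> dd le Q a = n")
    case True
    then show ?thesis by (auto simp: C_def rcyc_iff[OF fQ sub] chainsp_def)
  qed (auto simp: fun_eq_iff)
  have R: "(\<forall>a. (\<lambda>\<tau>. x (a # \<tau>)) \<in> (if a \<in> Q \<and> dd le Q a = n then rcyc le (Qlt le Q a) n else {\<lambda>_. 0}))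
     \<longleftrightarrow> (\<forall>a \<tau>. x (a # \<tau>) \<noteq> 0 \<longrightarrow> a \<in> Q \<and> dd le Q a = n \<and> \<tau> \<in> C a) \<and>
      (n \<noteq> 0 \<longrightarrow> (\<forall>a\<in>Q. dd le Q a = n \<longrightarrow> (\<forall>\<sigma>. dl Q \<sigma> (\<lambda>\<tau>. x (a # \<tau>)) = 0)))"
    unfolding Ra by blast
  show ?thesis
    unfolding R conic_def mem_Collect_eq supp conj_assoc[symmetric]
    by (rule conj_cong[OF refl]) (rule main; blast)
qed

lemma conic_chainsp:
  assumes "is_poset Q le" "x \<in> conic le Q n" shows "x \<in> chainsp le Q (Suc n)"
  unfolding chainsp_def
proof (intro CollectI allI impI)
  fix \<sigma> assume "\<sigma> \<notin> chains_len le Q (Suc n)"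
  moreover have "Qup le Q (Suc n) \<subseteq> Q" by (auto simp: Qup_def)
  ultimately show "x \<sigma> = 0"
    using assms(2) chains_mono unfolding conic_def chains_len_def by blast
qed

section \<open>Homology below an element of an hcw-poset\<close>

lemma hcw_is_poset: "hcw_poset TYPE('k::field) Q le \<Longrightarrow> is_poset Q le"
  by (simp add: hcw_poset_def)

lemma hcw_top:
  "hcw_poset TYPE('k::field) Q le \<Longrightarrow> a \<in> Q \<Longrightarrow>
    quot_iso_k (rcyc le (Qlt le Q a) (dd le Q a) :: (nat list \<Rightarrow> 'k) set) (rbnd le (Qlt le Q a) (dd le Q a))"
  by (simp add: hcw_poset_def dd_eq Let_def)

lemma hcw_other:
  "hcw_poset TYPE('k::field) Q le \<Longrightarrow> a \<in> Q \<Longrightarrow> n \<noteq> dd le Q a \<Longrightarrow>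
    (rcyc le (Qlt le Q a) n :: (nat list \<Rightarrow> 'k) set) \<subseteq> rbnd le (Qlt le Q a) n"
  by (simp add: hcw_poset_def dd_eq Let_def)

lemma chainsp_above_maxlen:
  assumes "finite S" "maxlen le S < n" shows "chainsp le S n = {\<lambda>_. 0}"
proof -
  have "chains_len le S n = {}"
    using length_le_maxlen[OF assms(1)] assms(2) by (fastforce simp: chains_len_def)
  then show ?thesis by (auto simp: chainsp_def)
qed

lemma rbnd_maxlen:
  assumes "finite S" shows "rbnd le S (maxlen le S) = {\<lambda>_. 0}"
  by (rule set_eqI) (simp add: rbnd_iff[OF assms subset_refl] chainsp_above_maxlen[OF assms lessI] dl_zero)

text \<open>There are no chains long enough to produce top boundaries, so the top homology is the
  cycle space itself and the isomorphism with the field makes it a line. This is why a cell can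
  later be cleared from a chain by one scalar.\<close>

lemma hcw_top_scalar:
  fixes x y :: "nat list \<Rightarrow> 'k::field"
  assumes hcw: "hcw_poset TYPE('k) Q le" and a: "a \<in> Q"
    and x: "x \<in> rcyc le (Qlt le Q a) (dd le Q a)" and y: "y \<in> rcyc le (Qlt le Q a) (dd le Q a)"
    and nz: "y \<noteq> (\<lambda>_. 0)"
  shows "\<exists>r. x = (\<lambda>\<tau>. r * y \<tau>)"
proof -
  note P = hcw_is_poset[OF hcw]
  let ?Z = "rcyc le (Qlt le Q a) (dd le Q a) :: (nat list \<Rightarrow> 'k) set"
  have "rbnd le (Qlt le Q a) (dd le Q a) = ({\<lambda>_. 0} :: (nat list \<Rightarrow> 'k) set)"
    unfolding dd_eq[OF P a] by (rule rbnd_maxlen[OF finite_QltI[OF P]])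
  then have ex: "quot_iso_k ?Z {\<lambda>_. 0}" using hcw_top[OF hcw a] by simp
  from ex obtain \<phi> :: "(nat list \<Rightarrow> 'k) \<Rightarrow> 'k" where
    \<phi>: "(\<forall>u\<in>?Z. \<forall>v\<in>?Z. \<phi> (\<lambda>\<sigma>. u \<sigma> + v \<sigma>) = \<phi> u + \<phi> v) \<and>
      (\<forall>r. \<forall>u\<in>?Z. \<phi> (\<lambda>\<sigma>. r * u \<sigma>) = r * \<phi> u) \<and>
      \<phi> ` ?Z = UNIV \<and> {u \<in> ?Z. \<phi> u = 0} = {\<lambda>_. 0}"
    unfolding quot_iso_k_def by (elim exE)
  then have add: "\<And>u v. u \<in> ?Z \<Longrightarrow> v \<in> ?Z \<Longrightarrow> \<phi> (\<lambda>\<sigma>. u \<sigma> + v \<sigma>) = \<phi> u + \<phi> v"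
    and mult: "\<And>r u. u \<in> ?Z \<Longrightarrow> \<phi> (\<lambda>\<sigma>. r * u \<sigma>) = r * \<phi> u"
    and ker: "{u \<in> ?Z. \<phi> u = 0} = {\<lambda>_. 0}" by simp_all
  have ny: "\<phi> y \<noteq> 0" using ker y nz by blast
  define r where "r = \<phi> x / \<phi> y"
  have c: "(\<lambda>\<sigma>. s * y \<sigma>) \<in> ?Z" for s
    using rcyc_add_mult[OF finite_QltI[OF P] rcyc_zero[OF finite_QltI[OF P]] y, of s] by simp
  have "\<phi> (\<lambda>\<sigma>. x \<sigma> + (- r) * y \<sigma>) = \<phi> x + (- r) * \<phi> y"
    using add[OF x c[of "- r"]] mult[OF y, of "- r"] by simp
  also have "\<dots> = 0" using ny by (simp add: r_def)
  finally have "(\<lambda>\<sigma>. x \<sigma> + (- r) * y \<sigma>) = (\<lambda>_. 0)"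
    using ker rcyc_add_mult[OF finite_QltI[OF P] x y, of "- r"] by blast
  then have "x = (\<lambda>\<tau>. r * y \<tau>)" by (simp add: fun_eq_iff)
  then show ?thesis ..
qed

text \<open>Cellular approximation: a simplicial cycle of dimension \<open>k\<close> is pushed into
  the k-skeleton. The induction \<open>step\<close> lowers the largest dimension of a head; once it
  is \<open>k\<close>, the links of the heads are cycles and the chain is conic.\<close>

lemma rcyc_homologous_conic:
  fixes z :: "nat list \<Rightarrow> 'k::field"
  assumes hcw: "hcw_poset TYPE('k) P le" and z: "z \<in> rcyc le P (Suc k)"
  shows "\<exists>w\<in>chainsp le P (Suc (Suc k)). (\<lambda>\<sigma>. z \<sigma> + dl P \<sigma> w) \<in> conic le P k"
proof -
  note po = hcw_is_poset[OF hcw]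
  note fP = is_poset_finite[OF po]
  note cyc = rcyc_iff[OF fP subset_refl]
  have sub: "Qlt le P a \<subseteq> P" for a by (auto simp: Qlt_def)
  have step: "\<exists>w\<in>chainsp le P (Suc (Suc k)). (\<lambda>\<sigma>. z \<sigma> + dl P \<sigma> w) \<in> conic le P k"
    if "z \<in> rcyc le P (Suc k)" "\<And>a \<tau>. z (a # \<tau>) \<noteq> 0 \<Longrightarrow> dd le P a \<le> k + j" for j and z :: "nat list \<Rightarrow> 'k"
    using that
  proof (induction j arbitrary: z)
    case (0 z)
    have zc: "z \<in> chainsp le P (Suc k)" and zd: "\<And>\<sigma>. dl P \<sigma> z = 0" using 0(1) unfolding cyc by simp_all
    have z1: "z (a # \<tau>) = 0" if "\<not> (a \<in> P \<and> dd le P a = k)" for a \<tau>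
    proof (rule ccontr)
      assume nz: "z (a # \<tau>) \<noteq> 0"
      then have "a # \<tau> \<in> chains le P" "length \<tau> = k" using chainsp_nonzeroD[OF zc] by fastforce+
      then have "k \<le> dd le P a" "a \<in> P" using dd_ge_length[OF po] by (auto simp: Cons_in_chains)
      then show False using 0(2)[OF nz] that by simp
    qed
    have z0: "z [] = 0" using zc by (simp add: chainsp_def chains_len_def)
    have "z \<in> conic le P k"
      unfolding conic_iff[OF po]
    proof (intro conjI z0 allI)
      fix a
      have "(\<lambda>\<tau>. z (a # \<tau>)) \<in> rcyc le (Qlt le P a) k" if a: "a \<in> P" "dd le P a = k"
        unfolding rcyc_iff[OF fP sub]
      proof (intro conjI impI allI)
        show "(\<lambda>\<tau>. z (a # \<tau>)) \<in> chainsp le (Qlt le P a) k" using zc by (rule chainsp_Cons)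
        fix \<sigma>
        have "z (b # a # \<sigma>) = 0" for b
        proof (rule ccontr)
          assume nz: "z (b # a # \<sigma>) \<noteq> 0"
          then have "b # a # \<sigma> \<in> chains le P" using chainsp_nonzeroD[OF zc] by blast
          then have "b \<in> P" "a \<in> Qlt le P b" by (auto simp: Cons_in_chains)
          then show False using dd_less[OF po] 0(2)[OF nz] a by fastforce
        qed
        then show "dl P \<sigma> (\<lambda>\<tau>. z (a # \<tau>)) = 0" using zd[of "a # \<sigma>"] by simp
      qed
      then show "(\<lambda>\<tau>. z (a # \<tau>)) \<in> (if a \<in> P \<and> dd le P a = k then rcyc le (Qlt le P a) k else {\<lambda>_. 0})"
        using z1 by (auto simp: fun_eq_iff)
    qed
    then show ?case by (intro bexI[of _ "\<lambda>_. 0"]) (simp_all add: dl_zero chainsp_zero)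
  next
    case (Suc j z)
    \<comment> \<open>The dimension to be removed exceeds \<open>k\<close>, so the link of
      \<open>z\<close> at such a vertex is a cycle away from the top of its sphere and therefore
      bounds.\<close>
    define N where "N = k + Suc j"
    have zc: "z \<in> chainsp le P (Suc k)" and zd: "\<And>\<sigma>. dl P \<sigma> z = 0" using Suc.prems(1) unfolding cyc by simp_all
    have "\<exists>w\<in>chainsp le (Qlt le P a) (Suc k). (\<lambda>\<tau>. z (a # \<tau>)) = (\<lambda>\<sigma>. dl P \<sigma> w)"
      if a: "a \<in> P" "dd le P a = N" for a
    proof -
      have "(\<lambda>\<tau>. z (a # \<tau>)) \<in> rcyc le (Qlt le P a) k"
        unfolding rcyc_iff[OF fP sub]
      proof (intro conjI impI allI)
        show "(\<lambda>\<tau>. z (a # \<tau>)) \<in> chainsp le (Qlt le P a) k" using zc by (rule chainsp_Cons)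
        fix \<sigma>
        have "z (b # a # \<sigma>) = 0" for b
        proof (rule ccontr)
          assume nz: "z (b # a # \<sigma>) \<noteq> 0"
          then have "b # a # \<sigma> \<in> chains le P" using chainsp_nonzeroD[OF zc] by blast
          then have "b \<in> P" "a \<in> Qlt le P b" by (auto simp: Cons_in_chains)
          then show False using dd_less[OF po] Suc.prems(2)[OF nz] a N_def by fastforce
        qed
        then show "dl P \<sigma> (\<lambda>\<tau>. z (a # \<tau>)) = 0" using zd[of "a # \<sigma>"] by simp
      qed
      moreover have "k \<noteq> dd le P a" using a N_def by simp
      ultimately have "(\<lambda>\<tau>. z (a # \<tau>)) \<in> rbnd le (Qlt le P a) k"
        by (intro subsetD[OF hcw_other[OF hcw a(1)]])
      then show ?thesis unfolding rbnd_iff[OF fP sub] .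
    qed
    note ex = this
    define v where "v a = (SOME w. w \<in> chainsp le (Qlt le P a) (Suc k) \<and> (\<lambda>\<tau>. z (a # \<tau>)) = (\<lambda>\<sigma>. dl P \<sigma> w))" for a
    have v: "v a \<in> chainsp le (Qlt le P a) (Suc k)" "(\<lambda>\<tau>. z (a # \<tau>)) = (\<lambda>\<sigma>. dl P \<sigma> (v a))"
      if "a \<in> P" "dd le P a = N" for a
      using someI_ex[OF ex[OF that, unfolded Bex_def]] unfolding v_def by blast+
    \<comment> \<open>The bounding chains are coned off with their vertices as apexes. The boundary
      of \<open>w\<close> at \<open>a # \<tau>\<close> is minus that of \<open>v a\<close> at
      \<tau>, so adding it cancels the part of \<open>z\<close> with head \<open>a\<close>.\<close>
    define w where "w = (\<lambda>\<sigma>. case \<sigma> of [] \<Rightarrow> 0 | a # \<tau> \<Rightarrow> if a \<in> P \<and> dd le P a = N then v a \<tau> else 0)"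
    have w: "w \<in> chainsp le P (Suc (Suc k))"
      unfolding chainsp_def
    proof (intro CollectI allI impI)
      fix \<sigma> assume "\<sigma> \<notin> chains_len le P (Suc (Suc k))"
      then show "w \<sigma> = 0" using v(1)
        by (cases \<sigma>) (auto simp: w_def chains_len_def Cons_in_chains chainsp_def)
    qed
    define z' where "z' = (\<lambda>\<sigma>. z \<sigma> + dl P \<sigma> w)"
    have "z' \<in> chainsp le P (Suc k)"
    proof -
      \<comment> \<open>Here \<open>bd\<close> is preferred to \<open>dl\<close> because its support
        is visible: faces of chains are chains.\<close>
      have "bd le P (Suc k) w \<in> chainsp le P (Suc k)"
        unfolding chainsp_def
      proof (intro CollectI allI impI)
        fix \<sigma> assume s: "\<sigma> \<notin> chains_len le P (Suc k)"
        have del: "del_nth i \<tau> \<in> chains_len le P (Suc k)"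
          if t: "\<tau> \<in> chains_len le P (Suc (Suc k))" and i: "i < Suc (Suc k)" for i \<tau>
        proof -
          have "sorted_wrt (\<lambda>x y. lt le y x) (take i \<tau> @ drop i \<tau>)" "length \<tau> = Suc (Suc k)" "set \<tau> \<subseteq> P"
            using t by (auto simp: chains_len_def chains_def)
          moreover have "drop i \<tau> = \<tau> ! i # drop (Suc i) \<tau>" using i calculation by (simp add: Cons_nth_drop_Suc)
          ultimately show ?thesis using i set_take_subset[of i \<tau>] set_drop_subset[of "Suc i" \<tau>]
            by (auto simp: chains_len_def chains_def del_nth_def sorted_wrt_append simp del: append_take_drop_id)
        qed
        show "bd le P (Suc k) w \<sigma> = 0"
          unfolding bd_def using del s by (intro sum.neutral ballI) auto
      qed
      moreover have "bd le P (Suc k) w = (\<lambda>\<sigma>. dl P \<sigma> w)"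
        using bd_eq_dl[OF fP subset_refl w] by (simp add: fun_eq_iff)
      ultimately show ?thesis using chainsp_add_mult[OF zc, of _ 1] by (simp add: z'_def)
    qed
    moreover have "dl P \<sigma> z' = 0" for \<sigma>
      using dl_add_mult[of P \<sigma> z 1 "\<lambda>\<sigma>. dl P \<sigma> w"] zd dl_dl[OF fP] by (simp add: z'_def)
    ultimately have "z' \<in> rcyc le P (Suc k)" using cyc by blast
    moreover have "dd le P a \<le> k + j" if nz: "z' (a # \<tau>) \<noteq> 0" for a \<tau>
    proof (rule ccontr)
      assume "\<not> ?thesis"
      then have ge: "N \<le> dd le P a" by (simp add: N_def)
      have 1: "w (b # a # \<tau>) = 0" for b
      proof (rule ccontr)
        assume "w (b # a # \<tau>) \<noteq> 0"
        moreover from this have "b \<in> P" "dd le P b = N" by (auto simp: w_def split: if_splits)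
        moreover have "b # a # \<tau> \<in> chains le P" using chainsp_nonzeroD[OF w] calculation by blast
        ultimately show False using dd_less[OF po, of b a] ge by (auto simp: Cons_in_chains)
      qed
      have ww: "(\<lambda>\<tau>. w (a # \<tau>)) = (if a \<in> P \<and> dd le P a = N then v a else (\<lambda>_. 0))"
        by (auto simp: w_def)
      have "a \<in> P \<and> dd le P a = N"
      proof (rule ccontr)
        assume n: "\<not> ?thesis"
        have "(\<lambda>\<tau>. w (a # \<tau>)) = (\<lambda>_. 0)" unfolding ww if_not_P[OF n] ..
        then have "z (a # \<tau>) \<noteq> 0" using nz 1 by (simp add: z'_def dl_zero)
        then have "dd le P a \<le> N" "a \<in> P" using Suc.prems(2) chainsp_nonzeroD[OF zc, of "a # \<tau>"]
          by (simp_all add: N_def Cons_in_chains)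
        then show False using n ge by simp
      qed
      moreover from this have "z (a # \<tau>) = dl P \<tau> (v a)" using v(2)[of a] by (metis (mono_tags))
      ultimately show False using nz 1 ww by (simp add: z'_def)
    qed
    ultimately obtain u where u: "u \<in> chainsp le P (Suc (Suc k))"
        "(\<lambda>\<sigma>. z' \<sigma> + dl P \<sigma> u) \<in> conic le P k" using Suc.IH by blast
    have "(\<lambda>\<sigma>. w \<sigma> + 1 * u \<sigma>) \<in> chainsp le P (Suc (Suc k))" using w u(1) by (rule chainsp_add_mult)
    moreover have "(\<lambda>\<sigma>. z \<sigma> + dl P \<sigma> (\<lambda>\<sigma>. w \<sigma> + 1 * u \<sigma>)) = (\<lambda>\<sigma>. z' \<sigma> + dl P \<sigma> u)"
      unfolding dl_add_mult z'_def by (simp add: algebra_simps)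
    ultimately show ?case using u(2) by metis
  qed
  obtain j where "\<And>a. a \<in> P \<Longrightarrow> dd le P a \<le> j"
    using fP by (metis Max_ge finite_imageI image_eqI)
  then have "dd le P a \<le> k + j" if "z (a # \<tau>) \<noteq> 0" for a \<tau>
    using chainsp_nonzeroD[of z le P "Suc k" "a # \<tau>"] that z[unfolded cyc]
    by (auto simp: Cons_in_chains intro: trans_le_add2)
  then show ?thesis using step[OF z] by blast
qed

section \<open>Strands of the homogenization\<close>

lemma hstrand_iff:
  assumes P: "is_poset Q le"
  shows "x \<in> hstrand le Q deg m n c \<longleftrightarrow> x [] = 0 \<and> (\<forall>a. (\<lambda>\<tau>. x (a # \<tau>)) \<in>
    (if a \<in> Q \<and> dd le Q a = n \<and> vle m (deg a) c then rcyc le (Qlt le Q a) n else {\<lambda>_. 0}))"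
    (is "_ \<longleftrightarrow> ?R")
proof -
  have "(\<forall>\<sigma>. x \<sigma> \<noteq> 0 \<longrightarrow> vle m (deg (hd \<sigma>)) c) \<longleftrightarrow> (\<forall>a. \<not> vle m (deg a) c \<longrightarrow> (\<lambda>\<tau>. x (a # \<tau>)) = (\<lambda>_. 0))"
    if "x [] = 0"
  proof
    assume R: "\<forall>a. \<not> vle m (deg a) c \<longrightarrow> (\<lambda>\<tau>. x (a # \<tau>)) = (\<lambda>_. 0)"
    show "\<forall>\<sigma>. x \<sigma> \<noteq> 0 \<longrightarrow> vle m (deg (hd \<sigma>)) c"
    proof (intro allI impI)
      fix \<sigma> assume "x \<sigma> \<noteq> 0"
      then show "vle m (deg (hd \<sigma>)) c"
        using that R by (cases \<sigma>) (auto simp: fun_eq_iff)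
    qed
  qed (auto simp: fun_eq_iff)
  moreover have "0 \<in> {0::'a}" by simp
  ultimately have "x \<in> hstrand le Q deg m n c \<longleftrightarrow> x [] = 0 \<and> (\<forall>a. (\<lambda>\<tau>. x (a # \<tau>)) \<in>
      (if a \<in> Q \<and> dd le Q a = n then rcyc le (Qlt le Q a) n else {\<lambda>_. 0}) \<and>
      (\<not> vle m (deg a) c \<longrightarrow> (\<lambda>\<tau>. x (a # \<tau>)) = (\<lambda>_. 0)))"
    unfolding hstrand_def mem_Collect_eq conic_iff[OF P] by blast
  also have "\<dots> \<longleftrightarrow> ?R"
    using rcyc_zero[OF finite_QltI[OF P], of le, where 'a = 'a] by (intro conj_cong refl iff_allI) auto
  finally show ?thesis .
qed

section \<open>Cells occurring in a strand and their boundaries\<close>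

definition hsupp :: "(nat list \<Rightarrow> 'k::zero) \<Rightarrow> nat set" where
  "hsupp x = {a. \<exists>\<tau>. x (a # \<tau>) \<noteq> 0}"

text \<open>The boundary of a conic chain just drops the top vertex, because every link is a cycle.\<close>
definition push :: "nat set \<Rightarrow> (nat list \<Rightarrow> 'k::comm_ring_1) \<Rightarrow> nat list \<Rightarrow> 'k" where
  "push Q x = (\<lambda>\<sigma>. \<Sum>a\<in>Q. x (a # \<sigma>))"

lemma push_add_mult: "push Q (\<lambda>\<sigma>. x \<sigma> + r * y \<sigma>) = (\<lambda>\<sigma>. push Q x \<sigma> + r * push Q y \<sigma>)"
  by (simp add: push_def sum.distrib sum_distrib_left)

lemma push_zero: "push Q (\<lambda>_. 0) = (\<lambda>_. 0)"
  by (simp add: push_def)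

lemma push_conic_eq_dl:
  assumes P: "is_poset Q le" and x: "x \<in> conic le Q n"
  shows "push Q x = (\<lambda>\<sigma>. dl Q \<sigma> x)"
proof
  fix \<sigma>
  have sub: "Qlt le Q b \<subseteq> Q" for b by (auto simp: Qlt_def)
  have "dl Q \<tau> (\<lambda>\<tau>. x (b # \<tau>)) = 0" for b \<tau>
  proof -
    have "(\<lambda>\<tau>. x (b # \<tau>)) \<in> (if b \<in> Q \<and> dd le Q b = n then rcyc le (Qlt le Q b) n else {\<lambda>_. 0})"
      using x unfolding conic_iff[OF P] by blast
    then have "(\<lambda>\<tau>. x (b # \<tau>)) = (\<lambda>_. 0) \<or> (\<lambda>\<tau>. x (b # \<tau>)) \<in> rcyc le (Qlt le Q b) n"
      by (auto split: if_splits)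
    then show ?thesis
    proof
      assume "(\<lambda>\<tau>. x (b # \<tau>)) \<in> rcyc le (Qlt le Q b) n"
      then have c: "(\<lambda>\<tau>. x (b # \<tau>)) \<in> chainsp le (Qlt le Q b) n" "n \<noteq> 0 \<longrightarrow> dl Q \<tau> (\<lambda>\<tau>. x (b # \<tau>)) = 0"
        unfolding rcyc_iff[OF is_poset_finite[OF P] sub] by auto
      show ?thesis
      proof (cases "n = 0")
        case True
        show ?thesis
          by (rule dl_length0) (use c(1) True in \<open>auto simp: chainsp_def chains_len_def\<close>)
      qed (use c in simp)
    qed (simp add: dl_zero)
  qed
  then show "push Q x \<sigma> = dl Q \<sigma> x" by (cases \<sigma>) (simp_all add: push_def)
qed

lemma bd_conic:
  assumes P: "is_poset Q le" and x: "x \<in> conic le Q n"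
  shows "bd le Q n x = push Q x"
  unfolding push_conic_eq_dl[OF assms]
  using bd_eq_dl[OF is_poset_finite[OF P] subset_refl conic_chainsp[OF assms]] by (simp add: fun_eq_iff)

lemma hstrand_conic: "x \<in> hstrand le Q deg m n c \<Longrightarrow> x \<in> conic le Q n"
  by (simp add: hstrand_def)

lemma hstrand_nonzeroD:
  assumes P: "is_poset Q le" and x: "x \<in> hstrand le Q deg m n c" and nz: "x (a # \<tau>) \<noteq> 0"
  shows "a \<in> Q" "dd le Q a = n" "vle m (deg a) c" "\<tau> \<in> chains le (Qlt le Q a)" "length \<tau> = n"
    "(\<lambda>\<tau>. x (a # \<tau>)) \<in> rcyc le (Qlt le Q a) n"
proof -
  have "(\<lambda>\<tau>. x (a # \<tau>)) \<in> (if a \<in> Q \<and> dd le Q a = n \<and> vle m (deg a) c then rcyc le (Qlt le Q a) n else {\<lambda>_. 0})"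
    using x unfolding hstrand_iff[OF P] by blast
  then have *: "a \<in> Q \<and> dd le Q a = n \<and> vle m (deg a) c \<and> (\<lambda>\<tau>. x (a # \<tau>)) \<in> rcyc le (Qlt le Q a) n"
    using nz by (auto simp: fun_eq_iff split: if_splits)
  then show "a \<in> Q" "dd le Q a = n" "vle m (deg a) c" "(\<lambda>\<tau>. x (a # \<tau>)) \<in> rcyc le (Qlt le Q a) n" by auto
  have "(\<lambda>\<tau>. x (a # \<tau>)) \<in> chainsp le (Qlt le Q a) n" using * by (simp add: rcyc_def)
  from chainsp_nonzeroD[OF this nz] show "\<tau> \<in> chains le (Qlt le Q a)" "length \<tau> = n" by auto
qed

lemma hstrandI:
  assumes P: "is_poset Q le" and "x [] = 0"
    and "\<And>a \<tau>. x (a # \<tau>) \<noteq> 0 \<Longrightarrow> a \<in> Q \<and> dd le Q a = n \<and> vle m (deg a) c"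
    and "\<And>a. a \<in> Q \<Longrightarrow> dd le Q a = n \<Longrightarrow> vle m (deg a) c \<Longrightarrow> (\<lambda>\<tau>. x (a # \<tau>)) \<in> rcyc le (Qlt le Q a) n"
  shows "x \<in> hstrand le Q deg m n c"
  unfolding hstrand_iff[OF P] using assms(2-) by (auto simp: fun_eq_iff)

text \<open>Monotonicity of \<open>deg\<close> keeps the image in degree \<open>c\<close>. That its
  link at \<open>b\<close> is a cycle comes from d d = 0: the terms of that identity with a further
  vertex above \<open>b\<close> vanish, since two vertices of dimension \<open>n\<close> would lie
  in one chain.\<close>

lemma push_hstrand:
  fixes x :: "nat list \<Rightarrow> 'k::comm_ring_1"
  assumes P: "is_poset Q le" and mono: "poset_morphism m Q le deg"
    and x: "x \<in> hstrand le Q deg m (Suc n) c"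
  shows "push Q x \<in> hstrand le Q deg m n c"
proof -
  have sub: "Qlt le Q b \<subseteq> Q" for b by (auto simp: Qlt_def)
  note nzD = hstrand_nonzeroD[OF P x]
  have two: "b \<in> Q \<and> dd le Q b = n \<and> vle m (deg b) c \<and> \<tau> \<in> chains_len le (Qlt le Q b) n"
    if nz: "x (a # b # \<tau>) \<noteq> 0" for a b \<tau>
  proof -
    have a: "a \<in> Q" "dd le Q a = Suc n" "vle m (deg a) c" "b # \<tau> \<in> chains le (Qlt le Q a)" "length \<tau> = n"
      using nzD[OF nz] by auto
    then have b: "b \<in> Qlt le Q a" "\<tau> \<in> chains le (Qlt le Q b)" using Qlt_Qlt[OF P] by (auto simp: Cons_in_chains)
    then have bQ: "b \<in> Q" "le b a" by (auto simp: Qlt_def lt_def)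
    then have "n \<le> dd le Q b" using dd_ge_length[OF P, of b \<tau>] b a by (simp add: Cons_in_chains)
    moreover have "dd le Q b < Suc n" using dd_less[OF P a(1) b(1)] a by simp
    moreover have "vle m (deg b) (deg a)" using mono bQ a unfolding poset_morphism_def by blast
    ultimately show ?thesis using a b bQ unfolding vle_def chains_len_def by force
  qed
  show ?thesis
  proof (rule hstrandI[OF P])
    have "x [a] = 0" for a using nzD(5)[of a "[]"] by auto
    then show "push Q x [] = 0" by (simp add: push_def)
    show "b \<in> Q \<and> dd le Q b = n \<and> vle m (deg b) c" if "push Q x (b # \<tau>) \<noteq> 0" for b \<tau>
    proof -
      obtain a where "x (a # b # \<tau>) \<noteq> 0" using \<open>push Q x (b # \<tau>) \<noteq> 0\<close>
        unfolding push_def by (rule sum.not_neutral_contains_not_neutral)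
      then show ?thesis using two by blast
    qed
    fix b assume b: "b \<in> Q" "dd le Q b = n" "vle m (deg b) c"
    show "(\<lambda>\<tau>. push Q x (b # \<tau>)) \<in> rcyc le (Qlt le Q b) n"
      unfolding rcyc_iff[OF is_poset_finite[OF P] sub]
    proof (intro conjI impI allI)
      show "(\<lambda>\<tau>. push Q x (b # \<tau>)) \<in> chainsp le (Qlt le Q b) n"
        using two unfolding chainsp_def push_def by (auto intro!: sum.neutral)
      fix \<sigma>
      have "x (d # a # b # \<sigma>) = 0" for d a
      proof (rule ccontr)
        assume "x (d # a # b # \<sigma>) \<noteq> 0"
        from two[OF this] b dd_less[OF P, of a b] show False
          by (auto simp: chains_len_def Cons_in_chains)
      qed
      then have "(\<Sum>a\<in>Q. push Q x (a # b # \<sigma>)) = 0" by (simp add: push_def)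
      moreover have "dl Q (b # \<sigma>) (push Q x) = 0"
        unfolding push_conic_eq_dl[OF P hstrand_conic[OF x]] by (rule dl_dl[OF is_poset_finite[OF P]])
      ultimately show "dl Q \<sigma> (\<lambda>\<tau>. push Q x (b # \<tau>)) = 0" by simp
    qed
  qed
qed

lemma push_push:
  assumes P: "is_poset Q le" and mono: "poset_morphism m Q le deg"
    and x: "x \<in> hstrand le Q deg m (Suc n) c"
  shows "push Q (push Q x) = (\<lambda>_. 0)"
  unfolding push_conic_eq_dl[OF P hstrand_conic[OF push_hstrand[OF assms]]]
  unfolding push_conic_eq_dl[OF P hstrand_conic[OF x]] dl_dl[OF is_poset_finite[OF P]] ..

lemma hstrand_add_mult:
  assumes P: "is_poset Q le" and "x \<in> hstrand le Q deg m n c" "y \<in> hstrand le Q deg m n c"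
  shows "(\<lambda>\<sigma>. x \<sigma> + r * y \<sigma>) \<in> hstrand le Q deg m n c"
proof -
  have "(\<lambda>\<tau>. x (a # \<tau>) + r * y (a # \<tau>)) \<in>
      (if a \<in> Q \<and> dd le Q a = n \<and> vle m (deg a) c then rcyc le (Qlt le Q a) n else {\<lambda>_. 0})" for a
  proof (cases "a \<in> Q \<and> dd le Q a = n \<and> vle m (deg a) c")
    case True
    then show ?thesis using assms(2,3)[unfolded hstrand_iff[OF P], THEN conjunct2, THEN spec, of a]
      by (simp add: rcyc_add_mult[OF finite_QltI[OF P]])
  next
    case False
    then show ?thesis using assms(2,3)[unfolded hstrand_iff[OF P], THEN conjunct2, THEN spec, of a]
      unfolding if_not_P[OF False] by (simp add: fun_eq_iff)
  qed
  moreover have "x [] + r * y [] = 0"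
    using assms(2,3)[unfolded hstrand_iff[OF P], THEN conjunct1] by simp
  ultimately show ?thesis unfolding hstrand_iff[OF P] by blast
qed

lemma hstrand_zero: "is_poset Q le \<Longrightarrow> (\<lambda>_. 0) \<in> hstrand le Q deg m n c"
  by (simp add: hstrand_iff rcyc_zero finite_QltI)

text \<open>Level \<open>l\<close> is homological degree \<open>l - 1\<close>; level \<open>0\<close> is the degree-\<open>c\<close> component of the
  ideal itself, where \<open>U c\<close> expresses that the monomial of degree \<open>c\<close> lies in the ideal.\<close>
definition strand ::
  "(nat \<Rightarrow> nat \<Rightarrow> bool) \<Rightarrow> nat set \<Rightarrow> (nat \<Rightarrow> nat \<Rightarrow> int) \<Rightarrow> nat \<Rightarrow> ((nat \<Rightarrow> int) \<Rightarrow> bool) \<Rightarrow> nat \<Rightarrow>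
    (nat \<Rightarrow> int) \<Rightarrow> (nat list \<Rightarrow> 'k::comm_ring_1) set" where
  "strand le Q deg m U l c = (case l of 0 \<Rightarrow> {x. (\<forall>\<sigma>. \<sigma> \<noteq> [] \<longrightarrow> x \<sigma> = 0) \<and> (\<not> U c \<longrightarrow> x [] = 0)}
     | Suc n \<Rightarrow> hstrand le Q deg m n c)"

definition scyc ::
  "(nat \<Rightarrow> nat \<Rightarrow> bool) \<Rightarrow> nat set \<Rightarrow> (nat \<Rightarrow> nat \<Rightarrow> int) \<Rightarrow> nat \<Rightarrow> ((nat \<Rightarrow> int) \<Rightarrow> bool) \<Rightarrow> nat \<Rightarrow>
    (nat \<Rightarrow> int) \<Rightarrow> (nat list \<Rightarrow> 'k::comm_ring_1) set" where
  "scyc le Q deg m U l c = {x \<in> strand le Q deg m U l c. l \<noteq> 0 \<longrightarrow> push Q x = (\<lambda>_. 0)}"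

text \<open>Note the shift: level \<open>l + 1\<close> is the strand in homological degree
  \<open>l\<close>, so boundaries at level \<open>l\<close> come from \<open>hstrand\<close> with
  index \<open>l\<close>. For \<open>l = 0\<close> the map \<open>push\<close> is the augmentation,
  which stores the sum of the coefficients at \<open>[]\<close>.\<close>

definition sbnd ::
  "(nat \<Rightarrow> nat \<Rightarrow> bool) \<Rightarrow> nat set \<Rightarrow> (nat \<Rightarrow> nat \<Rightarrow> int) \<Rightarrow> nat \<Rightarrow> nat \<Rightarrow>
    (nat \<Rightarrow> int) \<Rightarrow> (nat list \<Rightarrow> 'k::comm_ring_1) set" where
  "sbnd le Q deg m l c = push Q ` hstrand le Q deg m l c"

lemma strand_0: "x \<in> strand le Q deg m U 0 c \<longleftrightarrow> (\<forall>\<sigma>. \<sigma> \<noteq> [] \<longrightarrow> x \<sigma> = 0) \<and> (\<not> U c \<longrightarrow> x [] = 0)"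
  by (simp add: strand_def)

lemma strand_Suc: "strand le Q deg m U (Suc n) c = hstrand le Q deg m n c"
  by (simp add: strand_def)

lemma sbnd_add_mult:
  assumes P: "is_poset Q le" and "x \<in> sbnd le Q deg m l c" "y \<in> sbnd le Q deg m l c"
  shows "(\<lambda>\<sigma>. x \<sigma> + r * y \<sigma>) \<in> sbnd le Q deg m l c"
proof -
  obtain u v where "u \<in> hstrand le Q deg m l c" "v \<in> hstrand le Q deg m l c" "x = push Q u" "y = push Q v"
    using assms unfolding sbnd_def by blast
  then have "(\<lambda>\<sigma>. x \<sigma> + r * y \<sigma>) = push Q (\<lambda>\<sigma>. u \<sigma> + r * v \<sigma>)"
    "(\<lambda>\<sigma>. u \<sigma> + r * v \<sigma>) \<in> hstrand le Q deg m l c"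
    by (simp_all add: push_add_mult hstrand_add_mult[OF P])
  then show ?thesis unfolding sbnd_def by (rule image_eqI)
qed

lemma sbnd_zero: "is_poset Q le \<Longrightarrow> (\<lambda>_. 0) \<in> sbnd le Q deg m l c"
  unfolding sbnd_def by (rule image_eqI, rule push_zero[symmetric], rule hstrand_zero)

lemma sbnd_subset_scyc:
  assumes P: "is_poset Q le" and mono: "poset_morphism m Q le deg"
    and U: "\<And>a. a \<in> Q \<Longrightarrow> U (deg a)" and up: "\<And>c d. U c \<Longrightarrow> vle m c d \<Longrightarrow> U d"
  shows "sbnd le Q deg m l c \<subseteq> (scyc le Q deg m U l c :: (nat list \<Rightarrow> 'k::comm_ring_1) set)"
proof
  fix y :: "nat list \<Rightarrow> 'k" assume "y \<in> sbnd le Q deg m l c"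
  then obtain x where x: "x \<in> hstrand le Q deg m l c" and y: "y = push Q x" by (auto simp: sbnd_def)
  show "y \<in> scyc le Q deg m U l c"
  proof (cases l)
    case 0
    have "y \<sigma> = 0" if "\<sigma> \<noteq> []" for \<sigma>
      unfolding y push_def using hstrand_nonzeroD(5)[OF P x] 0 that by (intro sum.neutral) auto
    moreover have "U c" if nz: "y [] \<noteq> 0"
    proof -
      obtain a where "x [a] \<noteq> 0" using nz unfolding y push_def
        by (rule sum.not_neutral_contains_not_neutral)
      from hstrand_nonzeroD[OF P x this] U up show ?thesis by blast
    qed
    ultimately show ?thesis using 0 by (auto simp: scyc_def strand_0)
  next
    case (Suc n)
    then show ?thesis using push_hstrand[OF P mono, of x n c] push_push[OF P mono, of x n c] x y
      by (simp add: scyc_def strand_Suc)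
  qed
qed

text \<open>The exchange argument in pure linear algebra. \<open>V\<close> is the space of chains,
  \<open>B\<close> the boundaries among them, \<open>f\<close> the differential and
  \<open>hs\<close> the set of cells used; \<open>piv\<close> says that each cell is a
  one-dimensional coordinate. The last conclusion, that \<open>S\<close> already produces all values
  of \<open>f\<close>, is what later kills the homology just below the top.\<close>

lemma minimal_support_cycle:
  fixes V B :: "('s \<Rightarrow> 'k::field) set" and f :: "('s \<Rightarrow> 'k) \<Rightarrow> 't \<Rightarrow> 'k" and hs :: "('s \<Rightarrow> 'k) \<Rightarrow> 'c set"
  assumes fin: "finite E"
    and V: "\<And>x y r. x \<in> V \<Longrightarrow> y \<in> V \<Longrightarrow> (\<lambda>\<sigma>. x \<sigma> + r * y \<sigma>) \<in> V"
    and B: "\<And>x y r. x \<in> B \<Longrightarrow> y \<in> B \<Longrightarrow> (\<lambda>\<sigma>. x \<sigma> + r * y \<sigma>) \<in> B" and B0: "(\<lambda>_. 0) \<in> B"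
    and f: "\<And>x y r. f (\<lambda>\<sigma>. x \<sigma> + r * y \<sigma>) = (\<lambda>\<sigma>. f x \<sigma> + r * f y \<sigma>)"
    and hsE: "\<And>x. x \<in> V \<Longrightarrow> hs x \<subseteq> E"
    and hs_add: "\<And>x y r. hs (\<lambda>\<sigma>. x \<sigma> + r * y \<sigma>) \<subseteq> hs x \<union> hs y"
    and hs0: "\<And>x. x \<in> V \<Longrightarrow> hs x = {} \<Longrightarrow> x = (\<lambda>_. 0)"
    and piv: "\<And>x y b. x \<in> V \<Longrightarrow> y \<in> V \<Longrightarrow> b \<in> hs y \<Longrightarrow> \<exists>r. b \<notin> hs (\<lambda>\<sigma>. x \<sigma> + r * y \<sigma>)"
    and nex: "z1 \<in> V" "f z1 = (\<lambda>_. 0)" "z1 \<notin> B"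
  obtains S z where "S \<subseteq> E" "z \<in> V" "f z = (\<lambda>_. 0)" "z \<notin> B" "hs z \<subseteq> S"
    "\<And>x. x \<in> V \<Longrightarrow> f x = (\<lambda>_. 0) \<Longrightarrow> hs x \<subseteq> S \<Longrightarrow> \<exists>r. x = (\<lambda>\<sigma>. r * z \<sigma>)"
    "\<And>y. y \<in> V \<Longrightarrow> \<exists>y'\<in>V. hs y' \<subseteq> S \<and> f y' = f y"
proof -
  define Z where "Z = {x \<in> V. f x = (\<lambda>_. 0)}"
  have Z: "(\<lambda>\<sigma>. x \<sigma> + r * y \<sigma>) \<in> Z" if "x \<in> Z" "y \<in> Z" for x y r
    using that V by (simp add: Z_def f)
  define P where "P S \<longleftrightarrow> S \<subseteq> E \<and> (\<exists>z\<in>Z. z \<notin> B \<and> hs z \<subseteq> S) \<and> (\<forall>y\<in>V. \<exists>y'\<in>V. hs y' \<subseteq> S \<and> f y' = f y)" for S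
  have "P E" unfolding P_def Z_def using nex hsE by blast
  then obtain S where S: "P S" and least: "\<And>T. P T \<Longrightarrow> card S \<le> card T"
    using ex_has_least_nat[of P E card] by blast
  have finS: "finite S" using S fin finite_subset by (auto simp: P_def)
  \<comment> \<open>Otherwise \<open>b\<close> could be dropped from \<open>S\<close>: any chain on
    \<open>S\<close> is freed from \<open>b\<close> by adding a multiple of the cycle
    \<open>z\<close>, which leaves its boundary unchanged, and \<open>x\<close> is still a cycle
    outside \<open>B\<close>.\<close>
  have key: "x \<in> B" if z: "z \<in> Z" "hs z \<subseteq> S" "b \<in> hs z" and x: "x \<in> Z" "hs x \<subseteq> S - {b}" for x z b
  proof (rule ccontr)
    assume "x \<notin> B"
    have "\<exists>y'\<in>V. hs y' \<subseteq> S - {b} \<and> f y' = f y" if yV: "y \<in> V" for y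
    proof -
      obtain y' where y': "y' \<in> V" "hs y' \<subseteq> S" "f y' = f y" using S yV unfolding P_def by blast
      obtain r where r: "b \<notin> hs (\<lambda>\<sigma>. y' \<sigma> + r * z \<sigma>)" using piv y' z unfolding Z_def by blast
      have "hs (\<lambda>\<sigma>. y' \<sigma> + r * z \<sigma>) \<subseteq> S - {b}" using r hs_add[of y' r z] y' z by blast
      moreover have "f (\<lambda>\<sigma>. y' \<sigma> + r * z \<sigma>) = f y" using z y' by (simp add: f Z_def)
      moreover have "(\<lambda>\<sigma>. y' \<sigma> + r * z \<sigma>) \<in> V" using V y' z by (simp add: Z_def)
      ultimately show ?thesis by blast
    qed
    then have "P (S - {b})" using S x \<open>x \<notin> B\<close> unfolding P_def by blast
    then have "card S \<le> card (S - {b})" by (rule least)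
    moreover have "card (S - {b}) < card S" using z finS by (intro card_Diff1_less) auto
    ultimately show False by simp
  qed
  obtain z where z: "z \<in> Z" "z \<notin> B" "hs z \<subseteq> S" using S unfolding P_def by blast
  \<comment> \<open>A nonzero \<open>x\<close> of this kind could serve as pivot: \<open>z\<close>
    plus a multiple of \<open>x\<close> avoids a cell of \<open>x\<close>, so \<open>key\<close>
    puts it into \<open>B\<close>, and then \<open>z\<close> itself lies in
    \<open>B\<close>.\<close>
  have zero: "x = (\<lambda>_. 0)" if x: "x \<in> Z" "x \<in> B" "hs x \<subseteq> S" for x
  proof (rule ccontr)
    assume "x \<noteq> (\<lambda>_. 0)"
    then obtain b where b: "b \<in> hs x" using hs0[of x] x(1) unfolding Z_def by blast
    have "z \<in> V" "x \<in> V" using x z by (simp_all add: Z_def)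
    from piv[OF this b] obtain r where r: "b \<notin> hs (\<lambda>\<sigma>. z \<sigma> + r * x \<sigma>)" by blast
    have "hs (\<lambda>\<sigma>. z \<sigma> + r * x \<sigma>) \<subseteq> S - {b}" using r hs_add[of z r x] x z by blast
    then have "(\<lambda>\<sigma>. z \<sigma> + r * x \<sigma>) \<in> B" by (rule key[OF x(1,3) b Z[OF z(1) x(1)]])
    from B[OF this x(2), of "- r"] z(2) show False by simp
  qed
  \<comment> \<open>Clearing from \<open>x\<close> a cell used by \<open>z\<close> leaves a cycle
    that is in \<open>B\<close> by \<open>key\<close>, hence zero by \<open>zero\<close>.\<close>
  have scalar: "\<exists>r. x = (\<lambda>\<sigma>. r * z \<sigma>)" if x: "x \<in> Z" "hs x \<subseteq> S" for x
  proof -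
    have "z \<noteq> (\<lambda>_. 0)" using z B0 by blast
    then obtain b where b: "b \<in> hs z" using hs0[of z] z(1) unfolding Z_def by blast
    have "x \<in> V" "z \<in> V" using x z by (simp_all add: Z_def)
    from piv[OF this b] obtain r where r: "b \<notin> hs (\<lambda>\<sigma>. x \<sigma> + r * z \<sigma>)" by blast
    have s: "hs (\<lambda>\<sigma>. x \<sigma> + r * z \<sigma>) \<subseteq> S - {b}" using r hs_add[of x r z] x z by blast
    then have "(\<lambda>\<sigma>. x \<sigma> + r * z \<sigma>) \<in> B" by (rule key[OF z(1,3) b Z[OF x(1) z(1)]])
    with s have "(\<lambda>\<sigma>. x \<sigma> + r * z \<sigma>) = (\<lambda>_. 0)" by (intro zero[OF Z[OF x(1) z(1)]]) auto
    then have "x = (\<lambda>\<sigma>. (- r) * z \<sigma>)" by (simp add: fun_eq_iff add_eq_0_iff2)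
    then show ?thesis ..
  qed
  show thesis
  proof (rule that[of S z])
    show "z \<in> V" "f z = (\<lambda>_. 0)" using z(1) by (simp_all add: Z_def)
    show "S \<subseteq> E" using S by (simp add: P_def)
    show "\<exists>r. x = (\<lambda>\<sigma>. r * z \<sigma>)" if "x \<in> V" "f x = (\<lambda>_. 0)" "hs x \<subseteq> S" for x
      using scalar[of x] that by (simp add: Z_def)
    show "\<exists>y'\<in>V. hs y' \<subseteq> S \<and> f y' = f y" if "y \<in> V" for y
      using S that unfolding P_def by blast
  qed (fact z)+
qed

section \<open>Links of new cells\<close>

lemma is_poset_subset: "is_poset Q le \<Longrightarrow> D \<subseteq> Q \<Longrightarrow> is_poset D le"
  unfolding is_poset_def by (meson finite_subset subsetD)

lemma Qlt_downset: "D \<subseteq> Q \<Longrightarrow> Qlt le Q b \<subseteq> D \<Longrightarrow> Qlt le D b = Qlt le Q b"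
  by (auto simp: Qlt_def)

lemma dd_downset:
  assumes "is_poset Q le" "D \<subseteq> Q" "Qlt le Q b \<subseteq> D" "b \<in> D"
  shows "dd le D b = dd le Q b"
proof -
  have "b \<in> Q" using assms by blast
  then show ?thesis
    using dd_eq[OF assms(1)] dd_eq[OF is_poset_subset[OF assms(1,2)] assms(4)] Qlt_downset[OF assms(2,3)] by simp
qed

lemma hcw_downset:
  assumes "hcw_poset TYPE('k::field) Q le" "D \<subseteq> Q" "\<And>b. b \<in> D \<Longrightarrow> Qlt le Q b \<subseteq> D"
  shows "hcw_poset TYPE('k) D le"
proof -
  have P: "is_poset D le" using is_poset_subset[OF hcw_is_poset[OF assms(1)] assms(2)] .
  have "Qlt le D a = Qlt le Q a \<and> a \<in> Q" if "a \<in> D" for a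
    using Qlt_downset[OF assms(2) assms(3)[OF that]] that assms(2) by blast
  with assms(1) P show ?thesis unfolding hcw_poset_def by metis
qed

lemma conic_downset:
  assumes P: "is_poset Q le" and D: "D \<subseteq> Q" "\<And>b. b \<in> D \<Longrightarrow> Qlt le Q b \<subseteq> D"
    and x: "x \<in> conic le D n"
  shows "x \<in> conic le Q n"
  unfolding conic_iff[OF P]
proof (intro conjI allI)
  note x = x[unfolded conic_iff[OF is_poset_subset[OF P D(1)]]]
  show "x [] = 0" using x by blast
  fix a
  have "(\<lambda>\<tau>. x (a # \<tau>)) \<in> (if a \<in> D \<and> dd le D a = n then rcyc le (Qlt le D a) n else {\<lambda>_. 0})" using x by blast
  then show "(\<lambda>\<tau>. x (a # \<tau>)) \<in> (if a \<in> Q \<and> dd le Q a = n then rcyc le (Qlt le Q a) n else {\<lambda>_. 0})"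
    using dd_downset[OF P D(1) D(2), of a] Qlt_downset[OF D(1) D(2), of a] D(1) rcyc_zero[OF finite_QltI[OF P]]
    by (cases "a \<in> D") auto
qed

lemma dl_mono:
  assumes "finite A" "S \<subseteq> A" "c \<in> chainsp le S (Suc n)"
  shows "dl A \<sigma> c = dl S \<sigma> c"
  using bd_eq_dl[OF assms, of \<sigma>] bd_eq_dl[OF finite_subset[OF assms(2,1)] subset_refl assms(3), of \<sigma>] by simp

lemma hsupp_add_mult: "hsupp (\<lambda>\<sigma>. x \<sigma> + r * y \<sigma>) \<subseteq> hsupp x \<union> hsupp (y :: nat list \<Rightarrow> 'k::comm_ring_1)"
  by (auto simp: hsupp_def)

lemma hstrand_eq_zero:
  assumes "is_poset Q le" "x \<in> hstrand le Q deg m n c" "hsupp x = {}"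
  shows "x = (\<lambda>_. 0)"
proof
  fix \<sigma> show "x \<sigma> = 0" using assms(2,3) hstrand_iff[OF assms(1), of x]
    by (cases \<sigma>) (auto simp: hsupp_def)
qed

lemma hstrand_pivot:
  fixes x y :: "nat list \<Rightarrow> 'k::field"
  assumes hcw: "hcw_poset TYPE('k) Q le"
    and x: "x \<in> hstrand le Q deg m n c" and y: "y \<in> hstrand le Q deg m n c" and b: "b \<in> hsupp y"
  shows "\<exists>r. b \<notin> hsupp (\<lambda>\<sigma>. x \<sigma> + r * y \<sigma>)"
proof -
  note P = hcw_is_poset[OF hcw]
  obtain \<tau> where nz: "y (b # \<tau>) \<noteq> 0" using b by (auto simp: hsupp_def)
  note D = hstrand_nonzeroD[OF P y nz]
  have "(\<lambda>\<tau>. x (b # \<tau>)) \<in> rcyc le (Qlt le Q b) n"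
    using x[unfolded hstrand_iff[OF P], THEN conjunct2, THEN spec, of b] D by simp
  moreover have "(\<lambda>\<tau>. y (b # \<tau>)) \<noteq> (\<lambda>_. 0)" using nz by (metis (mono_tags))
  ultimately obtain r where "(\<lambda>\<tau>. x (b # \<tau>)) = (\<lambda>\<tau>. r * y (b # \<tau>))"
    using hcw_top_scalar[OF hcw D(1)] D by blast
  then have "x (b # \<tau>) = r * y (b # \<tau>)" for \<tau> by (rule fun_cong)
  then have "b \<notin> hsupp (\<lambda>\<sigma>. x \<sigma> + (- r) * y \<sigma>)" by (simp add: hsupp_def)
  then show ?thesis ..
qed

lemma rcyc_subset_rbnd_above:
  assumes "finite S" "maxlen le S < n"
  shows "rcyc le S n \<subseteq> rbnd le S n"
proof
  fix x :: "nat list \<Rightarrow> 'a" assume "x \<in> rcyc le S n"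
  then have "x = (\<lambda>\<sigma>. dl S \<sigma> (\<lambda>_. 0))"
    using chainsp_above_maxlen[OF assms, where 'a = 'a] by (simp add: rcyc_def dl_zero)
  then show "x \<in> rbnd le S n"
    unfolding rbnd_iff[OF assms(1) subset_refl] using chainsp_zero by blast
qed

text \<open>A nonempty complex has no reduced homology in dimension -1: the vertex \<open>v\<close>
  bounds the empty simplex.\<close>

lemma rcyc_subset_rbnd_0:
  assumes "finite S" "v \<in> S"
  shows "rcyc le S 0 \<subseteq> rbnd le S 0"
proof
  fix x :: "nat list \<Rightarrow> 'a" assume "x \<in> rcyc le S 0"
  then have x: "x \<sigma> = 0" if "\<sigma> \<noteq> []" for \<sigma>
    using that unfolding rcyc_iff[OF assms(1) subset_refl] chainsp_def chains_len_def by auto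
  define w where "w = (\<lambda>\<sigma>. if \<sigma> = [v] then x [] else 0)"
  have "w \<in> chainsp le S (Suc 0)"
    using assms by (auto simp: w_def chainsp_def chains_len_def Cons_in_chains)
  moreover have "x \<sigma> = dl S \<sigma> w" for \<sigma>
  proof (cases \<sigma>)
    case Nil
    have "dl S \<sigma> w = (\<Sum>a\<in>S. if a = v then x [] else 0)" using Nil by (simp add: w_def)
    then show ?thesis using assms Nil by simp
  next
    case (Cons b \<tau>)
    have "dl S \<tau> (\<lambda>\<tau>. w (b # \<tau>)) = 0" by (rule dl_length0) (simp add: w_def)
    then show ?thesis using Cons x by (simp add: w_def)
  qed
  ultimately show "x \<in> rbnd le S 0" unfolding rbnd_iff[OF assms(1) subset_refl] by blast
qed

lemma rcyc_mult: "finite S \<Longrightarrow> z \<in> rcyc le S n \<Longrightarrow> (\<lambda>\<sigma>. r * z \<sigma>) \<in> rcyc le S n"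
  using rcyc_add_mult[OF _ rcyc_zero, of S z le n r] by simp

text \<open>\<open>D\<close> is to become the set of elements strictly below a new cell of degree
  \<alpha> and dimension \<open>l\<close>, and \<open>z\<close> its boundary. The function
  \<open>z\<close> is read in two ways, as a cycle of the strand and as the fundamental cycle of the
  order complex of \<open>D\<close>; both are functions on the same decreasing lists.\<close>

definition new_link where
  "new_link le Q deg m U l \<alpha> D z \<longleftrightarrow> D \<subseteq> Q \<and> (\<forall>b\<in>D. Qlt le Q b \<subseteq> D) \<and> (\<forall>b\<in>D. vle m (deg b) \<alpha>) \<and>
    maxlen le D = l \<and> z \<in> scyc le Q deg m U l \<alpha> \<and> z \<notin> sbnd le Q deg m l \<alpha> \<and>
    rcyc le D l = range (\<lambda>r \<sigma>. r * z \<sigma>) \<and> (\<forall>n. n \<noteq> l \<longrightarrow> (rcyc le D n :: (nat list \<Rightarrow> 'k) set) \<subseteq> rbnd le D n)"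
  for z :: "nat list \<Rightarrow> 'k::field"

text \<open>A missing generator of the ideal: the link is empty, a sphere of dimension -1, whose
  cycles are the functions supported on \<open>[]\<close>. A nonzero value of \<open>z\<close> there
  spans them.\<close>

lemma exists_new_link_0:
  assumes P: "is_poset Q le" and z: "z \<in> scyc le Q deg m U 0 \<alpha>" "z \<notin> sbnd le Q deg m 0 \<alpha>"
  shows "new_link le Q deg m U 0 \<alpha> {} z"
proof -
  have chains: "chains le {} = {[]}" by (auto simp: chains_def)
  have ml: "maxlen le {} = 0" by (simp add: maxlen_def chains)
  have z0: "z \<sigma> = 0" if "\<sigma> \<noteq> []" for \<sigma> using z(1) that by (simp add: scyc_def strand_0)
  have "z [] \<noteq> 0"
  proof
    assume "z [] = 0"
    then have "z = (\<lambda>_. 0)" using z0 by (metis (full_types))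
    then show False using z(2) sbnd_zero[OF P] by metis
  qed
  have cyc0: "x \<in> rcyc le {} 0 \<longleftrightarrow> (\<forall>\<sigma>. \<sigma> \<noteq> [] \<longrightarrow> x \<sigma> = 0)" for x :: "nat list \<Rightarrow> 'a"
    by (auto simp: rcyc_def chainsp_def chains_len_def chains)
  have "x \<in> range (\<lambda>r \<sigma>. r * z \<sigma>)" if "x \<in> rcyc le {} 0" for x
  proof (rule range_eqI[of _ _ "x [] / z []"], rule ext)
    fix \<sigma> show "x \<sigma> = x [] / z [] * z \<sigma>"
      using that \<open>z [] \<noteq> 0\<close> z0 unfolding cyc0 by (cases \<sigma>) simp_all
  qed
  moreover have "(\<lambda>\<sigma>. r * z \<sigma>) \<in> rcyc le {} 0" for r using z0 by (simp add: cyc0)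
  ultimately have "rcyc le {} 0 = range (\<lambda>r \<sigma>. r * z \<sigma>)" by blast
  moreover have "rcyc le {} n \<subseteq> (rbnd le {} n :: (nat list \<Rightarrow> 'a) set)" if "n \<noteq> 0" for n
    using that ml by (intro rcyc_subset_rbnd_above) auto
  ultimately show ?thesis using z ml by (simp add: new_link_def)
qed

text \<open>The top homology of \<open>D\<close> is governed by the minimality of \<open>S\<close>,
  the lower homology by exactness of the strand at the levels up to \<open>n\<close>.\<close>

lemma exists_new_link_Suc:
  fixes le Q
  assumes hcw: "hcw_poset TYPE('k::field) Q le" and mono: "poset_morphism m Q le deg"
    and ex: "\<And>j. j < Suc n \<Longrightarrow> (scyc le Q deg m U j \<alpha> :: (nat list \<Rightarrow> 'k) set) \<subseteq> sbnd le Q deg m j \<alpha>"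
    and nex: "\<not> (scyc le Q deg m U (Suc n) \<alpha> :: (nat list \<Rightarrow> 'k) set) \<subseteq> sbnd le Q deg m (Suc n) \<alpha>"
  shows "\<exists>D (z :: nat list \<Rightarrow> 'k). new_link le Q deg m U (Suc n) \<alpha> D z"
proof -
  note P = hcw_is_poset[OF hcw]
  note fQ = is_poset_finite[OF P]
  define E where "E = {b \<in> Q. dd le Q b = n \<and> vle m (deg b) \<alpha>}"
  let ?V = "hstrand le Q deg m n \<alpha> :: (nat list \<Rightarrow> 'k) set"
  let ?B = "sbnd le Q deg m (Suc n) \<alpha> :: (nat list \<Rightarrow> 'k) set"
  have finE: "finite E" using fQ by (simp add: E_def)
  have hsE: "hsupp x \<subseteq> E" if "x \<in> ?V" for x
    using hstrand_nonzeroD(1-3)[OF P that] by (auto simp: hsupp_def E_def)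
  obtain z1 where z1: "z1 \<in> ?V" "push Q z1 = (\<lambda>_. 0)" "z1 \<notin> ?B"
    using nex by (auto simp: scyc_def strand_Suc)
  obtain S z where S: "S \<subseteq> E" and z: "z \<in> ?V" "push Q z = (\<lambda>_. 0)" "z \<notin> ?B" "hsupp z \<subseteq> S"
    and scalar: "\<And>x. x \<in> ?V \<Longrightarrow> push Q x = (\<lambda>_. 0) \<Longrightarrow> hsupp x \<subseteq> S \<Longrightarrow> \<exists>r. x = (\<lambda>\<sigma>. r * z \<sigma>)"
    and span: "\<And>y. y \<in> ?V \<Longrightarrow> \<exists>y'\<in>?V. hsupp y' \<subseteq> S \<and> push Q y' = push Q y"
    by (rule minimal_support_cycle[OF finE, of ?V ?B "push Q" hsupp,
        OF hstrand_add_mult[OF P] sbnd_add_mult[OF P] sbnd_zero[OF P] push_add_mult hsE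
          hsupp_add_mult hstrand_eq_zero[OF P] hstrand_pivot[OF hcw] z1]) blast+
  \<comment> \<open>Taking every lower cell of the strand, and not just those below
    \<open>S\<close>, ensures that bounding chains found in the strand remain available inside
    \<open>D\<close>.\<close>
  define D where "D = {b \<in> Q. vle m (deg b) \<alpha> \<and> (dd le Q b < n \<or> b \<in> S)}"
  have DQ: "D \<subseteq> Q" by (auto simp: D_def)
  have ddD: "dd le Q b \<le> n" if "b \<in> D" for b using that S by (auto simp: D_def E_def)
  have SD: "S \<subseteq> D" using S by (auto simp: D_def E_def)
  have fD: "finite D" using DQ fQ finite_subset by blast
  have down: "Qlt le Q b \<subseteq> D" if b: "b \<in> D" for b
  proof
    fix c assume c: "c \<in> Qlt le Q b"
    then have "dd le Q c < n" using dd_less[OF P, of b c] ddD[OF b] b DQ by force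
    moreover have "c \<in> Q" "le c b" using c by (auto simp: Qlt_def lt_def)
    moreover from this have "vle m (deg c) (deg b)" using mono b DQ unfolding poset_morphism_def by blast
    then have "vle m (deg c) \<alpha>" using b unfolding D_def vle_def by force
    ultimately show "c \<in> D" by (simp add: D_def)
  qed
  have in_chainsp: "x \<in> chainsp le D (Suc k)" if x: "x \<in> hstrand le Q deg m k \<alpha>" and "hsupp x \<subseteq> D"
    for k and x :: "nat list \<Rightarrow> 'k"
    unfolding chainsp_def
  proof (intro CollectI allI impI, rule ccontr)
    fix \<sigma> assume s: "\<sigma> \<notin> chains_len le D (Suc k)" and nz: "x \<sigma> \<noteq> 0"
    obtain a \<tau> where \<sigma>: "\<sigma> = a # \<tau>" using nz x hstrand_iff[OF P, of x] by (cases \<sigma>) auto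
    have "a \<in> D" using nz that \<sigma> by (auto simp: hsupp_def)
    then show False using s hstrand_nonzeroD(4,5)[OF P x nz[unfolded \<sigma>]] Qlt_downset[OF DQ down]
      by (simp add: \<sigma> chains_len_def Cons_in_chains)
  qed
  \<comment> \<open>A chain of \<open>n + 1\<close> elements of \<open>D\<close> has a head of
    dimension at least \<open>n\<close>, which must lie in \<open>S\<close>. So simplicial top
    cycles of \<open>D\<close> are automatically conic.\<close>
  have top_iff: "x \<in> rcyc le D (Suc n) \<longleftrightarrow> x \<in> ?V \<and> push Q x = (\<lambda>_. 0) \<and> hsupp x \<subseteq> S" for x :: "nat list \<Rightarrow> 'k"
  proof
    assume "x \<in> rcyc le D (Suc n)"
    then have xc: "x \<in> chainsp le D (Suc n)" and xd: "\<And>\<sigma>. dl Q \<sigma> x = 0"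
      unfolding rcyc_iff[OF fQ DQ] by simp_all
    have supp: "a \<in> S" if nz: "x (a # \<tau>) \<noteq> 0" for a \<tau>
    proof -
      have a: "a # \<tau> \<in> chains le D" "length \<tau> = n" using chainsp_nonzeroD[OF xc nz] by auto
      then have "n \<le> dd le Q a" using dd_ge_length[OF P, of a \<tau>] chains_mono[OF DQ] by blast
      then show ?thesis using a by (auto simp: Cons_in_chains D_def)
    qed
    have V: "x \<in> ?V"
    proof (rule hstrandI[OF P])
      show "x [] = 0" using xc by (simp add: chainsp_def chains_len_def)
      show "a \<in> Q \<and> dd le Q a = n \<and> vle m (deg a) \<alpha>" if "x (a # \<tau>) \<noteq> 0" for a \<tau>
        using supp[OF that] S by (auto simp: E_def)
      fix a assume a: "a \<in> Q" "dd le Q a = n"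
      have "Qlt le Q a \<subseteq> Q" by (auto simp: Qlt_def)
      then show "(\<lambda>\<tau>. x (a # \<tau>)) \<in> rcyc le (Qlt le Q a) n"
        unfolding rcyc_iff[OF fQ \<open>Qlt le Q a \<subseteq> Q\<close>]
      proof (intro conjI impI allI)
        show "(\<lambda>\<tau>. x (a # \<tau>)) \<in> chainsp le (Qlt le Q a) n"
          using chainsp_Cons[OF xc] chainsp_mono[of "Qlt le D a" "Qlt le Q a"] DQ by (auto simp: Qlt_def)
        fix \<sigma>
        have "x (b # a # \<sigma>) = 0" for b
        proof (rule ccontr)
          assume nz: "x (b # a # \<sigma>) \<noteq> 0"
          then have "b # a # \<sigma> \<in> chains le D" using chainsp_nonzeroD[OF xc] by blast
          then have "b \<in> D" "a \<in> Qlt le Q b" using DQ by (auto simp: Cons_in_chains Qlt_def)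
          then show False using dd_less[OF P, of b a] ddD[of b] a DQ by auto
        qed
        then show "dl Q \<sigma> (\<lambda>\<tau>. x (a # \<tau>)) = 0" using xd[of "a # \<sigma>"] by simp
      qed
    qed
    moreover have "push Q x = (\<lambda>_. 0)" using push_conic_eq_dl[OF P hstrand_conic[OF V]] xd by simp
    ultimately show "x \<in> ?V \<and> push Q x = (\<lambda>_. 0) \<and> hsupp x \<subseteq> S" using supp by (auto simp: hsupp_def)
  next
    assume x: "x \<in> ?V \<and> push Q x = (\<lambda>_. 0) \<and> hsupp x \<subseteq> S"
    then have "dl Q \<sigma> x = 0" for \<sigma>
      using push_conic_eq_dl[OF P hstrand_conic[of x le Q deg m n \<alpha>]] by (simp add: fun_eq_iff)
    then show "x \<in> rcyc le D (Suc n)" unfolding rcyc_iff[OF fQ DQ] using x in_chainsp SD by auto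
  qed
  have zD: "z \<in> rcyc le D (Suc n)" using z by (simp add: top_iff)
  have top: "rcyc le D (Suc n) = range (\<lambda>r \<sigma>. r * z \<sigma>)"
  proof (intro set_eqI iffI)
    fix x :: "nat list \<Rightarrow> 'k" assume "x \<in> rcyc le D (Suc n)"
    then show "x \<in> range (\<lambda>r \<sigma>. r * z \<sigma>)" using scalar[of x] unfolding top_iff by blast
  qed (use rcyc_mult[OF fD zD] in blast)
  have "z \<noteq> (\<lambda>_. 0)" using z(3) sbnd_zero[OF P] by metis
  then obtain \<sigma>0 where "z \<sigma>0 \<noteq> 0" by auto
  then have \<sigma>0: "\<sigma>0 \<in> chains le D" "length \<sigma>0 = Suc n"
    using zD chainsp_nonzeroD[of z le D "Suc n" \<sigma>0] unfolding rcyc_iff[OF fQ DQ] by auto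
  have ml: "maxlen le D = Suc n"
  proof (rule maxlen_eqI[OF fD _ \<sigma>0])
    fix \<sigma> assume s: "\<sigma> \<in> chains le D"
    show "length \<sigma> \<le> Suc n"
    proof (cases \<sigma>)
      case (Cons a \<tau>)
      then have "a # \<tau> \<in> chains le Q" using s chains_mono[OF DQ] by blast
      then have "a \<in> D" "length \<tau> \<le> dd le Q a"
        using s Cons dd_ge_length[OF P] by (auto simp: Cons_in_chains)
      then show ?thesis using ddD[of a] Cons by simp
    qed simp
  qed
  \<comment> \<open>Deform the cycle inside \<open>D\<close> into a conic one, bound it in the
    strand by exactness, and bring the bounding chain back into \<open>D\<close>.\<close>
  have low: "rcyc le D (Suc j) \<subseteq> (rbnd le D (Suc j) :: (nat list \<Rightarrow> 'k) set)" if j: "j < n" for j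
  proof
    fix x :: "nat list \<Rightarrow> 'k" assume x: "x \<in> rcyc le D (Suc j)"
    obtain w where w: "w \<in> chainsp le D (Suc (Suc j))" and "(\<lambda>\<sigma>. x \<sigma> + dl D \<sigma> w) \<in> conic le D j"
      using rcyc_homologous_conic[OF hcw_downset[OF hcw DQ down] x] by blast
    moreover define y where "y = (\<lambda>\<sigma>. x \<sigma> + 1 * dl Q \<sigma> w)"
    ultimately have yD: "y \<in> conic le D j" using dl_mono[OF fQ DQ w] by simp
    then have yQ: "y \<in> conic le Q j" by (intro conic_downset[OF P DQ _ yD] down)
    have "vle m (deg (hd \<sigma>)) \<alpha>" if "y \<sigma> \<noteq> 0" for \<sigma>
    proof -
      have "\<sigma> \<in> chains le D" "length \<sigma> = Suc j"
        using chainsp_nonzeroD[OF conic_chainsp[OF is_poset_subset[OF P DQ] yD] that] by auto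
      then have "hd \<sigma> \<in> D" by (cases \<sigma>) (auto simp: Cons_in_chains)
      then show ?thesis by (simp add: D_def)
    qed
    then have yh: "y \<in> hstrand le Q deg m j \<alpha>" using yQ by (simp add: hstrand_def)
    have "dl Q \<sigma> y = 0" for \<sigma>
      unfolding y_def dl_add_mult using x dl_dl[OF fQ] by (simp add: rcyc_iff[OF fQ DQ])
    then have "push Q y = (\<lambda>_. 0)" using push_conic_eq_dl[OF P yQ] by simp
    then have "y \<in> scyc le Q deg m U (Suc j) \<alpha>" using yh by (simp add: scyc_def strand_Suc)
    then have "y \<in> sbnd le Q deg m (Suc j) \<alpha>" using ex[of "Suc j"] j by blast
    then obtain u0 where u0: "u0 \<in> hstrand le Q deg m (Suc j) \<alpha>" "y = push Q u0" by (auto simp: sbnd_def)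
    \<comment> \<open>Only in the top dimension can \<open>u0\<close> leave \<open>D\<close>. There
      \<open>span\<close> supplies a chain on \<open>S\<close> with the same boundary; below, all
      cells of the strand belong to \<open>D\<close>.\<close>
    have "\<exists>u\<in>hstrand le Q deg m (Suc j) \<alpha>. hsupp u \<subseteq> D \<and> y = push Q u"
    proof (cases "Suc j = n")
      case True
      then obtain u where "u \<in> ?V" "hsupp u \<subseteq> S" "push Q u = push Q u0" using span[of u0] u0(1) by blast
      then show ?thesis using u0(2) SD True by (intro bexI[of _ u]) auto
    next
      case False
      then have "hsupp u0 \<subseteq> D" using hstrand_nonzeroD(1-3)[OF P u0(1)] j by (auto simp: hsupp_def D_def)
      then show ?thesis using u0 by blast
    qed
    then obtain u where u: "u \<in> hstrand le Q deg m (Suc j) \<alpha>" "hsupp u \<subseteq> D" "y = push Q u" by blast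
    have "y = (\<lambda>\<sigma>. dl Q \<sigma> u)" using u push_conic_eq_dl[OF P hstrand_conic[OF u(1)]] by simp
    then have "x \<sigma> + 1 * dl Q \<sigma> w = dl Q \<sigma> u" for \<sigma> unfolding y_def by (rule fun_cong)
    then have "x = (\<lambda>\<sigma>. dl Q \<sigma> (\<lambda>\<sigma>. u \<sigma> + (-1) * w \<sigma>))"
      unfolding dl_add_mult by (simp add: fun_eq_iff eq_diff_eq)
    moreover have "(\<lambda>\<sigma>. u \<sigma> + (-1) * w \<sigma>) \<in> chainsp le D (Suc (Suc j))"
      using in_chainsp[OF u(1,2)] w by (rule chainsp_add_mult)
    ultimately show "x \<in> rbnd le D (Suc j)" unfolding rbnd_iff[OF fQ DQ] by blast
  qed
  have "rcyc le D k \<subseteq> (rbnd le D k :: (nat list \<Rightarrow> 'k) set)" if k: "k \<noteq> Suc n" for k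
  proof (cases k)
    case 0
    obtain v where "v \<in> D" using \<sigma>0 by (cases \<sigma>0) (auto simp: Cons_in_chains)
    then show ?thesis unfolding 0 by (rule rcyc_subset_rbnd_0[OF fD])
  next
    case (Suc j)
    show ?thesis
    proof (cases "j < n")
      case True
      then show ?thesis unfolding Suc by (rule low)
    next
      case False
      then show ?thesis using k Suc ml by (intro rcyc_subset_rbnd_above[OF fD]) simp
    qed
  qed
  then have "new_link le Q deg m U (Suc n) \<alpha> D z"
    using DQ down ml top z unfolding new_link_def by (auto simp: D_def scyc_def strand_Suc)
  then show ?thesis by blast
qed

lemma exists_new_link:
  assumes hcw: "hcw_poset TYPE('k::field) Q le" and mono: "poset_morphism m Q le deg"
    and ex: "\<And>j. j < l \<Longrightarrow> (scyc le Q deg m U j \<alpha> :: (nat list \<Rightarrow> 'k) set) \<subseteq> sbnd le Q deg m j \<alpha>"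
    and nex: "\<not> (scyc le Q deg m U l \<alpha> :: (nat list \<Rightarrow> 'k) set) \<subseteq> sbnd le Q deg m l \<alpha>"
  shows "\<exists>D (z :: nat list \<Rightarrow> 'k). new_link le Q deg m U l \<alpha> D z"
proof (cases l)
  case 0
  from nex obtain z :: "nat list \<Rightarrow> 'k" where
    "z \<in> scyc le Q deg m U l \<alpha>" "z \<notin> sbnd le Q deg m l \<alpha>" unfolding subset_iff by auto
  then show ?thesis unfolding 0 by (intro exI) (rule exists_new_link_0[OF hcw_is_poset[OF hcw]])
next
  case (Suc n)
  show ?thesis unfolding Suc
    by (rule exists_new_link_Suc[OF hcw mono ex[unfolded Suc] nex[unfolded Suc]])
qed

section \<open>Attaching a cell\<close>

lemma chains_cong:
  assumes "\<And>x y. x \<in> S \<Longrightarrow> y \<in> S \<Longrightarrow> le x y = le' x y"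
  shows "chains le S = chains le' S"
proof -
  have "sorted_wrt (\<lambda>x y. lt le y x) \<sigma> = sorted_wrt (\<lambda>x y. lt le' y x) \<sigma>" if "set \<sigma> \<subseteq> S" for \<sigma>
    using that by (induction \<sigma>) (auto simp: lt_def assms subset_iff)
  then show ?thesis unfolding chains_def by blast
qed

text \<open>The order enters only through the chains of \<open>S\<close>, so extending it by a new
  element affects no homology of old subsets.\<close>

lemma homology_cong:
  assumes "chains le S = chains le' S"
  shows "rcyc le S n = rcyc le' S n" "rbnd le S n = rbnd le' S n" "maxlen le S = maxlen le' S"
proof -
  have c: "chains_len le S = chains_len le' S" using assms by (simp add: chains_len_def fun_eq_iff)
  then have cp: "chainsp le S = chainsp le' S" by (simp add: chainsp_def fun_eq_iff)
  have b: "bd le S = bd le' S" using c by (simp add: bd_def fun_eq_iff)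
  show "rcyc le S n = rcyc le' S n" by (simp add: rcyc_def cp b)
  show "rbnd le S n = rbnd le' S n" by (simp add: rbnd_def cp b)
  show "maxlen le S = maxlen le' S" by (simp add: maxlen_def assms)
qed

section \<open>The enlarged poset and its strands\<close>

definition cone :: "nat \<Rightarrow> (nat list \<Rightarrow> 'k) \<Rightarrow> nat list \<Rightarrow> 'k::zero" where
  "cone a z \<sigma> = (case \<sigma> of [] \<Rightarrow> 0 | b # \<tau> \<Rightarrow> if b = a then z \<tau> else 0)"

lemma cone_simps [simp]: "cone a z [] = 0" "cone a z (b # \<tau>) = (if b = a then z \<tau> else 0)"
  by (simp_all add: cone_def)

locale cell_attachment =
  fixes le Q deg m U l \<alpha> D and z :: "nat list \<Rightarrow> 'k::field" and a :: nat
  assumes hcw: "hcw_poset TYPE('k) Q le" and mono: "poset_morphism m Q le deg"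
    and link: "new_link le Q deg m U l \<alpha> D z" and fresh: "a \<notin> Q"
begin

text \<open>As \<open>le\<close> is arbitrary outside \<open>Q\<close>, its values at the fresh
  element \<open>a\<close> are overwritten; \<open>a\<close> becomes maximal.\<close>

definition "le' x y = (if y = a then x \<in> insert a D else x \<noteq> a \<and> le x y)"

definition "Q' = insert a Q"

definition "deg' = deg(a := \<alpha>)"

lemma P: "is_poset Q le" using hcw by (rule hcw_is_poset)

lemma D: "D \<subseteq> Q" "\<And>b. b \<in> D \<Longrightarrow> Qlt le Q b \<subseteq> D" "\<And>b. b \<in> D \<Longrightarrow> vle m (deg b) \<alpha>"
  "maxlen le D = l" "z \<in> scyc le Q deg m U l \<alpha>" "z \<notin> sbnd le Q deg m l \<alpha>"
  "rcyc le D l = range (\<lambda>r \<sigma>. r * z \<sigma>)" "\<And>n. n \<noteq> l \<Longrightarrow> (rcyc le D n :: (nat list \<Rightarrow> 'k) set) \<subseteq> rbnd le D n"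
  using link unfolding new_link_def by blast+

lemma chains_le': "S \<subseteq> Q \<Longrightarrow> chains le' S = chains le S"
  by (rule chains_cong) (use fresh in \<open>auto simp: le'_def\<close>)

lemmas homology_le' = homology_cong[OF chains_le']

lemma Qlt'_old: "b \<in> Q \<Longrightarrow> Qlt le' Q' b = Qlt le Q b"
  using fresh by (auto simp: Qlt_def lt_def le'_def Q'_def)

lemma Qlt'_new: "Qlt le' Q' a = D"
  using fresh D(1) by (auto simp: Qlt_def lt_def le'_def Q'_def)

lemma Qlt_sub: "Qlt le Q b \<subseteq> Q" by (auto simp: Qlt_def)

lemma P': "is_poset Q' le'"
proof -
  have fin: "finite Q'" using P by (simp add: is_poset_def Q'_def)
  have refl: "le' x x" if "x \<in> Q'" for x using P that by (auto simp: is_poset_def Q'_def le'_def)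
  have antisym: "x = y" if "x \<in> Q'" "y \<in> Q'" "le' x y" "le' y x" for x y
  proof (cases "x = a \<or> y = a")
    case True
    have "a \<notin> D" using fresh D(1) by blast
    then show ?thesis using that True by (auto simp: le'_def split: if_splits)
  next
    case False
    then have "x \<in> Q" "y \<in> Q" "le x y" "le y x" using that by (simp_all add: le'_def Q'_def)
    then show ?thesis using P unfolding is_poset_def by blast
  qed
  have trans: "le' x w" if xyw: "x \<in> Q'" "y \<in> Q'" "w \<in> Q'" "le' x y" "le' y w" for x y w
  proof (cases "w = a")
    case True
    then have y: "y \<in> insert a D" using xyw by (simp add: le'_def)
    show ?thesis
    proof (cases "y = a")
      case False
      then have "y \<in> D" "x \<in> Q" "le x y" using xyw y by (auto simp: le'_def Q'_def)
      then have "x \<in> D" using D(2)[of y] by (cases "x = y") (auto simp: Qlt_def lt_def)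
      then show ?thesis using True by (simp add: le'_def)
    qed (use True xyw in simp)
  next
    case False
    then have y: "y \<in> Q" "le y w" "w \<in> Q" using xyw by (auto simp: le'_def Q'_def)
    then have "x \<in> Q" "le x y" using xyw fresh by (auto simp: le'_def Q'_def split: if_splits)
    then have "le x w" using P y unfolding is_poset_def by blast
    then show ?thesis using False \<open>x \<in> Q\<close> fresh by (auto simp: le'_def)
  qed
  show ?thesis unfolding is_poset_def using fin refl antisym trans by blast
qed

lemma dd'_old: "b \<in> Q \<Longrightarrow> dd le' Q' b = dd le Q b"
  using dd_eq[OF P', of b] dd_eq[OF P, of b] Qlt'_old homology_le'(3)[OF Qlt_sub] by (simp add: Q'_def)

lemma dd'_new: "dd le' Q' a = l"
  using dd_eq[OF P', of a] Qlt'_new homology_le'(3)[OF D(1)] D(4) by (simp add: Q'_def)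

lemma quot_iso_range:
  assumes "z \<noteq> (\<lambda>_. 0)" shows "quot_iso_k (range (\<lambda>r \<sigma>. r * z \<sigma>)) {\<lambda>_. 0}"
proof -
  obtain \<sigma>0 where nz: "z \<sigma>0 \<noteq> 0" using assms by auto
  let ?Z = "range (\<lambda>r \<sigma>. r * z \<sigma>)"
  \<comment> \<open>Evaluation at a position where \<open>z\<close> does not vanish recovers the
    scalar.\<close>
  define \<phi> where "\<phi> x = x \<sigma>0 / z \<sigma>0" for x
  have "\<phi> ` ?Z = UNIV"
  proof -
    have "\<phi> (\<lambda>\<sigma>. r * z \<sigma>) = r" for r using nz by (simp add: \<phi>_def)
    then show ?thesis by (simp add: image_image)
  qed
  moreover have "{x \<in> ?Z. \<phi> x = 0} = {\<lambda>_. 0}"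
  proof (intro set_eqI iffI)
    fix x :: "nat list \<Rightarrow> 'k" assume "x \<in> {\<lambda>_. 0}"
    moreover have "(\<lambda>_. 0) \<in> ?Z" using rangeI[of "\<lambda>r \<sigma>. r * z \<sigma>" 0] by simp
    ultimately show "x \<in> {x \<in> ?Z. \<phi> x = 0}" by (simp add: \<phi>_def)
  qed (use nz in \<open>auto simp: \<phi>_def\<close>)
  ultimately show ?thesis
    unfolding quot_iso_k_def by (intro exI[of _ \<phi>]) (auto simp: \<phi>_def add_divide_distrib)
qed

lemma z_nonzero: "z \<noteq> (\<lambda>_. 0)"
  using D(6) sbnd_zero[OF P] by metis

lemma hcw': "hcw_poset TYPE('k) Q' le'"
  unfolding hcw_poset_def Let_def
proof (intro conjI P' ballI allI)
  have fD: "finite D" using D(1) is_poset_finite[OF P] finite_subset by blast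
  fix b n assume b: "b \<in> Q'"
  have old: "(n = maxlen le (Qlt le Q b) \<longrightarrow> quot_iso_k (rcyc le (Qlt le Q b) n :: (nat list \<Rightarrow> 'k) set) (rbnd le (Qlt le Q b) n)) \<and>
        (n \<noteq> maxlen le (Qlt le Q b) \<longrightarrow> (rcyc le (Qlt le Q b) n :: (nat list \<Rightarrow> 'k) set) \<subseteq> rbnd le (Qlt le Q b) n)"
    if "b \<in> Q" using hcw that unfolding hcw_poset_def Let_def by blast
  have new: "(n = maxlen le D \<longrightarrow> quot_iso_k (rcyc le D n :: (nat list \<Rightarrow> 'k) set) (rbnd le D n)) \<and>
        (n \<noteq> maxlen le D \<longrightarrow> (rcyc le D n :: (nat list \<Rightarrow> 'k) set) \<subseteq> rbnd le D n)"
  proof (intro conjI impI)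
    have "rbnd le D (maxlen le D) = ({\<lambda>_. 0} :: (nat list \<Rightarrow> 'k) set)" by (rule rbnd_maxlen[OF fD])
    then show "quot_iso_k (rcyc le D n :: (nat list \<Rightarrow> 'k) set) (rbnd le D n)" if "n = maxlen le D"
      using quot_iso_range[OF z_nonzero] D(4,7) that by simp
    show "(rcyc le D n :: (nat list \<Rightarrow> 'k) set) \<subseteq> rbnd le D n" if "n \<noteq> maxlen le D"
      using that unfolding D(4) by (rule D(8))
  qed
  have "S \<subseteq> Q \<Longrightarrow> rcyc le' S n = (rcyc le S n :: (nat list \<Rightarrow> 'k) set)"
    "S \<subseteq> Q \<Longrightarrow> rbnd le' S n = (rbnd le S n :: (nat list \<Rightarrow> 'k) set)"
    "S \<subseteq> Q \<Longrightarrow> maxlen le' S = maxlen le S" for S n by (rule homology_le', assumption)+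
  note c = this
  have "(n = maxlen le' (Qlt le' Q' b) \<longrightarrow>
        quot_iso_k (rcyc le' (Qlt le' Q' b) n :: (nat list \<Rightarrow> 'k) set) (rbnd le' (Qlt le' Q' b) n)) \<and>
      (n \<noteq> maxlen le' (Qlt le' Q' b) \<longrightarrow>
        (rcyc le' (Qlt le' Q' b) n :: (nat list \<Rightarrow> 'k) set) \<subseteq> rbnd le' (Qlt le' Q' b) n)"
  proof (cases "b \<in> Q")
    case True
    show ?thesis unfolding Qlt'_old[OF True] c[OF Qlt_sub] by (rule old[OF True])
  next
    case False
    then have "b = a" using b by (simp add: Q'_def)
    show ?thesis unfolding \<open>b = a\<close> Qlt'_new c[OF D(1)] by (rule new)
  qed
  then show "n = maxlen le' (Qlt le' Q' b) \<longrightarrow>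
        quot_iso_k (rcyc le' (Qlt le' Q' b) n :: (nat list \<Rightarrow> 'k) set) (rbnd le' (Qlt le' Q' b) n)"
    "n \<noteq> maxlen le' (Qlt le' Q' b) \<longrightarrow>
        (rcyc le' (Qlt le' Q' b) n :: (nat list \<Rightarrow> 'k) set) \<subseteq> rbnd le' (Qlt le' Q' b) n" by blast+
qed

lemma mono': "poset_morphism m Q' le' deg'"
  unfolding poset_morphism_def
proof (intro ballI impI)
  fix x y assume xy: "x \<in> Q'" "y \<in> Q'" "le' x y"
  show "vle m (deg' x) (deg' y)"
  proof (cases "y = a")
    case True
    then have "x = a \<or> x \<in> D" using xy by (auto simp: le'_def)
    then show ?thesis using True D(1,3) fresh by (auto simp: deg'_def vle_def)
  next
    case False
    then show ?thesis using xy mono fresh by (auto simp: deg'_def le'_def Q'_def poset_morphism_def)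
  qed
qed

lemma hstrand_fresh: "y \<in> hstrand le Q deg m n c \<Longrightarrow> y (a # \<tau>) = 0" for y :: "nat list \<Rightarrow> 'k"
  using hstrand_nonzeroD(1)[OF P, of y] fresh by blast

text \<open>Dimensions, degrees and links of old cells are unchanged, while the link cycles at
  \<open>a\<close> are the multiples of \<open>z\<close>. Hence the strand grows by the line through
  \<open>cone a z\<close>, and this only in homological degree \<open>l\<close> and in degrees above
  \<alpha>.\<close>

lemma hstrand'_iff:
  fixes x :: "nat list \<Rightarrow> 'k"
  shows "x \<in> hstrand le' Q' deg' m n c \<longleftrightarrow>
    (\<exists>y\<in>hstrand le Q deg m n c. \<exists>r. (r = 0 \<or> n = l \<and> vle m \<alpha> c) \<and> x = (\<lambda>\<sigma>. y \<sigma> + r * cone a z \<sigma>))"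
proof -
  define C' where "C' b = (if b \<in> Q' \<and> dd le' Q' b = n \<and> vle m (deg' b) c then rcyc le' (Qlt le' Q' b) n
    else {\<lambda>_. 0 :: 'k})" for b
  define C where "C b = (if b \<in> Q \<and> dd le Q b = n \<and> vle m (deg b) c then rcyc le (Qlt le Q b) n
    else {\<lambda>_. 0 :: 'k})" for b
  have rcyc': "rcyc le' S n = (rcyc le S n :: (nat list \<Rightarrow> 'k) set)" if "S \<subseteq> Q" for S
    by (rule homology_le'(1)[OF that])
  have old: "C' b = C b" if "b \<noteq> a" for b
    using that dd'_old[of b] Qlt'_old[of b] rcyc'[OF Qlt_sub]
    by (auto simp: C_def C'_def Q'_def deg'_def)
  have new: "C' a = (if n = l \<and> vle m \<alpha> c then range (\<lambda>r \<sigma>. r * z \<sigma>) else {\<lambda>_. 0})"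
    using dd'_new Qlt'_new rcyc'[OF D(1)] D(7) by (auto simp: C'_def Q'_def deg'_def)
  have Ca: "C a = {\<lambda>_. 0}" using fresh by (simp add: C_def)
  have iff: "x \<in> hstrand le Q deg m n c \<longleftrightarrow> x [] = 0 \<and> (\<forall>b. (\<lambda>\<tau>. x (b # \<tau>)) \<in> C b)" for x :: "nat list \<Rightarrow> 'k"
    unfolding hstrand_iff[OF P] C_def ..
  have iff': "x \<in> hstrand le' Q' deg' m n c \<longleftrightarrow> x [] = 0 \<and> (\<forall>b. (\<lambda>\<tau>. x (b # \<tau>)) \<in> C' b)" for x :: "nat list \<Rightarrow> 'k"
    unfolding hstrand_iff[OF P'] C'_def ..
  show ?thesis
  proof
    assume x: "x \<in> hstrand le' Q' deg' m n c"
    have "(\<lambda>\<tau>. x (a # \<tau>)) \<in> C' a" using x iff' by blast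
    then obtain r where r: "r = 0 \<or> n = l \<and> vle m \<alpha> c" "(\<lambda>\<tau>. x (a # \<tau>)) = (\<lambda>\<tau>. r * z \<tau>)"
      unfolding new by (cases "n = l \<and> vle m \<alpha> c") auto
    define y where "y = (\<lambda>\<sigma>. x \<sigma> - r * cone a z \<sigma>)"
    have "(\<lambda>\<tau>. y (b # \<tau>)) \<in> C b" for b
    proof (cases "b = a")
      case True
      then show ?thesis using fun_cong[OF r(2)] by (simp add: y_def Ca fun_eq_iff)
    next
      case False
      then show ?thesis
        using x[unfolded iff', THEN conjunct2, THEN spec, of b] old[OF False] by (simp add: y_def)
    qed
    then have "y \<in> hstrand le Q deg m n c" using x iff' by (simp add: iff y_def)
    moreover have "x = (\<lambda>\<sigma>. y \<sigma> + r * cone a z \<sigma>)" by (simp add: y_def)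
    ultimately show "\<exists>y\<in>hstrand le Q deg m n c. \<exists>r. (r = 0 \<or> n = l \<and> vle m \<alpha> c) \<and> x = (\<lambda>\<sigma>. y \<sigma> + r * cone a z \<sigma>)"
      using r(1) by blast
  next
    assume "\<exists>y\<in>hstrand le Q deg m n c. \<exists>r. (r = 0 \<or> n = l \<and> vle m \<alpha> c) \<and> x = (\<lambda>\<sigma>. y \<sigma> + r * cone a z \<sigma>)"
    then obtain y r where y: "y \<in> hstrand le Q deg m n c" and r: "r = 0 \<or> n = l \<and> vle m \<alpha> c"
      and x: "x = (\<lambda>\<sigma>. y \<sigma> + r * cone a z \<sigma>)" by blast
    have "(\<lambda>\<tau>. x (b # \<tau>)) \<in> C' b" for b
    proof (cases "b = a")
      case True
      have "(\<lambda>\<tau>. x (a # \<tau>)) = (\<lambda>\<tau>. r * z \<tau>)" using hstrand_fresh[OF y] by (simp add: x)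
      then show ?thesis unfolding True new using r by auto
    next
      case False
      then show ?thesis
        using y[unfolded iff, THEN conjunct2, THEN spec, of b] old[OF False] by (simp add: x)
    qed
    then show "x \<in> hstrand le' Q' deg' m n c" using y iff by (simp add: iff' x)
  qed
qed

lemma hstrand'_other:
  "\<not> (n = l \<and> vle m \<alpha> c) \<Longrightarrow> hstrand le' Q' deg' m n c = (hstrand le Q deg m n c :: (nat list \<Rightarrow> 'k) set)"
  by (rule set_eqI) (auto simp: hstrand'_iff)

lemma push'_eq:
  fixes y :: "nat list \<Rightarrow> 'k"
  assumes "y \<in> hstrand le Q deg m n c"
  shows "push Q' (\<lambda>\<sigma>. y \<sigma> + r * cone a z \<sigma>) = (\<lambda>\<sigma>. push Q y \<sigma> + r * z \<sigma>)"
proof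
  fix \<sigma>
  have "push Q' (\<lambda>\<sigma>. y \<sigma> + r * cone a z \<sigma>) \<sigma>
      = (y (a # \<sigma>) + r * z \<sigma>) + (\<Sum>b\<in>Q. y (b # \<sigma>) + r * cone a z (b # \<sigma>))"
    unfolding push_def Q'_def using is_poset_finite[OF P] fresh by simp
  also have "(\<Sum>b\<in>Q. y (b # \<sigma>) + r * cone a z (b # \<sigma>)) = push Q y \<sigma>"
    unfolding push_def using fresh by (intro sum.cong) auto
  finally show "push Q' (\<lambda>\<sigma>. y \<sigma> + r * cone a z \<sigma>) \<sigma> = push Q y \<sigma> + r * z \<sigma>"
    using hstrand_fresh[OF assms] by simp
qed

lemma push'_old:
  fixes y :: "nat list \<Rightarrow> 'k"
  assumes "y \<in> hstrand le Q deg m n c" shows "push Q' y = push Q y"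
  using push'_eq[OF assms, of 0] by simp

lemma strand'_other:
  "\<not> (j = Suc l \<and> vle m \<alpha> c) \<Longrightarrow> strand le' Q' deg' m U j c = (strand le Q deg m U j c :: (nat list \<Rightarrow> 'k) set)"
  using hstrand'_other by (auto simp: strand_def split: nat.split)

text \<open>A cell of dimension \<open>l\<close> sits at level \<open>l + 1\<close>: it can alter
  cycles at that level and boundaries at level \<open>l\<close>, and nothing else. All preservation
  of exactness rests on this offset.\<close>

lemma scyc'_other:
  assumes "\<not> (j = Suc l \<and> vle m \<alpha> c)"
  shows "scyc le' Q' deg' m U j c = (scyc le Q deg m U j c :: (nat list \<Rightarrow> 'k) set)"
  unfolding scyc_def strand'_other[OF assms]
  using push'_old by (cases j) (auto simp: strand_Suc)

lemma sbnd'_other: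
  assumes "\<not> (j = l \<and> vle m \<alpha> c)"
  shows "sbnd le' Q' deg' m j c = (sbnd le Q deg m j c :: (nat list \<Rightarrow> 'k) set)"
  unfolding sbnd_def hstrand'_other[OF assms] using push'_old by (intro image_cong) auto

lemma sbnd'_mono: "sbnd le Q deg m j c \<subseteq> (sbnd le' Q' deg' m j c :: (nat list \<Rightarrow> 'k) set)"
proof
  fix x :: "nat list \<Rightarrow> 'k" assume "x \<in> sbnd le Q deg m j c"
  then obtain y where y: "y \<in> hstrand le Q deg m j c" "x = push Q y" by (auto simp: sbnd_def)
  then have "y \<in> hstrand le' Q' deg' m j c" unfolding hstrand'_iff by (intro bexI[of _ y] exI[of _ 0]) auto
  then show "x \<in> sbnd le' Q' deg' m j c" unfolding sbnd_def using push'_old[OF y(1)] y(2) by (metis imageI)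
qed

lemma z_sbnd': "z \<in> sbnd le' Q' deg' m l \<alpha>"
proof -
  have "vle m \<alpha> \<alpha>" by (simp add: vle_def)
  then have "(\<lambda>\<sigma>. 0 + 1 * cone a z \<sigma>) \<in> hstrand le' Q' deg' m l \<alpha>"
    unfolding hstrand'_iff
    by (intro bexI[of _ "\<lambda>_. 0"] exI[of _ 1]) (simp_all add: hstrand_zero[OF P])
  moreover have "push Q' (\<lambda>\<sigma>. 0 + 1 * cone a z \<sigma>) = z"
    unfolding push'_eq[OF hstrand_zero[OF P]] by (simp add: push_def)
  ultimately show ?thesis unfolding sbnd_def by (metis imageI)
qed

text \<open>The new boundary \<open>z\<close> was not a boundary before, so no cycle of degree \<open>\<alpha>\<close> can involve the new cell.\<close>
lemma cycle'_old:
  fixes x :: "nat list \<Rightarrow> 'k"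
  assumes x: "x \<in> hstrand le' Q' deg' m n \<alpha>" and cyc: "push Q' x = (\<lambda>_. 0)"
  shows "x \<in> hstrand le Q deg m n \<alpha> \<and> push Q x = (\<lambda>_. 0)"
proof -
  obtain y r where y: "y \<in> hstrand le Q deg m n \<alpha>" and r: "r = 0 \<or> n = l" and xy: "x = (\<lambda>\<sigma>. y \<sigma> + r * cone a z \<sigma>)"
    using x unfolding hstrand'_iff by blast
  have p: "push Q y \<sigma> + r * z \<sigma> = 0" for \<sigma> using cyc fun_cong[OF push'_eq[OF y, of r], of \<sigma>] xy by simp
  have "r = 0"
  proof (rule ccontr)
    assume nz: "r \<noteq> 0"
    then have "z = (\<lambda>\<sigma>. 0 + (- inverse r) * push Q y \<sigma>)"
      using p by (simp add: fun_eq_iff field_simps add_eq_0_iff)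
    moreover have "push Q y \<in> sbnd le Q deg m l \<alpha>" using y r nz by (simp add: sbnd_def)
    ultimately have "z \<in> sbnd le Q deg m l \<alpha>"
      using sbnd_add_mult[OF P sbnd_zero[OF P], of "push Q y" deg m l \<alpha> "- inverse r"] by simp
    then show False using D(6) by simp
  qed
  then show ?thesis using y xy p by auto
qed

text \<open>The nonzero \<open>z\<close> either is an element of the ideal component of degree
  \<alpha> or involves an older cell of degree at most \<alpha>, whose degree lies in the
  ideal.\<close>

lemma U_\<alpha>:
  assumes U: "\<And>b. b \<in> Q \<Longrightarrow> U (deg b)" and up: "\<And>c d. U c \<Longrightarrow> vle m c d \<Longrightarrow> U d"
  shows "U \<alpha>"
proof -
  obtain \<sigma> where nz: "z \<sigma> \<noteq> 0" using z_nonzero by auto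
  show ?thesis
  proof (cases l)
    case 0
    then show ?thesis using D(5) nz by (cases "\<sigma> = []") (auto simp: scyc_def strand_0)
  next
    case (Suc n)
    then have zh: "z \<in> hstrand le Q deg m n \<alpha>" using D(5) by (simp add: scyc_def strand_Suc)
    then obtain b \<tau> where "\<sigma> = b # \<tau>" using nz hstrand_iff[OF P, of z] by (cases \<sigma>) auto
    then show ?thesis using hstrand_nonzeroD(1,3)[OF P zh, of b \<tau>] nz U up by blast
  qed
qed

end

text \<open>The invariant of the construction. Its last clause encodes minimality: a differential
  has cycles as values, so none of its values in degree \<open>deg b\<close> can involve
  \<open>b\<close>, and no unit entry occurs.\<close>

definition good_cells ::
  "'k::field itself \<Rightarrow> (nat \<Rightarrow> nat \<Rightarrow> bool) \<Rightarrow> nat set \<Rightarrow> (nat \<Rightarrow> nat \<Rightarrow> int) \<Rightarrow> nat \<Rightarrow> ((nat \<Rightarrow> int) \<Rightarrow> bool) \<Rightarrow>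
    (nat \<Rightarrow> int) set \<Rightarrow> bool" where
  "good_cells _ le Q deg m U W \<longleftrightarrow> hcw_poset TYPE('k) Q le \<and> poset_morphism m Q le deg \<and>
    (\<forall>b\<in>Q. deg b \<in> W \<and> U (deg b)) \<and>
    (\<forall>b\<in>Q. \<forall>n. \<forall>x\<in>(hstrand le Q deg m n (deg b) :: (nat list \<Rightarrow> 'k) set).
       push Q x = (\<lambda>_. 0) \<longrightarrow> b \<notin> hsupp x)"

definition exact_at ::
  "'k::field itself \<Rightarrow> (nat \<Rightarrow> nat \<Rightarrow> bool) \<Rightarrow> nat set \<Rightarrow> (nat \<Rightarrow> nat \<Rightarrow> int) \<Rightarrow> nat \<Rightarrow> ((nat \<Rightarrow> int) \<Rightarrow> bool) \<Rightarrow>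
    nat \<Rightarrow> (nat \<Rightarrow> int) \<Rightarrow> bool" where
  "exact_at _ le Q deg m U j c \<longleftrightarrow> (scyc le Q deg m U j c :: (nat list \<Rightarrow> 'k) set) \<subseteq> sbnd le Q deg m j c"

text \<open>Since \<alpha> is maximal in \<open>W\<close>, strands belonging to cells of other
  degrees do not see the new cell, and their invariant survives. The bound \<open>J\<close> concerns
  only cells of degree different from \<alpha>, so it survives too. Constant cycles with strictly
  growing boundaries give the progress measure.\<close>

lemma attach_cell:
  fixes z :: "nat list \<Rightarrow> 'k::field"
  assumes good: "good_cells TYPE('k) le Q deg m U W"
    and up: "\<forall>c d. U c \<longrightarrow> vle m c d \<longrightarrow> U d"
    and \<alpha>: "\<alpha> \<in> W" and maximal: "\<forall>\<gamma>\<in>W. vle m \<alpha> \<gamma> \<longrightarrow> \<gamma> = \<alpha>"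
    and link: "new_link le Q deg m U l \<alpha> D z"
    and J: "\<forall>b\<in>Q. deg b \<noteq> \<alpha> \<longrightarrow> dd le Q b < J"
  shows "\<exists>le' Q' deg'. good_cells TYPE('k) le' Q' deg' m U W \<and>
    (\<forall>b\<in>Q'. deg' b \<noteq> \<alpha> \<longrightarrow> dd le' Q' b < J) \<and>
    (\<forall>c j. \<not> vle m \<alpha> c \<longrightarrow> exact_at TYPE('k) le Q deg m U j c \<longrightarrow> exact_at TYPE('k) le' Q' deg' m U j c) \<and>
    (\<forall>j<l. exact_at TYPE('k) le Q deg m U j \<alpha> \<longrightarrow> exact_at TYPE('k) le' Q' deg' m U j \<alpha>) \<and>
    scyc le' Q' deg' m U l \<alpha> = (scyc le Q deg m U l \<alpha> :: (nat list \<Rightarrow> 'k) set) \<and>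
    (sbnd le Q deg m l \<alpha> :: (nat list \<Rightarrow> 'k) set) \<subset> sbnd le' Q' deg' m l \<alpha>"
proof -
  have hcw: "hcw_poset TYPE('k) Q le" and mono: "poset_morphism m Q le deg"
    and degW: "\<And>b. b \<in> Q \<Longrightarrow> deg b \<in> W" and degU: "\<And>b. b \<in> Q \<Longrightarrow> U (deg b)"
    and min: "\<And>b n x. b \<in> Q \<Longrightarrow> x \<in> (hstrand le Q deg m n (deg b) :: (nat list \<Rightarrow> 'k) set) \<Longrightarrow>
       push Q x = (\<lambda>_. 0) \<Longrightarrow> b \<notin> hsupp x"
    using good unfolding good_cells_def by blast+
  obtain a where fresh: "a \<notin> Q" using ex_new_if_finite[OF infinite_UNIV_nat is_poset_finite[OF hcw_is_poset[OF hcw]]] by blast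
  interpret A: cell_attachment le Q deg m U l \<alpha> D z a by unfold_locales (fact hcw mono link fresh)+
  have old: "A.deg' b = deg b" "b \<in> Q" if "b \<in> A.Q'" "b \<noteq> a" for b
    using that by (auto simp: A.deg'_def A.Q'_def)
  have new: "A.deg' a = \<alpha>" by (simp add: A.deg'_def)
  have "b \<notin> hsupp x" if b: "b \<in> A.Q'" and x: "x \<in> hstrand A.le' A.Q' A.deg' m n (A.deg' b)"
    and cyc: "push A.Q' x = (\<lambda>_. 0)" for b n and x :: "nat list \<Rightarrow> 'k"
  proof (cases "A.deg' b = \<alpha>")
    case True
    have x': "x \<in> hstrand le Q deg m n \<alpha>" "push Q x = (\<lambda>_. 0)"
      using A.cycle'_old[OF x[unfolded True] cyc] by auto
    show ?thesis
    proof (cases "b = a")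
      case True
      then show ?thesis using A.hstrand_fresh[OF x'(1)] by (simp add: hsupp_def)
    next
      case False
      then show ?thesis using min[of b x n] old[OF b False] True x' by simp
    qed
  next
    case False
    then have "b \<noteq> a" using new by blast
    note o = old[OF b this]
    have "\<not> vle m \<alpha> (deg b)" using maximal degW[OF o(2)] False o(1) by auto
    then have "x \<in> hstrand le Q deg m n (deg b)" using x A.hstrand'_other[of n "deg b"] o(1) by simp
    moreover from this have "push Q x = (\<lambda>_. 0)" using A.push'_old cyc by metis
    ultimately show ?thesis using min[OF o(2)] by blast
  qed
  moreover have "A.deg' b \<in> W \<and> U (A.deg' b)" if "b \<in> A.Q'" for b
    using old[OF that] new \<alpha> degW degU A.U_\<alpha>[OF degU up[rule_format]] by (cases "b = a") auto
  ultimately have good': "good_cells TYPE('k) A.le' A.Q' A.deg' m U W"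
    unfolding good_cells_def using A.hcw' A.mono' by blast
  have J': "dd A.le' A.Q' b < J" if "b \<in> A.Q'" "A.deg' b \<noteq> \<alpha>" for b
  proof -
    have "b \<noteq> a" using that new by blast
    from old[OF that(1) this] show ?thesis using that J A.dd'_old by simp
  qed
  have e1: "exact_at TYPE('k) A.le' A.Q' A.deg' m U j c" if "\<not> vle m \<alpha> c" "exact_at TYPE('k) le Q deg m U j c" for c j
    using that A.scyc'_other[of j c] A.sbnd'_other[of j c] by (simp add: exact_at_def)
  have e2: "exact_at TYPE('k) A.le' A.Q' A.deg' m U j \<alpha>" if "j < l" "exact_at TYPE('k) le Q deg m U j \<alpha>" for j
    using that A.scyc'_other[of j \<alpha>] A.sbnd'_other[of j \<alpha>] by (simp add: exact_at_def)
  show ?thesis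
  proof (intro exI conjI)
    show "good_cells TYPE('k) A.le' A.Q' A.deg' m U W" by (fact good')
    show "\<forall>b\<in>A.Q'. A.deg' b \<noteq> \<alpha> \<longrightarrow> dd A.le' A.Q' b < J" using J' by blast
    show "\<forall>c j. \<not> vle m \<alpha> c \<longrightarrow> exact_at TYPE('k) le Q deg m U j c \<longrightarrow> exact_at TYPE('k) A.le' A.Q' A.deg' m U j c"
      using e1 by blast
    show "\<forall>j<l. exact_at TYPE('k) le Q deg m U j \<alpha> \<longrightarrow> exact_at TYPE('k) A.le' A.Q' A.deg' m U j \<alpha>"
      using e2 by blast
    show "scyc A.le' A.Q' A.deg' m U l \<alpha> = (scyc le Q deg m U l \<alpha> :: (nat list \<Rightarrow> 'k) set)"
      by (rule A.scyc'_other) simp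
    show "(sbnd le Q deg m l \<alpha> :: (nat list \<Rightarrow> 'k) set) \<subset> sbnd A.le' A.Q' A.deg' m l \<alpha>"
    proof (rule psubsetI[OF A.sbnd'_mono], rule notI)
      assume "(sbnd le Q deg m l \<alpha> :: (nat list \<Rightarrow> 'k) set) = sbnd A.le' A.Q' A.deg' m l \<alpha>"
      then show False using A.z_sbnd' A.D(6) by simp
    qed
  qed
qed

section \<open>Saturation\<close>

definition lead :: "('a::countable \<Rightarrow> 'b::zero) \<Rightarrow> nat" where
  "lead x = Max (to_nat ` {\<sigma>. x \<sigma> \<noteq> 0})"

text \<open>The set of leading positions serves as a dimension count for spaces of finitely supported functions.\<close>
lemma lead_image_psubset:
  fixes A B :: "('s::countable \<Rightarrow> 'k::field) set"
  assumes A: "\<And>x y r. x \<in> A \<Longrightarrow> y \<in> A \<Longrightarrow> (\<lambda>\<sigma>. x \<sigma> + r * y \<sigma>) \<in> A" and A0: "(\<lambda>_. 0) \<in> A"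
    and B: "\<And>x y r. x \<in> B \<Longrightarrow> y \<in> B \<Longrightarrow> (\<lambda>\<sigma>. x \<sigma> + r * y \<sigma>) \<in> B"
    and fin: "\<And>x. x \<in> B \<Longrightarrow> finite {\<sigma>. x \<sigma> \<noteq> 0}" and AB: "A \<subset> B"
  shows "lead ` (A - {\<lambda>_. 0}) \<subset> lead ` (B - {\<lambda>_. 0})"
proof -
  obtain z0 where "z0 \<in> B - A" using AB by blast
  \<comment> \<open>Gaussian elimination: if the leading position of this element also occurred in
    \<open>A\<close>, cancelling it there would produce an element of \<open>B - A\<close> with a
    smaller one.\<close>
  then obtain z where z: "z \<in> B - A" and least: "\<And>y. y \<in> B - A \<Longrightarrow> lead z \<le> lead y"
    using ex_has_least_nat[of "\<lambda>z. z \<in> B - A" z0 lead] by blast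
  have znz: "z \<noteq> (\<lambda>_. 0)" using z A0 by blast
  have le_lead: "to_nat \<sigma> \<le> lead x" if "x \<in> B" "x \<sigma> \<noteq> 0" for x \<sigma>
    unfolding lead_def using that fin by (intro Max_ge) auto
  have lead_in: "\<exists>\<sigma>. x \<sigma> \<noteq> 0 \<and> to_nat \<sigma> = lead x" if "x \<in> B" "x \<noteq> (\<lambda>_. 0)" for x
  proof -
    have "lead x \<in> to_nat ` {\<sigma>. x \<sigma> \<noteq> 0}"
      unfolding lead_def by (rule Max_in) (use that fin in auto)
    then show ?thesis by auto
  qed
  have "lead z \<notin> lead ` (A - {\<lambda>_. 0})"
  proof
    assume "lead z \<in> lead ` (A - {\<lambda>_. 0})"
    then obtain b where "b \<in> A - {\<lambda>_. 0}" "lead z = lead b" by (rule imageE)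
    then have b: "b \<in> A" "b \<noteq> (\<lambda>_. 0)" "lead b = lead z" by simp_all
    have bB: "b \<in> B" using b AB by blast
    obtain \<sigma> where \<sigma>: "b \<sigma> \<noteq> 0" "to_nat \<sigma> = lead z" using lead_in[OF bB b(2)] b(3) by metis
    define y where "y = (\<lambda>\<tau>. z \<tau> + (- z \<sigma> / b \<sigma>) * b \<tau>)"
    have yB: "y \<in> B" unfolding y_def using z bB by (intro B) auto
    have "y \<notin> A"
    proof
      assume "y \<in> A"
      from A[OF this b(1), of "z \<sigma> / b \<sigma>"] show False using z by (simp add: y_def)
    qed
    moreover from this have "y \<noteq> (\<lambda>_. 0)" using A0 by blast
    then obtain \<tau> where \<tau>: "y \<tau> \<noteq> 0" "to_nat \<tau> = lead y" using lead_in[OF yB] by blast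
    have "y \<sigma> = 0" using \<sigma> by (simp add: y_def)
    then have "\<tau> \<noteq> \<sigma>" using \<tau> by blast
    moreover have "z \<tau> \<noteq> 0 \<or> b \<tau> \<noteq> 0" using \<tau> by (auto simp: y_def)
    then have "to_nat \<tau> \<le> lead z" using le_lead[of z \<tau>] le_lead[OF bB, of \<tau>] z b(3) by auto
    ultimately have "lead y < lead z" using \<tau> \<sigma> by (metis le_neq_implies_less to_nat_split)
    then show False using least[of y] yB \<open>y \<notin> A\<close> by simp
  qed
  moreover have "lead z \<in> lead ` (B - {\<lambda>_. 0})" using z znz by blast
  ultimately show ?thesis using AB by blast
qed

section \<open>Adding cells until one degree is exact\<close>

lemma scyc_support:
  assumes P: "is_poset Q le" and "x \<in> scyc le Q deg m U l c"
  shows "{\<sigma>. x \<sigma> \<noteq> 0} \<subseteq> chains le Q"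
proof (cases l)
  case 0
  then have "x \<sigma> = 0" if "\<sigma> \<noteq> []" for \<sigma> using assms(2) that by (simp add: scyc_def strand_0)
  then show ?thesis using Nil_in_chains by (metis (mono_tags, lifting) mem_Collect_eq subsetI)
next
  case (Suc n)
  then have "x \<in> conic le Q n" using assms(2) by (simp add: scyc_def strand_Suc hstrand_def)
  then show ?thesis using chainsp_nonzeroD[OF conic_chainsp[OF P]] by blast
qed

lemma good_cellsD:
  assumes "good_cells TYPE('k::field) le Q deg m U W"
  shows "hcw_poset TYPE('k) Q le" "poset_morphism m Q le deg" "is_poset Q le"
    "\<And>b. b \<in> Q \<Longrightarrow> deg b \<in> W" "\<And>b. b \<in> Q \<Longrightarrow> U (deg b)"
    "\<And>b n (x :: nat list \<Rightarrow> 'k). b \<in> Q \<Longrightarrow> x \<in> hstrand le Q deg m n (deg b) \<Longrightarrow>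
       push Q x = (\<lambda>_. 0) \<Longrightarrow> b \<notin> hsupp x"
  using assms hcw_is_poset unfolding good_cells_def by blast+

text \<open>The measure is the dimension of the homology at level \<open>l\<close>, counted by
  leading positions. Each attached cell keeps the cycles at this level and turns one that did not
  bound into a boundary.\<close>

lemma saturate_level:
  assumes "good_cells TYPE('k::field) le Q deg m U W"
    and up: "\<forall>c d. U c \<longrightarrow> vle m c d \<longrightarrow> U d"
    and \<alpha>: "\<alpha> \<in> W" and maximal: "\<forall>\<gamma>\<in>W. vle m \<alpha> \<gamma> \<longrightarrow> \<gamma> = \<alpha>"
    and "\<forall>b\<in>Q. deg b \<noteq> \<alpha> \<longrightarrow> dd le Q b < J"
    and "\<forall>j<l. exact_at TYPE('k) le Q deg m U j \<alpha>"
  shows "\<exists>le' Q' deg'. good_cells TYPE('k) le' Q' deg' m U W \<and>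
    (\<forall>b\<in>Q'. deg' b \<noteq> \<alpha> \<longrightarrow> dd le' Q' b < J) \<and>
    (\<forall>c j. \<not> vle m \<alpha> c \<longrightarrow> exact_at TYPE('k) le Q deg m U j c \<longrightarrow> exact_at TYPE('k) le' Q' deg' m U j c) \<and>
    (\<forall>j<Suc l. exact_at TYPE('k) le' Q' deg' m U j \<alpha>)"
  using assms(1,5,6)
proof (induction "card (lead ` ((scyc le Q deg m U l \<alpha> :: (nat list \<Rightarrow> 'k) set) - {\<lambda>_. 0}))
    - card (lead ` ((sbnd le Q deg m l \<alpha> :: (nat list \<Rightarrow> 'k) set) - {\<lambda>_. 0}))"
    arbitrary: le Q deg rule: less_induct)
  case (less le Q deg)
  note g = good_cellsD[OF less.prems(1)]
  show ?case
  proof (cases "exact_at TYPE('k) le Q deg m U l \<alpha>")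
    case True
    then have "\<forall>j<Suc l. exact_at TYPE('k) le Q deg m U j \<alpha>" using less.prems(3) by (simp add: less_Suc_eq)
    then show ?thesis using less.prems(1,2) by blast
  next
    case False
    have "\<exists>D (z :: nat list \<Rightarrow> 'k). new_link le Q deg m U l \<alpha> D z"
    proof (rule exists_new_link[OF g(1,2)])
      show "(scyc le Q deg m U j \<alpha> :: (nat list \<Rightarrow> 'k) set) \<subseteq> sbnd le Q deg m j \<alpha>" if "j < l" for j
        using less.prems(3) that by (simp add: exact_at_def)
      show "\<not> (scyc le Q deg m U l \<alpha> :: (nat list \<Rightarrow> 'k) set) \<subseteq> sbnd le Q deg m l \<alpha>"
        using False by (simp add: exact_at_def)
    qed
    then obtain D and z :: "nat list \<Rightarrow> 'k" where link: "new_link le Q deg m U l \<alpha> D z" by blast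
    obtain le1 Q1 deg1 where g1: "good_cells TYPE('k) le1 Q1 deg1 m U W"
      and J1: "\<forall>b\<in>Q1. deg1 b \<noteq> \<alpha> \<longrightarrow> dd le1 Q1 b < J"
      and keep: "\<forall>c j. \<not> vle m \<alpha> c \<longrightarrow> exact_at TYPE('k) le Q deg m U j c \<longrightarrow> exact_at TYPE('k) le1 Q1 deg1 m U j c"
      and below: "\<forall>j<l. exact_at TYPE('k) le Q deg m U j \<alpha> \<longrightarrow> exact_at TYPE('k) le1 Q1 deg1 m U j \<alpha>"
      and cyc: "scyc le1 Q1 deg1 m U l \<alpha> = (scyc le Q deg m U l \<alpha> :: (nat list \<Rightarrow> 'k) set)"
      and bnd: "(sbnd le Q deg m l \<alpha> :: (nat list \<Rightarrow> 'k) set) \<subset> sbnd le1 Q1 deg1 m l \<alpha>"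
      using attach_cell[OF less.prems(1) up \<alpha> maximal link less.prems(2)] by blast
    note h = good_cellsD[OF g1]
    let ?Z = "scyc le1 Q1 deg1 m U l \<alpha> :: (nat list \<Rightarrow> 'k) set"
    let ?B = "sbnd le Q deg m l \<alpha> :: (nat list \<Rightarrow> 'k) set"
    let ?B1 = "sbnd le1 Q1 deg1 m l \<alpha> :: (nat list \<Rightarrow> 'k) set"
    have BZ: "?B1 \<subseteq> ?Z" using h(5) up by (intro sbnd_subset_scyc[OF h(3,2)]) auto
    have fch: "finite (chains le1 Q1)" using h(3) by (simp add: is_poset_finite finite_chains)
    have fsupp: "finite {\<sigma>. x \<sigma> \<noteq> 0}" if "x \<in> ?Z" for x
      using scyc_support[OF h(3) that] fch finite_subset by blast
    have "lead ` (?Z - {\<lambda>_. 0}) \<subseteq> to_nat ` chains le1 Q1"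
    proof (rule image_subsetI)
      fix x assume x: "x \<in> ?Z - {\<lambda>_. 0}"
      then have "{\<sigma>. x \<sigma> \<noteq> 0} \<noteq> {}" by auto
      then have "lead x \<in> to_nat ` {\<sigma>. x \<sigma> \<noteq> 0}" unfolding lead_def using fsupp x by (intro Max_in) auto
      then show "lead x \<in> to_nat ` chains le1 Q1" using scyc_support[OF h(3), of x] x by blast
    qed
    then have finZ: "finite (lead ` (?Z - {\<lambda>_. 0}))" using fch finite_subset by blast
    have psub: "lead ` (?B - {\<lambda>_. 0}) \<subset> lead ` (?B1 - {\<lambda>_. 0})"
    proof (rule lead_image_psubset[OF _ _ _ _ bnd])
      show "finite {\<sigma>. x \<sigma> \<noteq> 0}" if "x \<in> ?B1" for x using that BZ fsupp by blast
    qed (simp_all add: sbnd_add_mult[OF g(3)] sbnd_zero[OF g(3)] sbnd_add_mult[OF h(3)])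
    have sub: "lead ` (?B1 - {\<lambda>_. 0}) \<subseteq> lead ` (?Z - {\<lambda>_. 0})" using BZ by blast
    have dec: "card (lead ` (?Z - {\<lambda>_. 0})) - card (lead ` (?B1 - {\<lambda>_. 0}))
      < card (lead ` ((scyc le Q deg m U l \<alpha> :: (nat list \<Rightarrow> 'k) set) - {\<lambda>_. 0})) - card (lead ` (?B - {\<lambda>_. 0}))"
      unfolding cyc[symmetric]
      using psubset_card_mono[OF finite_subset[OF sub finZ] psub] card_mono[OF finZ sub] by linarith
    have "\<forall>j<l. exact_at TYPE('k) le1 Q1 deg1 m U j \<alpha>" using below less.prems(3) by blast
    from less.hyps[OF dec g1 J1 this] keep show ?thesis by blast
  qed
qed

lemma saturate_below:
  assumes "good_cells TYPE('k::field) le Q deg m U W"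
    and up: "\<forall>c d. U c \<longrightarrow> vle m c d \<longrightarrow> U d"
    and \<alpha>: "\<alpha> \<in> W" and maximal: "\<forall>\<gamma>\<in>W. vle m \<alpha> \<gamma> \<longrightarrow> \<gamma> = \<alpha>"
    and "\<forall>b\<in>Q. deg b \<noteq> \<alpha> \<longrightarrow> dd le Q b < J"
  shows "\<exists>le' Q' deg'. good_cells TYPE('k) le' Q' deg' m U W \<and>
    (\<forall>b\<in>Q'. deg' b \<noteq> \<alpha> \<longrightarrow> dd le' Q' b < J) \<and>
    (\<forall>c j. \<not> vle m \<alpha> c \<longrightarrow> exact_at TYPE('k) le Q deg m U j c \<longrightarrow> exact_at TYPE('k) le' Q' deg' m U j c) \<and>
    (\<forall>j<L. exact_at TYPE('k) le' Q' deg' m U j \<alpha>)"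
proof (induction L)
  case 0
  show ?case using assms(1,5) by blast
next
  case (Suc L)
  then obtain le1 Q1 deg1 where 1: "good_cells TYPE('k) le1 Q1 deg1 m U W"
    "\<forall>b\<in>Q1. deg1 b \<noteq> \<alpha> \<longrightarrow> dd le1 Q1 b < J" "\<forall>j<L. exact_at TYPE('k) le1 Q1 deg1 m U j \<alpha>"
    and keep: "\<forall>c j. \<not> vle m \<alpha> c \<longrightarrow> exact_at TYPE('k) le Q deg m U j c \<longrightarrow> exact_at TYPE('k) le1 Q1 deg1 m U j c"
    by blast
  show ?case using saturate_level[OF 1(1) up \<alpha> maximal 1(2,3)] keep by metis
qed

lemma saturate_degree:
  assumes good: "good_cells TYPE('k::field) le Q deg m U W"
    and up: "\<forall>c d. U c \<longrightarrow> vle m c d \<longrightarrow> U d"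
    and \<alpha>: "\<alpha> \<in> W" and maximal: "\<forall>\<gamma>\<in>W. vle m \<alpha> \<gamma> \<longrightarrow> \<gamma> = \<alpha>"
  shows "\<exists>le' Q' deg'. good_cells TYPE('k) le' Q' deg' m U W \<and>
    (\<forall>c j. \<not> vle m \<alpha> c \<longrightarrow> exact_at TYPE('k) le Q deg m U j c \<longrightarrow> exact_at TYPE('k) le' Q' deg' m U j c) \<and>
    (\<forall>j. exact_at TYPE('k) le' Q' deg' m U j \<alpha>)"
proof -
  have fQ: "finite Q" using is_poset_finite[OF good_cellsD(3)[OF good]] .
  \<comment> \<open>\<open>J\<close> exceeds all dimensions present before degree \<alpha> is
    treated; every later cell has degree \<alpha>. So cells of dimension at least \<open>J\<close>
    all have degree \<alpha>.\<close>
  define J where "J = Suc (Max (insert 0 (dd le Q ` Q)))"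
  have "\<forall>b\<in>Q. deg b \<noteq> \<alpha> \<longrightarrow> dd le Q b < J"
    unfolding J_def using fQ by (auto simp: less_Suc_eq_le intro!: Max_ge)
  from saturate_below[OF good up \<alpha> maximal this, where L = "Suc J"]
  obtain le1 Q1 deg1 where g1: "good_cells TYPE('k) le1 Q1 deg1 m U W"
    and J1: "\<forall>b\<in>Q1. deg1 b \<noteq> \<alpha> \<longrightarrow> dd le1 Q1 b < J" and ex: "\<forall>j<Suc J. exact_at TYPE('k) le1 Q1 deg1 m U j \<alpha>"
    and keep: "\<forall>c j. \<not> vle m \<alpha> c \<longrightarrow> exact_at TYPE('k) le Q deg m U j c \<longrightarrow> exact_at TYPE('k) le1 Q1 deg1 m U j c"
    by blast
  note h = good_cellsD[OF g1]
  have "exact_at TYPE('k) le1 Q1 deg1 m U j \<alpha>" for j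
  proof (cases "j < Suc J")
    \<comment> \<open>Beyond level \<open>J\<close> a cycle could use only cells of degree \<alpha>,
      which the invariant forbids in this degree; it is therefore zero.\<close>
    case False
    then obtain n where j: "j = Suc n" "J \<le> n" by (cases j) auto
    have "x \<in> sbnd le1 Q1 deg1 m j \<alpha>" if x: "x \<in> scyc le1 Q1 deg1 m U j \<alpha>" for x :: "nat list \<Rightarrow> 'k"
    proof -
      have x': "x \<in> hstrand le1 Q1 deg1 m n \<alpha>" "push Q1 x = (\<lambda>_. 0)"
        using x j by (auto simp: scyc_def strand_Suc)
      have "b \<notin> hsupp x" for b
      proof
        assume b: "b \<in> hsupp x"
        then have bQ: "b \<in> Q1" "dd le1 Q1 b = n"
          using hstrand_nonzeroD(1,2)[OF h(3) x'(1)] by (auto simp: hsupp_def)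
        then have "deg1 b = \<alpha>" using J1 j by force
        then show False using h(6)[OF bQ(1), of x n] x' b by simp
      qed
      then have "x = (\<lambda>_. 0)" by (intro hstrand_eq_zero[OF h(3) x'(1)]) blast
      then show ?thesis by (simp add: sbnd_zero[OF h(3)])
    qed
    then show ?thesis unfolding exact_at_def by (rule subsetI)
  qed (use ex in blast)
  then show ?thesis using g1 keep by blast
qed

lemma good_cells_mono: "good_cells K le Q deg m U W \<Longrightarrow> W \<subseteq> W' \<Longrightarrow> good_cells K le Q deg m U W'"
  unfolding good_cells_def by blast

text \<open>Degrees are added by increasing coordinate sum, so each new one is maximal among those
  present. The vanishing of coordinates from \<open>m\<close> on is what makes \<open>vle\<close>
  antisymmetric on \<open>W\<close>.\<close>

lemma exists_resolution_on:
  fixes W :: "(nat \<Rightarrow> int) set"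
  assumes fin: "finite W" and W: "\<And>c i. c \<in> W \<Longrightarrow> m \<le> i \<Longrightarrow> c i = 0"
    and up: "\<forall>c d. U c \<longrightarrow> vle m c d \<longrightarrow> U d"
  shows "\<exists>le Q deg. good_cells TYPE('k::field) le Q deg m U W \<and> (\<forall>c\<in>W. \<forall>j. exact_at TYPE('k) le Q deg m U j c)"
  using fin W
proof (induction W rule: finite_ranking_induct[where f = "\<lambda>c. \<Sum>i<m. c i"])
  case empty
  have "good_cells TYPE('k) (\<lambda>_ _. True) {} (\<lambda>_ _. 0) m U {}"
    by (simp add: good_cells_def hcw_poset_def is_poset_def poset_morphism_def)
  then show ?case by blast
next
  case (insert \<alpha> W)
  from insert.IH insert.prems obtain le Q deg where good: "good_cells TYPE('k) le Q deg m U W"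
    and ex: "\<forall>c\<in>W. \<forall>j. exact_at TYPE('k) le Q deg m U j c" by blast
  have maximal: "\<forall>\<gamma>\<in>insert \<alpha> W. vle m \<alpha> \<gamma> \<longrightarrow> \<gamma> = \<alpha>"
  proof (intro ballI impI, rule ccontr)
    fix \<gamma> assume that: "\<gamma> \<in> insert \<alpha> W" "vle m \<alpha> \<gamma>"
    assume "\<gamma> \<noteq> \<alpha>"
    then have "\<gamma> \<in> W" using that by blast
    then have sum: "(\<Sum>i<m. \<gamma> i) \<le> (\<Sum>i<m. \<alpha> i)" using insert.hyps by blast
    have le: "\<And>i. i < m \<Longrightarrow> \<alpha> i \<le> \<gamma> i" using that(2) by (simp add: vle_def)
    have "\<gamma> i = \<alpha> i" for i
    proof (cases "i < m")
      case True
      show ?thesis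
      proof (rule ccontr)
        assume "\<gamma> i \<noteq> \<alpha> i"
        then have "\<alpha> i < \<gamma> i" using le[OF True] by simp
        then have "(\<Sum>i<m. \<alpha> i) < (\<Sum>i<m. \<gamma> i)" using le True by (intro sum_strict_mono_ex1) auto
        then show False using sum by simp
      qed
    next
      case False
      then show ?thesis using insert.prems[of \<gamma> i] insert.prems[of \<alpha> i] \<open>\<gamma> \<in> W\<close> by simp
    qed
    then show False using \<open>\<gamma> \<noteq> \<alpha>\<close> by blast
  qed
  have good': "good_cells TYPE('k) le Q deg m U (insert \<alpha> W)" by (rule good_cells_mono[OF good]) blast
  obtain le1 Q1 deg1 where g1: "good_cells TYPE('k) le1 Q1 deg1 m U (insert \<alpha> W)"
    and keep: "\<forall>c j. \<not> vle m \<alpha> c \<longrightarrow> exact_at TYPE('k) le Q deg m U j c \<longrightarrow> exact_at TYPE('k) le1 Q1 deg1 m U j c"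
    and new: "\<forall>j. exact_at TYPE('k) le1 Q1 deg1 m U j \<alpha>"
    using saturate_degree[OF good' up insertI1 maximal] by blast
  have "exact_at TYPE('k) le1 Q1 deg1 m U j c" if "c \<in> insert \<alpha> W" for j c
  proof (cases "c = \<alpha>")
    case False
    then have "c \<in> W" "\<not> vle m \<alpha> c" using that maximal by blast+
    then show ?thesis using ex keep by blast
  qed (use new in simp)
  then show ?case using g1 by blast
qed

section \<open>Monomial ideals\<close>

text \<open>Dickson's lemma. A finite set \<open>H\<close> dominates in the first \<open>m\<close>
  coordinates and handles every element whose last coordinate is at least the maximum
  \<open>M\<close> over \<open>H\<close>; each of the finitely many slices below \<open>M\<close>
  has its own finite set.\<close>

lemma finite_dominating_subset:
  fixes f :: "'a \<Rightarrow> nat \<Rightarrow> nat"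
  shows "\<exists>H\<subseteq>G. finite H \<and> (\<forall>g\<in>G. \<exists>h\<in>H. \<forall>i<m. f h i \<le> f g i)"
proof (induction m arbitrary: G)
  case 0
  show ?case
  proof (cases "G = {}")
    case False
    then obtain g where "g \<in> G" by blast
    then show ?thesis by (intro exI[of _ "{g}"]) auto
  qed auto
next
  case (Suc m)
  obtain H where H: "H \<subseteq> G" "finite H" "\<forall>g\<in>G. \<exists>h\<in>H. \<forall>i<m. f h i \<le> f g i"
    using Suc.IH[of G] by blast
  define M where "M = Max (insert 0 ((\<lambda>h. f h m) ` H))"
  have M: "f h m \<le> M" if "h \<in> H" for h unfolding M_def using H that by (intro Max_ge) auto
  have "\<exists>H\<subseteq>{g \<in> G. f g m = t}. finite H \<and> (\<forall>g\<in>{g \<in> G. f g m = t}. \<exists>h\<in>H. \<forall>i<m. f h i \<le> f g i)" for t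
    by (rule Suc.IH)
  then obtain K where K: "\<And>t. K t \<subseteq> {g \<in> G. f g m = t}" "\<And>t. finite (K t)"
    "\<And>t. \<forall>g\<in>{g \<in> G. f g m = t}. \<exists>h\<in>K t. \<forall>i<m. f h i \<le> f g i" by metis
  have "\<exists>h\<in>H \<union> (\<Union>t<M. K t). \<forall>i<Suc m. f h i \<le> f g i" if g: "g \<in> G" for g
  proof (cases "f g m < M")
    case True
    obtain h where h: "h \<in> K (f g m)" "\<forall>i<m. f h i \<le> f g i" using K(3) g by blast
    then have "f h m = f g m" using K(1) by blast
    then show ?thesis using h True by (intro bexI[of _ h]) (auto simp: less_Suc_eq)
  next
    case False
    obtain h where h: "h \<in> H" "\<forall>i<m. f h i \<le> f g i" using H g by blast
    then have "f h m \<le> f g m" using M[of h] False by linarith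
    then show ?thesis using h by (intro bexI[of _ h]) (auto simp: less_Suc_eq)
  qed
  moreover have "H \<union> (\<Union>t<M. K t) \<subseteq> G" using H(1) K(1) by blast
  moreover have "finite (H \<union> (\<Union>t<M. K t))" using H(2) K(2) by simp
  ultimately show ?case by blast
qed

lemma exists_exponent_bound:
  fixes f :: "'a \<Rightarrow> nat \<Rightarrow> nat"
  shows "\<exists>N. \<forall>g\<in>G. \<exists>h\<in>G. \<forall>i<m. f h i \<le> f g i \<and> f h i \<le> N"
proof -
  obtain H where H: "H \<subseteq> G" "finite H" "\<forall>g\<in>G. \<exists>h\<in>H. \<forall>i<m. f h i \<le> f g i"
    using finite_dominating_subset[of G m f] by blast
  define N where "N = Max (insert 0 ((\<lambda>(h, i). f h i) ` (H \<times> {..<m})))"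
  have N: "f h i \<le> N" if "h \<in> H" "i < m" for h i
    unfolding N_def using H that by (intro Max_ge) (auto intro!: rev_image_eqI[of "(h, i)"])
  show ?thesis
  proof (intro exI[of _ N] ballI)
    fix g assume "g \<in> G"
    then obtain h where "h \<in> H" "\<forall>i<m. f h i \<le> f g i" using H by blast
    then show "\<exists>h\<in>G. \<forall>i<m. f h i \<le> f g i \<and> f h i \<le> N" using H(1) N by blast
  qed
qed

text \<open>Membership of the monomial of degree \<open>c\<close> in the ideal generated by
  \<open>G\<close>. Comparing as integers excludes every \<open>c\<close> with a negative coordinate
  below \<open>m\<close>.\<close>

definition ideal_degree :: "(nat \<Rightarrow>\<^sub>0 nat) set \<Rightarrow> nat \<Rightarrow> (nat \<Rightarrow> int) \<Rightarrow> bool" where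
  "ideal_degree G m c \<longleftrightarrow> (\<exists>g\<in>G. \<forall>i<m. int (Poly_Mapping.lookup g i) \<le> c i)"

lemma ideal_degree_up: "ideal_degree G m c \<Longrightarrow> vle m c d \<Longrightarrow> ideal_degree G m d"
  unfolding ideal_degree_def vle_def by (meson order_trans)

text \<open>There is a single monomial of degree \<open>c\<close>. If it occurs in a combination of
  generators, it occurs in one summand and is thus a multiple of that generator.\<close>

lemma monomial_ideal_strand:
  fixes I :: "((nat \<Rightarrow>\<^sub>0 nat) \<Rightarrow>\<^sub>0 'k::field) set"
  assumes G: "\<forall>u\<in>G. Poly_Mapping.keys u \<subseteq> {..<m}"
    and I: "I = {p. \<exists>F r. finite F \<and> F \<subseteq> G \<and> (\<forall>g\<in>F. r g \<in> Rpoly m) \<and> p = (\<Sum>g\<in>F. r g * Defs.monom g)}"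
    and u: "Poly_Mapping.keys u \<subseteq> {..<m}" "\<forall>i<m. c i = int (Poly_Mapping.lookup u i)"
  shows "I \<inter> Rdeg m c = {Poly_Mapping.single u r | r. r = 0 \<or> ideal_degree G m c}"
proof (intro set_eqI iffI)
  have ueq: "v = u" if "Poly_Mapping.keys v \<subseteq> {..<m}" "\<forall>i<m. int (Poly_Mapping.lookup v i) = c i" for v
  proof (rule poly_mapping_eqI)
    fix i show "Poly_Mapping.lookup v i = Poly_Mapping.lookup u i"
    proof (cases "i < m")
      case False
      then have "i \<notin> Poly_Mapping.keys v" "i \<notin> Poly_Mapping.keys u" using that u by auto
      then show ?thesis by (simp add: in_keys_iff)
    qed (use that u in auto)
  qed
  fix p :: "(nat \<Rightarrow>\<^sub>0 nat) \<Rightarrow>\<^sub>0 'k" assume p: "p \<in> I \<inter> Rdeg m c"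
  have "Poly_Mapping.keys p \<subseteq> {u}" using p ueq unfolding Rdeg_def by blast
  then have pu: "p = Poly_Mapping.single u (Poly_Mapping.lookup p u)"
    by (intro poly_mapping_eqI) (auto simp: lookup_single when_def in_keys_iff)
  have "ideal_degree G m c" if nz: "Poly_Mapping.lookup p u \<noteq> 0"
  proof -
    obtain F r where F: "F \<subseteq> G" "p = (\<Sum>g\<in>F. r g * Defs.monom g)" using p I by blast
    have "u \<in> Poly_Mapping.keys (\<Sum>g\<in>F. r g * Defs.monom g)" using nz unfolding F(2)[symmetric] in_keys_iff .
    from subsetD[OF keys_sum this] obtain g where
      g: "g \<in> F" "u \<in> Poly_Mapping.keys (r g * Defs.monom g)" by (rule UN_E)
    have "Poly_Mapping.keys (Defs.monom g :: (nat \<Rightarrow>\<^sub>0 nat) \<Rightarrow>\<^sub>0 'k) = {g}" by (simp add: Defs.monom_def)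
    with subsetD[OF keys_mult g(2)] obtain v where "u = v + g" by auto
    then have "\<forall>i<m. int (Poly_Mapping.lookup g i) \<le> c i" using u by (simp add: lookup_add)
    then show ?thesis using g F unfolding ideal_degree_def by blast
  qed
  then show "p \<in> {Poly_Mapping.single u r | r. r = 0 \<or> ideal_degree G m c}" using pu by blast
next
  fix p :: "(nat \<Rightarrow>\<^sub>0 nat) \<Rightarrow>\<^sub>0 'k" assume "p \<in> {Poly_Mapping.single u r | r. r = 0 \<or> ideal_degree G m c}"
  then obtain r where p: "p = Poly_Mapping.single u r" and r: "r = 0 \<or> ideal_degree G m c" by blast
  have "p \<in> Rdeg m c" using u p by (auto simp: Rdeg_def split: if_splits)
  moreover have "p \<in> I"
  proof (cases "r = 0")
    case True
    show ?thesis unfolding I p True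
      by (intro CollectI exI[of _ "{}"] exI[of _ "\<lambda>_. 0"]) simp
  next
    case False
    then obtain g where g: "g \<in> G" "\<forall>i<m. int (Poly_Mapping.lookup g i) \<le> c i" using r unfolding ideal_degree_def by blast
    have "u - g + g = u"
    proof (rule poly_mapping_eqI)
      fix i show "Poly_Mapping.lookup (u - g + g) i = Poly_Mapping.lookup u i"
      proof (cases "i < m")
        case False
        then have "i \<notin> Poly_Mapping.keys g" using g(1) G by auto
        then show ?thesis by (simp add: lookup_add lookup_minus in_keys_iff)
      qed (use g u in \<open>simp add: lookup_add lookup_minus\<close>)
    qed
    then have "p = Poly_Mapping.single (u - g) r * Defs.monom g" by (simp add: p Defs.monom_def mult_single)
    moreover have "Poly_Mapping.keys (u - g) \<subseteq> {..<m}"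
    proof
      fix i assume "i \<in> Poly_Mapping.keys (u - g)"
      then have "i \<in> Poly_Mapping.keys u" by (auto simp: in_keys_iff lookup_minus)
      then show "i \<in> {..<m}" using u by blast
    qed
    then have "Poly_Mapping.single (u - g) r \<in> Rpoly m" by (auto simp: Rpoly_def split: if_splits)
    ultimately show ?thesis unfolding I using g
      by (intro CollectI exI[of _ "{g}"] exI[of _ "\<lambda>_. Poly_Mapping.single (u - g) r"]) simp
  qed
  ultimately show "p \<in> I \<inter> Rdeg m c" by blast
qed

lemma exists_resolution:
  fixes G :: "(nat \<Rightarrow>\<^sub>0 nat) set"
  shows "\<exists>W le Q deg. (\<forall>c\<in>W. \<forall>i\<ge>m. c i = 0) \<and> good_cells TYPE('k::field) le Q deg m (ideal_degree G m) W \<and>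
    (\<forall>c j. exact_at TYPE('k) le Q deg m (ideal_degree G m) j c)"
proof -
  obtain N where N: "\<forall>g\<in>G. \<exists>h\<in>G. \<forall>i<m. Poly_Mapping.lookup h i \<le> Poly_Mapping.lookup g i \<and> Poly_Mapping.lookup h i \<le> N"
    using exists_exponent_bound[of G m Poly_Mapping.lookup] by blast
  define W where "W = {c :: nat \<Rightarrow> int. \<forall>i. (i \<in> {..<m} \<longrightarrow> c i \<in> {0..int N}) \<and> (i \<notin> {..<m} \<longrightarrow> c i = 0)}"
  have "finite W" unfolding W_def by (rule finite_set_of_finite_funs) auto
  moreover have W0: "c i = 0" if "c \<in> W" "m \<le> i" for c i using that by (simp add: W_def)
  moreover have "\<forall>c d. ideal_degree G m c \<longrightarrow> vle m c d \<longrightarrow> ideal_degree G m d" using ideal_degree_up by blast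
  ultimately obtain le Q deg where good: "good_cells TYPE('k) le Q deg m (ideal_degree G m) W"
    and ex: "\<forall>c\<in>W. \<forall>j. exact_at TYPE('k) le Q deg m (ideal_degree G m) j c"
    using exists_resolution_on[of W m "ideal_degree G m", where 'k = 'k] by blast
  note g = good_cellsD[OF good]
  have degW: "0 \<le> deg b i \<and> deg b i \<le> int N" if "b \<in> Q" "i < m" for b i
    using g(4)[OF that(1)] that(2) by (simp add: W_def)
  have "exact_at TYPE('k) le Q deg m (ideal_degree G m) j c" for c j
  proof (cases "\<forall>i<m. 0 \<le> c i")
    case True
    \<comment> \<open>Truncation to the box changes nothing: all cell degrees lie in the box, and by
      the choice of \<open>N\<close> the generators with exponents at most \<open>N\<close> decide
      membership in the ideal.\<close>
    define c' where "c' i = (if i < m then min (c i) (int N) else 0)" for i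
    have "c' \<in> W" using True by (auto simp: W_def c'_def)
    then have e: "exact_at TYPE('k) le Q deg m (ideal_degree G m) j c'" using ex by blast
    have v: "vle m (deg b) c' \<longleftrightarrow> vle m (deg b) c" if "b \<in> Q" for b
      using degW[OF that] by (auto simp: vle_def c'_def)
    have h: "hstrand le Q deg m n c' = (hstrand le Q deg m n c :: (nat list \<Rightarrow> 'k) set)" for n
    proof -
      have "(a \<in> Q \<and> dd le Q a = n \<and> vle m (deg a) c') = (a \<in> Q \<and> dd le Q a = n \<and> vle m (deg a) c)" for a
        using v by blast
      then show ?thesis unfolding set_eq_iff hstrand_iff[OF g(3)] by simp
    qed
    have "ideal_degree G m c' \<longleftrightarrow> ideal_degree G m c"
    proof
      assume "ideal_degree G m c'"
      then show "ideal_degree G m c" by (rule ideal_degree_up) (simp add: vle_def c'_def)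
    next
      assume "ideal_degree G m c"
      then obtain f where f: "f \<in> G" "\<forall>i<m. int (Poly_Mapping.lookup f i) \<le> c i" unfolding ideal_degree_def by blast
      obtain h where h: "h \<in> G" "\<forall>i<m. Poly_Mapping.lookup h i \<le> Poly_Mapping.lookup f i \<and> Poly_Mapping.lookup h i \<le> N" using N f by blast
      have "int (Poly_Mapping.lookup h i) \<le> c' i" if "i < m" for i using h f that by (force simp: c'_def)
      then show "ideal_degree G m c'" using h unfolding ideal_degree_def by blast
    qed
    then have "strand le Q deg m (ideal_degree G m) j c' = (strand le Q deg m (ideal_degree G m) j c :: (nat list \<Rightarrow> 'k) set)"
      by (cases j) (simp_all add: strand_def h)
    then show ?thesis using e by (simp add: exact_at_def scyc_def sbnd_def h)
  next
    \<comment> \<open>With a negative coordinate no cell has degree at most \<open>c\<close> and no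
      monomial exists, so every level is zero.\<close>
    case False
    then obtain i where i: "i < m" "c i < 0" by force
    have nU: "\<not> ideal_degree G m c" using i unfolding ideal_degree_def by force
    have "x = (\<lambda>_. 0)" if x: "x \<in> scyc le Q deg m (ideal_degree G m) j c" for x :: "nat list \<Rightarrow> 'k"
    proof (cases j)
      case 0
      show ?thesis
      proof
        fix \<sigma> show "x \<sigma> = 0" using x nU 0 by (cases "\<sigma> = []") (simp_all add: scyc_def strand_0)
      qed
    next
      case (Suc n)
      then have xh: "x \<in> hstrand le Q deg m n c" using x by (simp add: scyc_def strand_Suc)
      have "b \<notin> hsupp x" for b
      proof
        assume "b \<in> hsupp x"
        then have "b \<in> Q" "vle m (deg b) c" using hstrand_nonzeroD(1,3)[OF g(3) xh] by (auto simp: hsupp_def)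
        then show False using degW[of b i] i by (auto simp: vle_def)
      qed
      then show ?thesis by (intro hstrand_eq_zero[OF g(3) xh]) blast
    qed
    then show ?thesis unfolding exact_at_def using sbnd_zero[OF g(3)] by blast
  qed
  then show ?thesis using good W0 by blast
qed

lemma homog_min_free_resI:
  fixes I :: "((nat \<Rightarrow>\<^sub>0 nat) \<Rightarrow>\<^sub>0 'k::field) set"
  assumes G: "\<forall>u\<in>G. Poly_Mapping.keys u \<subseteq> {..<m}"
    and I: "I = {p. \<exists>F r. finite F \<and> F \<subseteq> G \<and> (\<forall>g\<in>F. r g \<in> Rpoly m) \<and> p = (\<Sum>g\<in>F. r g * Defs.monom g)}"
    and W: "\<forall>c\<in>W. \<forall>i\<ge>m. c i = 0"
    and good: "good_cells TYPE('k) le Q deg m (ideal_degree G m) W"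
    and exact: "\<forall>c j. exact_at TYPE('k) le Q deg m (ideal_degree G m) j c"
  shows "homog_min_free_res m I Q le deg"
proof -
  note g = good_cellsD[OF good]
  let ?U = "ideal_degree G m"
  have eq: "scyc le Q deg m ?U j c = (sbnd le Q deg m j c :: (nat list \<Rightarrow> 'k) set)" for j c
  proof
    show "(sbnd le Q deg m j c :: (nat list \<Rightarrow> 'k) set) \<subseteq> scyc le Q deg m ?U j c"
      by (rule sbnd_subset_scyc[OF g(3,2)]) (use g(5) ideal_degree_up in blast)+
  qed (use exact in \<open>simp add: exact_at_def\<close>)
  have bd_eq: "bd le Q n ` hstrand le Q deg m n c = (sbnd le Q deg m n c :: (nat list \<Rightarrow> 'k) set)" for n c
    unfolding sbnd_def by (rule image_cong[OF refl], rule bd_conic[OF g(3) hstrand_conic])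
  have cyc: "{x \<in> hstrand le Q deg m n c. bd le Q n x = (\<lambda>_. 0)} = (scyc le Q deg m ?U (Suc n) c :: (nat list \<Rightarrow> 'k) set)" for n c
    unfolding scyc_def strand_Suc
    by (intro Collect_cong conj_cong refl) (simp add: bd_conic[OF g(3) hstrand_conic[of _ le Q deg m n c]])
  have aug: "push Q x = (\<lambda>_. 0) \<longleftrightarrow> (\<Sum>a\<in>Q. x [a]) = 0" if "x \<in> hstrand le Q deg m 0 c" for x :: "nat list \<Rightarrow> 'k" and c
  proof -
    have "push Q x \<sigma> = 0" if "\<sigma> \<noteq> []" for \<sigma>
      unfolding push_def using hstrand_nonzeroD(5)[OF g(3) \<open>x \<in> _\<close>] that by (intro sum.neutral) auto
    moreover have "push Q x [] = (\<Sum>a\<in>Q. x [a])" by (simp add: push_def)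
    ultimately show ?thesis by (metis (full_types))
  qed
  have image: "(\<lambda>x :: nat list \<Rightarrow> 'k. \<Sum>a\<in>Q. x [a]) ` hstrand le Q deg m 0 c = {r. r = 0 \<or> ?U c}" for c
  proof -
    have "(\<lambda>x :: nat list \<Rightarrow> 'k. \<Sum>a\<in>Q. x [a]) ` hstrand le Q deg m 0 c = (\<lambda>y :: nat list \<Rightarrow> 'k. y []) ` sbnd le Q deg m 0 c"
      unfolding sbnd_def image_image push_def ..
    also have "\<dots> = (\<lambda>y :: nat list \<Rightarrow> 'k. y []) ` {x. (\<forall>\<sigma>. \<sigma> \<noteq> [] \<longrightarrow> x \<sigma> = 0) \<and> (\<not> ?U c \<longrightarrow> x [] = 0)}"
      unfolding eq[symmetric] scyc_def strand_def by simp
    also have "\<dots> = {r. r = 0 \<or> ?U c}"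
    proof (intro set_eqI iffI)
      fix r :: 'k assume r: "r \<in> {r. r = 0 \<or> ?U c}"
      show "r \<in> (\<lambda>y :: nat list \<Rightarrow> 'k. y []) ` {x. (\<forall>\<sigma>. \<sigma> \<noteq> [] \<longrightarrow> x \<sigma> = 0) \<and> (\<not> ?U c \<longrightarrow> x [] = 0)}"
        by (rule image_eqI[of _ _ "\<lambda>\<sigma>. if \<sigma> = [] then r else 0"]) (use r in auto)
    qed auto
    finally show ?thesis .
  qed
  have minimal: "fcomp le Q n b x = (\<lambda>_. 0)"
    if n: "1 \<le> n" and ab: "a \<in> Q" "b \<in> Q" "\<forall>i<m. deg b i = deg a i" and x: "x \<in> Fna le Q n a"
    for n a b and x :: "nat list \<Rightarrow> 'k"
  proof -
    have deg: "deg b = deg a"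
    proof
      fix i show "deg b i = deg a i" using ab W[rule_format, OF g(4), of _ i] by (cases "i < m") auto
    qed
    obtain k where k: "n = Suc k" using n by (cases n) auto
    \<comment> \<open>The equal degrees put \<open>x\<close> into the strand of degree
      \<open>deg b\<close>; its boundary is a cycle there and so avoids the cell
      \<open>b\<close>.\<close>
    have "x \<in> hstrand le Q deg m (Suc k) (deg b)"
      using x k unfolding deg by (auto simp: hstrand_def Fna_def vle_def)
    note x = this
    have "b \<notin> hsupp (push Q x)"
      by (rule g(6)[OF ab(2) push_hstrand[OF g(3,2) x] push_push[OF g(3,2) x]])
    moreover have "bd le Q n x = push Q x" unfolding k by (rule bd_conic[OF g(3) hstrand_conic[OF x]])
    ultimately have "bd le Q n x (b # \<tau>) = 0" for \<tau> by (simp add: hsupp_def)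
    then have "bd le Q n x \<sigma> = 0" if "\<sigma> \<noteq> [] \<and> hd \<sigma> = b" for \<sigma> using that by (cases \<sigma>) auto
    then show ?thesis unfolding fcomp_def by (simp add: fun_eq_iff)
  qed
  show ?thesis
    unfolding homog_min_free_res_def
  \<comment> \<open>All augmentation coefficients are 1, because \<open>push\<close> in homological
    degree 0 simply adds the coefficients.\<close>
  proof (intro conjI exI[of _ "\<lambda>_. 1"] ballI allI impI)
    show "nonneg m (deg a)" if "a \<in> Q" for a
      using g(5)[OF that] unfolding ideal_degree_def nonneg_def by (meson of_nat_0_le_iff order_trans)
    fix c
    show "I \<inter> Rdeg m c = (\<lambda>x. Poly_Mapping.single u (\<Sum>a\<in>Q. 1 * x [a])) ` hstrand le Q deg m 0 c"
      if u: "Poly_Mapping.keys u \<subseteq> {..<m} \<and> (\<forall>i<m. c i = int (Poly_Mapping.lookup u i))" for u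
    proof -
      have "I \<inter> Rdeg m c = Poly_Mapping.single u ` {r. r = 0 \<or> ?U c}"
        using monomial_ideal_strand[OF G I] u by blast
      also have "\<dots> = (\<lambda>x. Poly_Mapping.single u (\<Sum>a\<in>Q. 1 * x [a])) ` hstrand le Q deg m 0 c"
        unfolding image[symmetric] image_image by simp
      finally show ?thesis .
    qed
    show "{x \<in> hstrand le Q deg m 0 c. (\<Sum>a\<in>Q. 1 * x [a]) = (0::'k)} = bd le Q 1 ` hstrand le Q deg m 1 c"
      unfolding bd_eq eq[symmetric] One_nat_def scyc_def strand_Suc using aug by auto
    show "{x \<in> (hstrand le Q deg m n c :: (nat list \<Rightarrow> 'k) set). bd le Q n x = (\<lambda>_. 0)} =
        bd le Q (Suc n) ` hstrand le Q deg m (Suc n) c" for n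
      unfolding cyc eq bd_eq ..
  qed (use minimal in blast)
qed

theorem mainTheorem12:
  fixes m :: nat and I :: "((nat \<Rightarrow>\<^sub>0 nat) \<Rightarrow>\<^sub>0 'k::field) set"
  assumes "monomial_ideal m I"
  shows "\<exists>(Q :: nat set) (le :: nat \<Rightarrow> nat \<Rightarrow> bool) (deg :: nat \<Rightarrow> nat \<Rightarrow> int).
           hcw_poset TYPE('k) Q le \<and> poset_morphism m Q le deg \<and> homog_min_free_res m I Q le deg"
proof -
  obtain G where G: "\<forall>u\<in>G. Poly_Mapping.keys u \<subseteq> {..<m}"
    and I: "I = {p. \<exists>F r. finite F \<and> F \<subseteq> G \<and> (\<forall>g\<in>F. r g \<in> Rpoly m) \<and> p = (\<Sum>g\<in>F. r g * Defs.monom g)}"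
    using assms unfolding monomial_ideal_def by blast
  obtain W le Q deg where W: "\<forall>c\<in>W. \<forall>i\<ge>m. c i = 0"
    and good: "good_cells TYPE('k) le Q deg m (ideal_degree G m) W"
    and exact: "\<forall>c j. exact_at TYPE('k) le Q deg m (ideal_degree G m) j c"
    using exists_resolution[of m G, where 'k = 'k] by blast
  show ?thesis
    using good_cellsD(1,2)[OF good] homog_min_free_resI[OF G I W good exact] by blast
qed

end
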